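(* Let $\mathbf{k}$ be a unitary commutative ring, $\lambda\in\mathbf{k}$, and let $A=\bigcup_{n\ge0}A^n$ be a (commutative) connected filtered left counital bialgebra over $\mathbf{k}$, with comultiplication $\Delta_A$ and left counit $\varepsilon_A$. Let $(\mathrm{Sh}(A),\diamond_\lambda,\mu_\lambda,\Delta_\lambda,\varepsilon_\lambda,P_\lambda)$ be as defined in the context. Then $\mathrm{Sh}(A)$ is a left counital Hopf algebra.
   Context: All algebras are unitary, commutative and associative over $\mathbf{k}$; algebra homomorphisms preserve units; tensor products and linear maps are over $\mathbf{k}$. Definitions. A left counital bialgebra is $(H,m,\mu,\Delta,\varepsilon)$ where $(H,m,\mu)$ is an algebra with unit map $\mu:\mathbf{k}\to H$, $\Delta:H\to H\otimes H$ is linear and coassociative, $\varepsilon:H\to\mathbf{k}$ is linear with $(\varepsilon\otimes\mathrm{id})\Delta(x)=1\otimes x$ for all $x\in H$ (right counitality is not assumed), and $\Delta$, $\varepsilon$ are algebra homomorphisms. With an additional linear operator $P:H\to H$ it is called a left counital operated bialgebra. It is filtered if there is an increasing filtration $H^0\subseteq H^1\subseteq\cdots$ by submodules with $\bigcup_{n\ge0}H^n=H$, $H^pH^q\subseteq H^{p+q}$ and $\Delta(H^n)\subseteq H^0\otimes H^n+\sum_{p+q=n,\,p>0,\,q>0}H^p\otimes H^q$ (tensor products on the right understood as images in $H\otimes H$); it is connected if $H^0=\operatorname{im}\mu=\mathbf{k}1_H$. (In $A=\bigcup_n A^n$, $A^n$ denotes the filtration, not a tensor power.) A right antipode is a linear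 map $S:H\to H$ with $\mathrm{id}_H\ast S=\mu\varepsilon$, where $f\ast g=m(f\otimes g)\Delta$. A left counital Hopf algebra is a left counital operated bialgebra that has a right antipode. $\lambda$-TD shuffle product. Let $\mathrm{Sh}^+(A)=\bigoplus_{n\ge 0}A^{\otimes n}$, $A^{\otimes 0}=\mathbf{k}$. The bilinear operation $\odot$ on $\mathrm{Sh}^+(A)$ is defined recursively on pure tensors: if one factor is a scalar $c\in\mathbf{k}=A^{\otimes 0}$, then $\odot$ is scalar multiplication by $c$ on the other factor; if $\mathfrak a=a_1\otimes\mathfrak a'\in A^{\otimes m}$, $\mathfrak b=b_1\otimes\mathfrak b'\in A^{\otimes n}$, $m,n\ge 1$, $\mathfrak a'\in A^{\otimes(m-1)}$, $\mathfrak b'\in A^{\otimes(n-1)}$ (for $m=1$ take $\mathfrak a'=1_{\mathbf k}$, similarly for $\mathfrak b'$; $a\otimes c$ with $c\in\mathbf k$ is identified with $ca$), then $$\mathfrak a\odot\mathfrak b=a_1\otimes(\mathfrak a'\odot\mathfrak b)+b_1\otimes(\mathfrak a\odot\mathfrak b')+\lambda a_1b_1\otimes(\mathfrak a'\odot\mathfrak b')-a_1b_1\otimes\big((\mathfrak a'\odot 1_A)\odot\mathfrak b'\big),$$ where $1_A\in A=A^{\otimes1}$. Structure on $\mathrm{Sh}(A)=A\otimes\mathrm{Sh}^+(A)\cong\bigoplus_{n\ge1}A^{\otimes n}$: the multiplication is $(a_0\otimes\mathfrak a')\diamond_\lambda(b_0\otimes\mathfrak b')=a_0b_0\otimes(\mathfrak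 a'\odot\mathfrak b')$ extended bilinearly; the unit is $\mu_\lambda:\mathbf{k}\to\mathrm{Sh}(A)$, $c\mapsto c1_A$; $P_\lambda(\mathfrak a)=1_A\otimes\mathfrak a$; $\bullet$ denotes the induced multiplication on $\mathrm{Sh}(A)\otimes\mathrm{Sh}(A)$. The comultiplication $\Delta_\lambda:\mathrm{Sh}(A)\to\mathrm{Sh}(A)\otimes\mathrm{Sh}(A)$ is the linear map defined recursively by $\Delta_\lambda(a)=\Delta_A(a)$ for $a\in A$, and $\Delta_\lambda(a_1\otimes\mathfrak a')=\Delta_A(a_1)\bullet\big((\mathrm{id}\otimes P_\lambda)\Delta_\lambda(\mathfrak a')\big)$ for $a_1\in A$, $\mathfrak a'\in A^{\otimes n}$, $n\ge1$. The linear map $\varepsilon_\lambda:\mathrm{Sh}(A)\to\mathbf{k}$ is $\varepsilon_A$ on $A=A^{\otimes 1}$ and $0$ on $A^{\otimes n}$ for $n\ge2$. *)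

theory Defs
  imports "HOL-Algebra.Module" "HOL-Algebra.AbelCoset"
begin

section \<open>Modules over a commutative ring\<close>

definition linear_map :: "'k ring \<Rightarrow> ('k, 'm) module \<Rightarrow> ('k, 'n) module \<Rightarrow> ('m \<Rightarrow> 'n) \<Rightarrow> bool" where
  "linear_map k M N f \<longleftrightarrow>
     f \<in> carrier M \<rightarrow> carrier N \<and>
     (\<forall>x\<in>carrier M. \<forall>y\<in>carrier M. f (x \<oplus>\<^bsub>M\<^esub> y) = f x \<oplus>\<^bsub>N\<^esub> f y) \<and>
     (\<forall>c\<in>carrier k. \<forall>x\<in>carrier M. f (c \<odot>\<^bsub>M\<^esub> x) = c \<odot>\<^bsub>N\<^esub> f x)"

definition submodule_span :: "'k ring \<Rightarrow> ('k, 'm) module \<Rightarrow> 'm set \<Rightarrow> 'm set" where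
  "submodule_span k M X = \<Inter>{N. submodule N k M \<and> X \<subseteq> N}"

definition self_module :: "'k ring \<Rightarrow> ('k, 'k) module" where
  "self_module k = \<lparr>carrier = carrier k, mult = mult k, one = one k,
                    zero = zero k, add = add k, smult = mult k\<rparr>"

text \<open>The record type of modules also has a multiplication and a unit. They are left
  unspecified where only the module structure is meant.\<close>

definition free_module :: "'k ring \<Rightarrow> 's set \<Rightarrow> ('k, 's \<Rightarrow> 'k) module" where
  "free_module k S =
     \<lparr>carrier = {f. (\<forall>s\<in>S. f s \<in> carrier k) \<and> (\<forall>s. s \<notin> S \<longrightarrow> f s = \<zero>\<^bsub>k\<^esub>) \<and> finite {s. f s \<noteq> \<zero>\<^bsub>k\<^esub>}},
      mult = undefined, one = undefined,
      zero = (\<lambda>s. \<zero>\<^bsub>k\<^esub>), add = (\<lambda>f g s. f s \<oplus>\<^bsub>k\<^esub> g s), smult = (\<lambda>c f s. c \<otimes>\<^bsub>k\<^esub> f s)\<rparr>"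

definition free_gen :: "'k ring \<Rightarrow> 's \<Rightarrow> 's \<Rightarrow> 'k" where
  "free_gen k s = (\<lambda>t. if t = s then \<one>\<^bsub>k\<^esub> else \<zero>\<^bsub>k\<^esub>)"

definition quot_module :: "('k, 'm) module \<Rightarrow> 'm set \<Rightarrow> ('k, 'm set) module" where
  "quot_module M N =
     \<lparr>carrier = a_rcosets\<^bsub>M\<^esub> N, mult = undefined, one = undefined,
      zero = N, add = set_add M, smult = (\<lambda>c X. \<Union>x\<in>X. N +>\<^bsub>M\<^esub> (c \<odot>\<^bsub>M\<^esub> x))\<rparr>"

text \<open>For a module presented by generators and relations, the linear map into \<open>Q\<close> that sends
  the class of each generator \<open>s\<close> to \<open>\<phi> s\<close>. It is well defined on classes whenever \<open>\<phi>\<close>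
  respects the relations; \<open>\<phi>\<close> is the multilinear map being extended in all uses below.\<close>

definition pres_lift :: "'k ring \<Rightarrow> ('k, 'q) module \<Rightarrow> ('s \<Rightarrow> 'q) \<Rightarrow> ('s \<Rightarrow> 'k) set \<Rightarrow> 'q" where
  "pres_lift k Q \<phi> X =
     the_elem ((\<lambda>f. \<Oplus>\<^bsub>Q\<^esub>s\<in>{s. f s \<noteq> \<zero>\<^bsub>k\<^esub>}. f s \<odot>\<^bsub>Q\<^esub> \<phi> s) ` X)"


section \<open>The tensor product of two modules\<close>

definition tensor_rels :: "'k ring \<Rightarrow> ('k, 'm) module \<Rightarrow> ('k, 'n) module \<Rightarrow> ('m \<times> 'n \<Rightarrow> 'k) set" where
  "tensor_rels k M N =
    (let F = free_module k (carrier M \<times> carrier N); g = free_gen k in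
     submodule_span k F
      ({g (x \<oplus>\<^bsub>M\<^esub> x', y) \<ominus>\<^bsub>F\<^esub> (g (x, y) \<oplus>\<^bsub>F\<^esub> g (x', y)) | x x' y.
          x \<in> carrier M \<and> x' \<in> carrier M \<and> y \<in> carrier N} \<union>
       {g (x, y \<oplus>\<^bsub>N\<^esub> y') \<ominus>\<^bsub>F\<^esub> (g (x, y) \<oplus>\<^bsub>F\<^esub> g (x, y')) | x y y'.
          x \<in> carrier M \<and> y \<in> carrier N \<and> y' \<in> carrier N} \<union>
       {g (c \<odot>\<^bsub>M\<^esub> x, y) \<ominus>\<^bsub>F\<^esub> c \<odot>\<^bsub>F\<^esub> g (x, y) | c x y.
          c \<in> carrier k \<and> x \<in> carrier M \<and> y \<in> carrier N} \<union>
       {g (x, c \<odot>\<^bsub>N\<^esub> y) \<ominus>\<^bsub>F\<^esub> c \<odot>\<^bsub>F\<^esub> g (x, y) | c x y.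
          c \<in> carrier k \<and> x \<in> carrier M \<and> y \<in> carrier N}))"

definition pure :: "'k ring \<Rightarrow> ('k, 'm) module \<Rightarrow> ('k, 'n) module \<Rightarrow> 'm \<Rightarrow> 'n \<Rightarrow> ('m \<times> 'n \<Rightarrow> 'k) set" where
  "pure k M N x y =
     tensor_rels k M N +>\<^bsub>free_module k (carrier M \<times> carrier N)\<^esub> free_gen k (x, y)"

definition tensor_module ::
    "'k ring \<Rightarrow> ('k, 'm) module \<Rightarrow> ('k, 'n) module \<Rightarrow> ('k, ('m \<times> 'n \<Rightarrow> 'k) set) module" where
  "tensor_module k M N = quot_module (free_module k (carrier M \<times> carrier N)) (tensor_rels k M N)"

text \<open>If \<open>M\<close> and \<open>N\<close> are algebras, \<open>M \<otimes> N\<close> carries the induced multiplication and unit;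
  for mere modules these two components are meaningless.\<close>

definition tensor :: "'k ring \<Rightarrow> ('k, 'm) module \<Rightarrow> ('k, 'n) module \<Rightarrow> ('k, ('m \<times> 'n \<Rightarrow> 'k) set) module" where
  "tensor k M N = (tensor_module k M N)
     \<lparr>mult := (\<lambda>X Y. pres_lift k (tensor_module k M N)
                (\<lambda>(x, y). pres_lift k (tensor_module k M N)
                   (\<lambda>(x', y'). pure k M N (x \<otimes>\<^bsub>M\<^esub> x') (y \<otimes>\<^bsub>N\<^esub> y')) Y) X),
      one := pure k M N \<one>\<^bsub>M\<^esub> \<one>\<^bsub>N\<^esub>\<rparr>"

text \<open>\<open>f \<otimes> g\<close> as a map into \<open>M' \<otimes> N'\<close>.\<close>

definition tensor_map :: "'k ring \<Rightarrow> ('k, 'p) module \<Rightarrow> ('k, 'q) module \<Rightarrow>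
    ('m \<Rightarrow> 'p) \<Rightarrow> ('n \<Rightarrow> 'q) \<Rightarrow> ('m \<times> 'n \<Rightarrow> 'k) set \<Rightarrow> ('p \<times> 'q \<Rightarrow> 'k) set" where
  "tensor_map k M' N' f g =
     pres_lift k (tensor k M' N') (\<lambda>(x, y). pure k M' N' (f x) (g y))"

text \<open>The canonical isomorphism \<open>(L \<otimes> M) \<otimes> N \<rightarrow> L \<otimes> (M \<otimes> N)\<close>.\<close>

definition tensor_assoc :: "'k ring \<Rightarrow> ('k, 'l) module \<Rightarrow> ('k, 'm) module \<Rightarrow> ('k, 'n) module \<Rightarrow>
    (('l \<times> 'm \<Rightarrow> 'k) set \<times> 'n \<Rightarrow> 'k) set \<Rightarrow> ('l \<times> ('m \<times> 'n \<Rightarrow> 'k) set \<Rightarrow> 'k) set" where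
  "tensor_assoc k L M N =
     pres_lift k (tensor k L (tensor k M N))
       (\<lambda>(t, z). pres_lift k (tensor k L (tensor k M N))
          (\<lambda>(x, y). pure k L (tensor k M N) x (pure k M N y z)) t)"

text \<open>The image of \<open>U \<otimes> V\<close> in \<open>M \<otimes> N\<close> for submodules \<open>U\<close> of \<open>M\<close> and \<open>V\<close> of \<open>N\<close>.\<close>

definition tensor_image :: "'k ring \<Rightarrow> ('k, 'm) module \<Rightarrow> ('k, 'n) module \<Rightarrow> 'm set \<Rightarrow> 'n set \<Rightarrow>
    ('m \<times> 'n \<Rightarrow> 'k) set set" where
  "tensor_image k M N U V =
     tensor_map k M N (\<lambda>x. x) (\<lambda>y. y) ` carrier (tensor k (M\<lparr>carrier := U\<rparr>) (N\<lparr>carrier := V\<rparr>))"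


section \<open>Left counital bialgebras and Hopf algebras\<close>

text \<open>The unit map is \<open>c \<mapsto> c \<odot> \<one>\<close>.\<close>

locale left_counital_bialgebra = algebra k H
  for k :: "'k ring" (structure) and H :: "('k, 'a) module" (structure) +
  fixes \<Delta> :: "'a \<Rightarrow> ('a \<times> 'a \<Rightarrow> 'k) set" and \<epsilon> :: "'a \<Rightarrow> 'k"
  assumes \<Delta>_linear: "linear_map k H (tensor k H H) \<Delta>"
    and coassoc: "x \<in> carrier H \<Longrightarrow>
      tensor_map k H (tensor k H H) (\<lambda>x. x) \<Delta> (\<Delta> x) =
      tensor_assoc k H H H (tensor_map k (tensor k H H) H \<Delta> (\<lambda>x. x) (\<Delta> x))"
    and \<epsilon>_linear: "linear_map k H (self_module k) \<epsilon>"
    and left_counit: "x \<in> carrier H \<Longrightarrow>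
      tensor_map k (self_module k) H \<epsilon> (\<lambda>x. x) (\<Delta> x) = pure k (self_module k) H \<one>\<^bsub>k\<^esub> x"
    and \<Delta>_hom: "\<Delta> \<in> ring_hom H (tensor k H H)"
    and \<epsilon>_hom: "\<epsilon> \<in> ring_hom H (self_module k)"

locale left_counital_operated_bialgebra = left_counital_bialgebra +
  fixes P :: "'b \<Rightarrow> 'b"
  assumes P_linear: "linear_map k H H P"

locale filtered_left_counital_bialgebra = left_counital_bialgebra +
  fixes F :: "nat \<Rightarrow> 'b set"
  assumes F_submodule: "submodule (F n) k H"
    and F_mono: "F n \<subseteq> F (Suc n)"
    and F_exhaustive: "(\<Union>n. F n) = carrier H"
    and F_mult: "x \<in> F p \<Longrightarrow> y \<in> F q \<Longrightarrow> x \<otimes>\<^bsub>H\<^esub> y \<in> F (p + q)"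
    and F_comult: "\<Delta> ` F n \<subseteq>
      submodule_span k (tensor k H H)
        (\<Union>(p, q)\<in>insert (0, n) {(p, q). p + q = n \<and> p > 0 \<and> q > 0}.
           tensor_image k H H (F p) (F q))"

locale connected_filtered_left_counital_bialgebra = filtered_left_counital_bialgebra +
  assumes connected: "F 0 = {c \<odot>\<^bsub>H\<^esub> \<one>\<^bsub>H\<^esub> | c. c \<in> carrier k}"

definition convolution :: "'k ring \<Rightarrow> ('k, 'a) module \<Rightarrow> ('a \<Rightarrow> ('a \<times> 'a \<Rightarrow> 'k) set) \<Rightarrow>
    ('a \<Rightarrow> 'a) \<Rightarrow> ('a \<Rightarrow> 'a) \<Rightarrow> 'a \<Rightarrow> 'a" where
  "convolution k H \<Delta> f g x =
     pres_lift k H (\<lambda>(x, y). x \<otimes>\<^bsub>H\<^esub> y) (tensor_map k H H f g (\<Delta> x))"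

definition right_antipode :: "'k ring \<Rightarrow> ('k, 'a) module \<Rightarrow> ('a \<Rightarrow> ('a \<times> 'a \<Rightarrow> 'k) set) \<Rightarrow>
    ('a \<Rightarrow> 'k) \<Rightarrow> ('a \<Rightarrow> 'a) \<Rightarrow> bool" where
  "right_antipode k H \<Delta> \<epsilon> S \<longleftrightarrow>
     linear_map k H H S \<and>
     (\<forall>x\<in>carrier H. convolution k H \<Delta> (\<lambda>x. x) S x = \<epsilon> x \<odot>\<^bsub>H\<^esub> \<one>\<^bsub>H\<^esub>)"

locale left_counital_hopf_algebra = left_counital_operated_bialgebra +
  assumes ex_right_antipode: "\<exists>S. right_antipode k H \<Delta> \<epsilon> S"


section \<open>The direct sum of all tensor powers\<close>

text \<open>All tensor powers of \<open>A\<close> at once: generators are the words over \<open>A\<close>, and the relations say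
  that a word is multilinear in its letters. As each relation involves only words of one
  length, this module is the direct sum of the \<open>A\<^sup>\<otimes>\<^sup>n\<close>, \<open>n \<ge> 0\<close>, with \<open>A\<^sup>\<otimes>\<^sup>n\<close> spanned by the
  classes of words of length \<open>n\<close>; the empty word is the unit of \<open>A\<^sup>\<otimes>\<^sup>0 = k\<close>.\<close>

definition word_rels :: "'k ring \<Rightarrow> ('k, 'a) module \<Rightarrow> ('a list \<Rightarrow> 'k) set" where
  "word_rels k A =
    (let F = free_module k (lists (carrier A)); g = free_gen k in
     submodule_span k F
      ({g (u @ (a \<oplus>\<^bsub>A\<^esub> b) # v) \<ominus>\<^bsub>F\<^esub> (g (u @ a # v) \<oplus>\<^bsub>F\<^esub> g (u @ b # v)) | u v a b.
          u \<in> lists (carrier A) \<and> v \<in> lists (carrier A) \<and> a \<in> carrier A \<and> b \<in> carrier A} \<union>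
       {g (u @ (c \<odot>\<^bsub>A\<^esub> a) # v) \<ominus>\<^bsub>F\<^esub> c \<odot>\<^bsub>F\<^esub> g (u @ a # v) | u v c a.
          u \<in> lists (carrier A) \<and> v \<in> lists (carrier A) \<and> c \<in> carrier k \<and> a \<in> carrier A}))"

definition Sh_plus :: "'k ring \<Rightarrow> ('k, 'a) module \<Rightarrow> ('k, ('a list \<Rightarrow> 'k) set) module" where
  "Sh_plus k A = quot_module (free_module k (lists (carrier A))) (word_rels k A)"

text \<open>\<open>word k A [a\<^sub>1, \<dots>, a\<^sub>n]\<close> is the pure tensor \<open>a\<^sub>1 \<otimes> \<dots> \<otimes> a\<^sub>n\<close>.\<close>

definition word :: "'k ring \<Rightarrow> ('k, 'a) module \<Rightarrow> 'a list \<Rightarrow> ('a list \<Rightarrow> 'k) set" where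
  "word k A w = word_rels k A +>\<^bsub>free_module k (lists (carrier A))\<^esub> free_gen k w"

text \<open>\<open>a \<otimes> X\<close> for \<open>X\<close> in the direct sum.\<close>

definition prepend :: "'k ring \<Rightarrow> ('k, 'a) module \<Rightarrow> 'a \<Rightarrow> ('a list \<Rightarrow> 'k) set \<Rightarrow> ('a list \<Rightarrow> 'k) set" where
  "prepend k A a = pres_lift k (Sh_plus k A) (\<lambda>w. word k A (a # w))"


section \<open>The TD shuffle product of weight \<open>\<lambda>\<close>\<close>

text \<open>The product of two pure tensors. In the last summand, the product with \<open>v\<close> is extended
  linearly to \<open>u \<odot> 1\<^sub>A\<close>. The length test is there for termination only: \<open>u \<odot> 1\<^sub>A\<close> lies in
  the sum of the tensor powers of degree at most \<open>length u + 1\<close>, so that longer words do not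
  contribute.\<close>

fun td_word :: "'k ring \<Rightarrow> ('k, 'a) module \<Rightarrow> 'k \<Rightarrow> 'a list \<Rightarrow> 'a list \<Rightarrow> ('a list \<Rightarrow> 'k) set" where
  "td_word k A l [] v = word k A v"
| "td_word k A l (a # u) [] = word k A (a # u)"
| "td_word k A l (a # u) (b # v) =
     prepend k A a (td_word k A l u (b # v))
     \<oplus>\<^bsub>Sh_plus k A\<^esub> prepend k A b (td_word k A l (a # u) v)
     \<oplus>\<^bsub>Sh_plus k A\<^esub> l \<odot>\<^bsub>Sh_plus k A\<^esub> prepend k A (a \<otimes>\<^bsub>A\<^esub> b) (td_word k A l u v)
     \<ominus>\<^bsub>Sh_plus k A\<^esub> prepend k A (a \<otimes>\<^bsub>A\<^esub> b)
        (pres_lift k (Sh_plus k A)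
           (\<lambda>w. if length w \<le> length u + 1 then td_word k A l w v else \<zero>\<^bsub>Sh_plus k A\<^esub>)
           (td_word k A l u [\<one>\<^bsub>A\<^esub>]))"

definition td_shuffle :: "'k ring \<Rightarrow> ('k, 'a) module \<Rightarrow> 'k \<Rightarrow>
    ('a list \<Rightarrow> 'k) set \<Rightarrow> ('a list \<Rightarrow> 'k) set \<Rightarrow> ('a list \<Rightarrow> 'k) set" where
  "td_shuffle k A l X Y =
     pres_lift k (Sh_plus k A) (\<lambda>u. pres_lift k (Sh_plus k A) (\<lambda>v. td_word k A l u v) Y) X"


section \<open>The structure on \<open>Sh(A)\<close>\<close>

text \<open>\<open>Sh(A) = A \<otimes> Sh\<^sup>+(A)\<close> is taken as the submodule of \<open>Sh\<^sup>+(A)\<close> formed by the tensor powers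
  of degree at least \<open>1\<close>. The maps below are given on words and extended linearly, so that
  their values on the empty word play no role.\<close>

fun diamond_word :: "'k ring \<Rightarrow> ('k, 'a) module \<Rightarrow> 'k \<Rightarrow> 'a list \<Rightarrow> 'a list \<Rightarrow> ('a list \<Rightarrow> 'k) set" where
  "diamond_word k A l (a # u) (b # v) =
     prepend k A (a \<otimes>\<^bsub>A\<^esub> b) (td_shuffle k A l (word k A u) (word k A v))"
| "diamond_word k A l _ _ = \<zero>\<^bsub>Sh_plus k A\<^esub>"

definition Sh :: "'k ring \<Rightarrow> ('k, 'a) module \<Rightarrow> 'k \<Rightarrow> ('k, ('a list \<Rightarrow> 'k) set) module" where
  "Sh k A l = (Sh_plus k A)
     \<lparr>carrier := submodule_span k (Sh_plus k A) {word k A w | w. w \<in> lists (carrier A) \<and> w \<noteq> []},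
      mult := (\<lambda>X Y. pres_lift k (Sh_plus k A)
                (\<lambda>u. pres_lift k (Sh_plus k A) (\<lambda>v. diamond_word k A l u v) Y) X),
      one := word k A [\<one>\<^bsub>A\<^esub>]\<rparr>"

definition Sh_P :: "'k ring \<Rightarrow> ('k, 'a) module \<Rightarrow> ('a list \<Rightarrow> 'k) set \<Rightarrow> ('a list \<Rightarrow> 'k) set" where
  "Sh_P k A = prepend k A \<one>\<^bsub>A\<^esub>"

text \<open>The comultiplication of \<open>a \<in> A\<close>, viewed in \<open>Sh(A) \<otimes> Sh(A)\<close>.\<close>

definition Sh_\<Delta>_letter :: "'k ring \<Rightarrow> ('k, 'a) module \<Rightarrow> 'k \<Rightarrow> ('a \<Rightarrow> ('a \<times> 'a \<Rightarrow> 'k) set) \<Rightarrow>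
    'a \<Rightarrow> (('a list \<Rightarrow> 'k) set \<times> ('a list \<Rightarrow> 'k) set \<Rightarrow> 'k) set" where
  "Sh_\<Delta>_letter k A l \<Delta> a =
     tensor_map k (Sh k A l) (Sh k A l) (\<lambda>a. word k A [a]) (\<lambda>a. word k A [a]) (\<Delta> a)"

fun Sh_\<Delta>_word :: "'k ring \<Rightarrow> ('k, 'a) module \<Rightarrow> 'k \<Rightarrow> ('a \<Rightarrow> ('a \<times> 'a \<Rightarrow> 'k) set) \<Rightarrow>
    'a list \<Rightarrow> (('a list \<Rightarrow> 'k) set \<times> ('a list \<Rightarrow> 'k) set \<Rightarrow> 'k) set" where
  "Sh_\<Delta>_word k A l \<Delta> [] = \<zero>\<^bsub>tensor k (Sh k A l) (Sh k A l)\<^esub>"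
| "Sh_\<Delta>_word k A l \<Delta> [a] = Sh_\<Delta>_letter k A l \<Delta> a"
| "Sh_\<Delta>_word k A l \<Delta> (a # b # w) =
     Sh_\<Delta>_letter k A l \<Delta> a \<otimes>\<^bsub>tensor k (Sh k A l) (Sh k A l)\<^esub>
     tensor_map k (Sh k A l) (Sh k A l) (\<lambda>x. x) (Sh_P k A) (Sh_\<Delta>_word k A l \<Delta> (b # w))"

definition Sh_\<Delta> :: "'k ring \<Rightarrow> ('k, 'a) module \<Rightarrow> 'k \<Rightarrow> ('a \<Rightarrow> ('a \<times> 'a \<Rightarrow> 'k) set) \<Rightarrow>
    ('a list \<Rightarrow> 'k) set \<Rightarrow> (('a list \<Rightarrow> 'k) set \<times> ('a list \<Rightarrow> 'k) set \<Rightarrow> 'k) set" where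
  "Sh_\<Delta> k A l \<Delta> = pres_lift k (tensor k (Sh k A l) (Sh k A l)) (Sh_\<Delta>_word k A l \<Delta>)"

definition Sh_\<epsilon> :: "'k ring \<Rightarrow> ('a \<Rightarrow> 'k) \<Rightarrow> ('a list \<Rightarrow> 'k) set \<Rightarrow> 'k" where
  "Sh_\<epsilon> k \<epsilon> = pres_lift k (self_module k) (\<lambda>w. case w of [a] \<Rightarrow> \<epsilon> a | _ \<Rightarrow> \<zero>\<^bsub>k\<^esub>)"

end

theory Submission
  imports Defs
begin

text \<open>The word algebra is handled through universal properties. Right multiplication by \<open>1\<^sub>A\<close> in the
  TD shuffle algebra is explicit, which turns the TD recursion into one of Nijenhuis type that is
  symmetric and involves only shorter words; commutativity and associativity follow from it by
  induction. Moreover \<open>P\<close> makes \<open>Sh(A)\<close> the free commutative TD algebra on \<open>A\<close>: an algebra map from \<open>A\<close>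
  to a commutative algebra with a TD operator \<open>Q\<close> extends uniquely to an algebra map on \<open>Sh(A)\<close> that
  intertwines \<open>P\<close> and \<open>Q\<close>. Existence for \<open>Q = id \<otimes> P\<close> on \<open>Sh(A) \<otimes> Sh(A)\<close> and for \<open>Q = 0\<close> on \<open>k\<close> shows that
  the comultiplication and the counit are algebra maps; uniqueness gives coassociativity and left
  counitality. The antipode needs the filtration on \<open>A\<close> only: the iteration
  \<open>s \<mapsto> \<mu>\<epsilon> - (id - \<mu>\<epsilon>) * s\<close> becomes stationary on each filtration step and yields a right antipode of \<open>A\<close>.
  Extended by zero to the words of length at least \<open>2\<close>, it is a right antipode of \<open>Sh(A)\<close>, because
  comultiplying such a word leaves only words of length at least \<open>2\<close> in the right tensor factor.\<close>

text \<open>All products and maps are given on generators and extended by \<open>pres_lift\<close>,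
  which yields the intended value only for maps that respect the relations. For the TD product this
  is circular: its last summand extends the product linearly to \<open>u \<odot> 1\<close> while the
  product is still being defined, so multilinearity cannot be read off the recursion. The Nijenhuis
  form removes that nested extension. Its price is a term of weight \<lambda> that survives only
  when both tails are empty; the projection of \<open>Sh\<^sup>+(A)\<close> to degree 0 records this
  defect and is the source of every term with \<open>aug\<close>. Associativity is proved as the
  cyclic identity (xy)z = (yz)x, because then one expansion of a left-bracketed triple product
  serves both sides. The iteration for the antipode comes from rewriting id * S = \<mu>\<epsilon>:
  as \<mu>\<epsilon> is a left unit for convolution, the equation says S = \<mu>\<epsilon> - (id -
  \<mu>\<epsilon>) * S, and id - \<mu>\<epsilon> vanishes on \<open>A\<^sup>0\<close>, so that the
  right-hand side depends on S in lower degrees only.\<close>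

lemma module_cong:
  assumes "module k M" "carrier M' = carrier M" "zero M' = zero M" "add M' = add M" "smult M' = smult M"
  shows "module k M'"
proof -
  interpret module k M by fact
  have "abelian_group M'"
    by (rule abelian_groupI) (use assms in \<open>auto simp: a_ac intro: exI[of _ "\<ominus>\<^bsub>M\<^esub> _"] intro!: M.l_neg\<close>)
  then show ?thesis
    by (intro moduleI) (use assms in \<open>auto simp: smult_l_distr smult_r_distr smult_assoc1 is_cring\<close>)
qed

lemma (in abelian_group) eq_if_minus_eq_zero:
  assumes "x \<ominus> y = \<zero>" "x \<in> carrier G" "y \<in> carrier G"
  shows "x = y"
  using assms by (metis a_minus_def add.inv_closed add.inv_comm minus_equality minus_minus)


section \<open>Linear and bilinear maps\<close>

lemma linear_mapI:
  assumes "\<And>x. x \<in> carrier M \<Longrightarrow> f x \<in> carrier N"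
    and "\<And>x y. x \<in> carrier M \<Longrightarrow> y \<in> carrier M \<Longrightarrow> f (x \<oplus>\<^bsub>M\<^esub> y) = f x \<oplus>\<^bsub>N\<^esub> f y"
    and "\<And>c x. c \<in> carrier k \<Longrightarrow> x \<in> carrier M \<Longrightarrow> f (c \<odot>\<^bsub>M\<^esub> x) = c \<odot>\<^bsub>N\<^esub> f x"
  shows "linear_map k M N f"
  using assms by (auto simp: linear_map_def)

lemma
  assumes "linear_map k M N f" "x \<in> carrier M"
  shows linear_map_closed: "f x \<in> carrier N"
    and linear_map_add: "y \<in> carrier M \<Longrightarrow> f (x \<oplus>\<^bsub>M\<^esub> y) = f x \<oplus>\<^bsub>N\<^esub> f y"
    and linear_map_smult: "c \<in> carrier k \<Longrightarrow> f (c \<odot>\<^bsub>M\<^esub> x) = c \<odot>\<^bsub>N\<^esub> f x"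
  using assms by (auto simp: linear_map_def)

lemma linear_map_cong:
  assumes "module k M" "\<And>x. x \<in> carrier M \<Longrightarrow> f x = g x"
  shows "linear_map k M N f \<longleftrightarrow> linear_map k M N g"
proof -
  interpret module k M by fact
  show ?thesis using assms(2) by (simp add: linear_map_def Pi_def)
qed

lemma linear_map_zero:
  assumes "linear_map k M N f" "module k M" "module k N"
  shows "f \<zero>\<^bsub>M\<^esub> = \<zero>\<^bsub>N\<^esub>"
proof -
  interpret M: module k M by fact
  interpret N: module k N by fact
  have "f (\<zero>\<^bsub>k\<^esub> \<odot>\<^bsub>M\<^esub> \<zero>\<^bsub>M\<^esub>) = \<zero>\<^bsub>k\<^esub> \<odot>\<^bsub>N\<^esub> f \<zero>\<^bsub>M\<^esub>"
    using assms by (simp only: linear_map_smult M.zero_closed M.R.zero_closed)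
  then show ?thesis
    using linear_map_closed[OF assms(1)] by simp
qed

lemma linear_map_neg:
  assumes "linear_map k M N f" "module k M" "module k N" "x \<in> carrier M"
  shows "f (\<ominus>\<^bsub>M\<^esub> x) = \<ominus>\<^bsub>N\<^esub> f x"
proof -
  interpret M: module k M by fact
  interpret N: module k N by fact
  have "f (\<ominus>\<^bsub>M\<^esub> x) \<oplus>\<^bsub>N\<^esub> f x = f (\<ominus>\<^bsub>M\<^esub> x \<oplus>\<^bsub>M\<^esub> x)"
    using assms by (simp add: linear_map_add)
  also have "\<dots> = \<zero>\<^bsub>N\<^esub>"
    using assms by (simp add: M.l_neg linear_map_zero)
  finally show ?thesis
    using assms by (simp add: N.minus_equality linear_map_closed)
qed

lemma linear_map_minus:
  assumes "linear_map k M N f" "module k M" "module k N" "x \<in> carrier M" "y \<in> carrier M"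
  shows "f (x \<ominus>\<^bsub>M\<^esub> y) = f x \<ominus>\<^bsub>N\<^esub> f y"
proof -
  interpret M: module k M by fact
  show ?thesis
    using assms by (simp add: a_minus_def linear_map_add linear_map_neg)
qed

lemma linear_map_id: "linear_map k M M (\<lambda>x. x)"
  by (simp add: linear_map_def)

lemma linear_map_compose:
  assumes "linear_map k N Q g" "linear_map k M N f"
  shows "linear_map k M Q (\<lambda>x. g (f x))"
  using assms by (auto simp: linear_map_def Pi_iff)

lemma linear_map_const_zero:
  assumes "module k N"
  shows "linear_map k M N (\<lambda>x. \<zero>\<^bsub>N\<^esub>)"
proof -
  interpret module k N by fact
  show ?thesis by (rule linear_mapI) auto
qed

lemma linear_map_plus:
  assumes "module k N" "linear_map k M N f" "linear_map k M N g"
  shows "linear_map k M N (\<lambda>x. f x \<oplus>\<^bsub>N\<^esub> g x)"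
proof -
  interpret module k N by fact
  show ?thesis
    by (rule linear_mapI)
      (use assms(2,3) in \<open>simp_all add: linear_map_closed linear_map_add linear_map_smult smult_r_distr M.a_ac\<close>)
qed

lemma linear_map_scale:
  assumes "module k N" "linear_map k M N f" "c \<in> carrier k"
  shows "linear_map k M N (\<lambda>x. c \<odot>\<^bsub>N\<^esub> f x)"
proof -
  interpret module k N by fact
  have "c \<odot>\<^bsub>N\<^esub> (d \<odot>\<^bsub>N\<^esub> x) = d \<odot>\<^bsub>N\<^esub> (c \<odot>\<^bsub>N\<^esub> x)" if "d \<in> carrier k" "x \<in> carrier N" for d x
    using that assms(3) by (simp add: smult_assoc1[symmetric] R.m_comm)
  then show ?thesis
    by (intro linear_mapI)
      (use assms in \<open>simp_all add: linear_map_closed linear_map_add linear_map_smult smult_r_distr\<close>)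
qed

lemma linear_map_diff:
  assumes "module k N" "linear_map k M N f" "linear_map k M N g"
  shows "linear_map k M N (\<lambda>x. f x \<ominus>\<^bsub>N\<^esub> g x)"
proof -
  interpret module k N by fact
  show ?thesis
    by (rule linear_mapI)
      (use assms(2,3) in \<open>simp_all add: linear_map_closed linear_map_add linear_map_smult smult_r_distr
        smult_r_minus M.minus_add M.a_ac a_minus_def\<close>)
qed

lemma linear_map_if:
  assumes "b \<Longrightarrow> linear_map k M N f" "\<not> b \<Longrightarrow> linear_map k M N g"
  shows "linear_map k M N (\<lambda>x. if b then f x else g x)"
  using assms by (cases b) auto

definition bilinear_map ::
    "'k ring \<Rightarrow> ('k, 'm) module \<Rightarrow> ('k, 'n) module \<Rightarrow> ('k, 'q) module \<Rightarrow> ('m \<Rightarrow> 'n \<Rightarrow> 'q) \<Rightarrow> bool" where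
  "bilinear_map k M N Q f \<longleftrightarrow>
     (\<forall>x\<in>carrier M. linear_map k N Q (f x)) \<and> (\<forall>y\<in>carrier N. linear_map k M Q (\<lambda>x. f x y))"

lemma bilinear_mapI:
  assumes "\<And>x. x \<in> carrier M \<Longrightarrow> linear_map k N Q (f x)"
    and "\<And>y. y \<in> carrier N \<Longrightarrow> linear_map k M Q (\<lambda>x. f x y)"
  shows "bilinear_map k M N Q f"
  using assms by (simp add: bilinear_map_def)

lemma
  assumes "bilinear_map k M N Q f"
  shows bilinear_map_left: "y \<in> carrier N \<Longrightarrow> linear_map k M Q (\<lambda>x. f x y)"
    and bilinear_map_right: "x \<in> carrier M \<Longrightarrow> linear_map k N Q (f x)"
    and bilinear_map_closed: "x \<in> carrier M \<Longrightarrow> y \<in> carrier N \<Longrightarrow> f x y \<in> carrier Q"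
  using assms by (auto simp: bilinear_map_def linear_map_def)

lemma
  assumes "bilinear_map k M N Q f" "x \<in> carrier M" "y \<in> carrier N"
  shows bilinear_map_add_left: "x' \<in> carrier M \<Longrightarrow> f (x \<oplus>\<^bsub>M\<^esub> x') y = f x y \<oplus>\<^bsub>Q\<^esub> f x' y"
    and bilinear_map_add_right: "y' \<in> carrier N \<Longrightarrow> f x (y \<oplus>\<^bsub>N\<^esub> y') = f x y \<oplus>\<^bsub>Q\<^esub> f x y'"
    and bilinear_map_smult_left: "c \<in> carrier k \<Longrightarrow> f (c \<odot>\<^bsub>M\<^esub> x) y = c \<odot>\<^bsub>Q\<^esub> f x y"
    and bilinear_map_smult_right: "c \<in> carrier k \<Longrightarrow> f x (c \<odot>\<^bsub>N\<^esub> y) = c \<odot>\<^bsub>Q\<^esub> f x y"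
  using assms by (auto simp: bilinear_map_def linear_map_def)

lemma bilinear_map_minus_left:
  assumes "bilinear_map k M N Q f" "module k M" "module k Q" "x \<in> carrier M" "x' \<in> carrier M" "y \<in> carrier N"
  shows "f (x \<ominus>\<^bsub>M\<^esub> x') y = f x y \<ominus>\<^bsub>Q\<^esub> f x' y"
  using linear_map_minus[OF bilinear_map_left[OF assms(1)]] assms by auto

lemma bilinear_map_flip: "bilinear_map k M N Q f \<Longrightarrow> bilinear_map k N M Q (\<lambda>x y. f y x)"
  by (simp add: bilinear_map_def)

lemma bilinear_map_compose:
  assumes "bilinear_map k M N Q f" "linear_map k M' M g" "linear_map k N' N h"
  shows "bilinear_map k M' N' Q (\<lambda>x y. f (g x) (h y))"
proof (rule bilinear_mapI)
  fix x assume "x \<in> carrier M'"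
  then show "linear_map k N' Q (\<lambda>y. f (g x) (h y))"
    by (intro linear_map_compose[OF bilinear_map_right[OF assms(1)] assms(3)] linear_map_closed[OF assms(2)])
next
  fix y assume "y \<in> carrier N'"
  then show "linear_map k M' Q (\<lambda>x. f (g x) (h y))"
    by (intro linear_map_compose[OF bilinear_map_left[OF assms(1)] assms(2)] linear_map_closed[OF assms(3)])
qed

lemma bilinear_map_compose':
  assumes "linear_map k Q Q' g" "bilinear_map k M N Q f"
  shows "bilinear_map k M N Q' (\<lambda>x y. g (f x y))"
  using assms by (auto simp: bilinear_map_def intro: linear_map_compose)


section \<open>Modules presented by generators and relations\<close>

lemma submodule_span_submodule:
  assumes "module k M" "X \<subseteq> carrier M"
  shows "submodule (submodule_span k M X) k M"
proof -
  interpret module k M by fact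
  have "submodule (carrier M) k M" by (rule carrier_is_submodule)
  then show ?thesis
    unfolding submodule_span_def
    by (intro submoduleI)
      (use assms(2) submoduleE in \<open>auto dest: submoduleE subgroup.one_closed[OF submodule.axioms(1)]\<close>)
qed

lemma submodule_span_superset: "X \<subseteq> submodule_span k M X"
  by (auto simp: submodule_span_def)

lemma submodule_span_least: "submodule N k M \<Longrightarrow> X \<subseteq> N \<Longrightarrow> submodule_span k M X \<subseteq> N"
  by (auto simp: submodule_span_def)

lemma linear_map_kernel_submodule:
  assumes "linear_map k M N f" "module k M" "module k N"
  shows "submodule {x \<in> carrier M. f x = \<zero>\<^bsub>N\<^esub>} k M"
proof -
  interpret M: module k M by fact
  interpret N: module k N by fact
  show ?thesis
    by (rule M.submoduleI)
      (use assms in \<open>auto simp: linear_map_add linear_map_smult linear_map_neg linear_map_zero\<close>)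
qed

text \<open>The difference of \<open>f\<close> and \<open>g\<close> is linear, so its kernel is a
  submodule; as it contains \<open>X\<close>, it contains the span.\<close>

lemma linear_map_eq_on_span:
  assumes "linear_map k M N f" "linear_map k M N g" "module k M" "module k N" "X \<subseteq> carrier M"
    and "\<And>x. x \<in> X \<Longrightarrow> f x = g x" "x \<in> submodule_span k M X"
  shows "f x = g x"
proof -
  interpret N: module k N by fact
  have "submodule_span k M X \<subseteq> {x \<in> carrier M. f x \<ominus>\<^bsub>N\<^esub> g x = \<zero>\<^bsub>N\<^esub>}"
    by (rule submodule_span_least[OF linear_map_kernel_submodule[OF linear_map_diff]])
      (use assms in \<open>auto simp: N.r_neg a_minus_def linear_map_closed subset_iff\<close>)
  then have "x \<in> carrier M" "f x \<ominus>\<^bsub>N\<^esub> g x = \<zero>\<^bsub>N\<^esub>"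
    using assms(7) by auto
  then show ?thesis
    by (simp add: N.eq_if_minus_eq_zero linear_map_closed[OF assms(1)] linear_map_closed[OF assms(2)])
qed

section \<open>Free modules, quotients and linear extension from generators\<close>

lemma free_module_simps:
  "zero (free_module k S) = (\<lambda>s. \<zero>\<^bsub>k\<^esub>)"
  "add (free_module k S) f g = (\<lambda>s. f s \<oplus>\<^bsub>k\<^esub> g s)"
  "smult (free_module k S) c f = (\<lambda>s. c \<otimes>\<^bsub>k\<^esub> f s)"
  by (simp_all add: free_module_def)

lemma mem_free_module:
  "f \<in> carrier (free_module k S) \<longleftrightarrow>
    (\<forall>s\<in>S. f s \<in> carrier k) \<and> (\<forall>s. s \<notin> S \<longrightarrow> f s = \<zero>\<^bsub>k\<^esub>) \<and> finite {s. f s \<noteq> \<zero>\<^bsub>k\<^esub>}"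
  by (simp add: free_module_def)

locale scalars = cring k for k :: "'k ring" (structure)
begin

lemma free_module_apply: "f \<in> carrier (free_module k S) \<Longrightarrow> f s \<in> carrier k"
  by (cases "s \<in> S") (auto simp: mem_free_module)

lemma free_module_is_module: "module k (free_module k S)"
proof -
  let ?F = "free_module k S"
  have add: "(\<lambda>s. f s \<oplus> g s) \<in> carrier ?F" if "f \<in> carrier ?F" "g \<in> carrier ?F" for f g
  proof -
    have "{s. f s \<oplus> g s \<noteq> \<zero>} \<subseteq> {s. f s \<noteq> \<zero>} \<union> {s. g s \<noteq> \<zero>}" by auto
    then have "finite {s. f s \<oplus> g s \<noteq> \<zero>}"
      using that by (elim finite_subset) (auto simp: mem_free_module)
    with that show ?thesis by (auto simp: mem_free_module)
  qed
  have smult: "(\<lambda>s. c \<otimes> f s) \<in> carrier ?F" if "f \<in> carrier ?F" "c \<in> carrier k" for f c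
  proof -
    have "{s. c \<otimes> f s \<noteq> \<zero>} \<subseteq> {s. f s \<noteq> \<zero>}" using that by auto
    then have "finite {s. c \<otimes> f s \<noteq> \<zero>}"
      using that by (elim finite_subset) (auto simp: mem_free_module)
    with that show ?thesis by (auto simp: mem_free_module)
  qed
  \<comment> \<open>Negation is obtained as scaling by \<open>\<ominus> \<one>\<close>, since
    closure under scaling is already known.\<close>
  have "\<exists>g\<in>carrier ?F. (\<lambda>s. g s \<oplus> f s) = (\<lambda>s. \<zero>)" if "f \<in> carrier ?F" for f
    using smult[OF that, of "\<ominus> \<one>"] that
    by (intro bexI[of _ "\<lambda>s. \<ominus> \<one> \<otimes> f s"]) (auto simp: free_module_apply l_minus l_neg)
  then have "abelian_group ?F"
    by (intro abelian_groupI)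
      (auto simp: free_module_simps free_module_apply a_ac add, auto simp: mem_free_module)
  then show ?thesis
    by (intro moduleI) (auto simp: free_module_simps is_cring free_module_apply smult l_distr r_distr m_assoc)
qed

lemma free_gen_closed: "s \<in> S \<Longrightarrow> free_gen k s \<in> carrier (free_module k S)"
  by (auto simp: mem_free_module free_gen_def)

text \<open>Induction on the support: splitting off one point writes \<open>f\<close> as a multiple
  of a generator plus a function with smaller support.\<close>

lemma free_module_induct [consumes 1, case_names zero gen add]:
  assumes "f \<in> carrier (free_module k S)"
    and "P (\<lambda>s. \<zero>)"
    and "\<And>c s. c \<in> carrier k \<Longrightarrow> s \<in> S \<Longrightarrow> P (c \<odot>\<^bsub>free_module k S\<^esub> free_gen k s)"
    and "\<And>f g. f \<in> carrier (free_module k S) \<Longrightarrow> g \<in> carrier (free_module k S) \<Longrightarrow> P f \<Longrightarrow> P g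
      \<Longrightarrow> P (f \<oplus>\<^bsub>free_module k S\<^esub> g)"
  shows "P f"
proof -
  have "\<forall>f. f \<in> carrier (free_module k S) \<and> {s. f s \<noteq> \<zero>} = B \<longrightarrow> P f" if "finite B" for B
    using that
  proof (induction B)
    case empty
    have "f = (\<lambda>s. \<zero>)" if "{s. f s \<noteq> \<zero>} = {}" for f :: "'b \<Rightarrow> 'k"
      using that by auto
    then show ?case using assms(2) by auto
  next
    case (insert s B)
    show ?case
    proof (intro allI impI, elim conjE)
      fix f assume f: "f \<in> carrier (free_module k S)" "{s. f s \<noteq> \<zero>} = insert s B"
      then have s: "s \<in> S" by (auto simp: mem_free_module)
      let ?g = "f(s := \<zero>)"
      have supp: "{t. ?g t \<noteq> \<zero>} = B" using f(2) insert.hyps by auto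
      then have g: "?g \<in> carrier (free_module k S)"
        using f(1) insert.hyps by (auto simp: mem_free_module)
      have "P ?g" using insert.IH supp g by blast
      moreover have "f = f s \<odot>\<^bsub>free_module k S\<^esub> free_gen k s \<oplus>\<^bsub>free_module k S\<^esub> ?g"
        using f(1) by (auto simp: free_module_simps free_gen_def free_module_apply fun_eq_iff)
      ultimately show "P f"
        using assms(3,4) g s free_module_apply[OF f(1)] module.smult_closed[OF free_module_is_module free_module_apply[OF f(1)] free_gen_closed]
        by metis
    qed
  qed
  then show ?thesis
    using assms(1) by (auto simp: mem_free_module)
qed

text \<open>Scaling a coset is defined as a union over its elements. It is a single coset because
  all members of the union coincide and the coset is non-empty.\<close>

lemma quot_module_is_module:
  assumes "module k M" "submodule N k M"
  shows "module k (quot_module M N)"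
    and "linear_map k M (quot_module M N) (\<lambda>x. N +>\<^bsub>M\<^esub> x)"
proof -
  interpret M: module k M by fact
  interpret N: submodule N k M by fact
  interpret N: abelian_subgroup N M
    by (rule abelian_subgroupI3)
      (auto intro: additive_subgroupI N.subgroup_axioms M.abelian_group_axioms)
  let ?Q = "quot_module M N"
  have carrier: "carrier ?Q = (\<lambda>x. N +>\<^bsub>M\<^esub> x) ` carrier M"
    by (auto simp: quot_module_def A_RCOSETS_def')
  have add: "(N +>\<^bsub>M\<^esub> x) \<oplus>\<^bsub>?Q\<^esub> (N +>\<^bsub>M\<^esub> y) = N +>\<^bsub>M\<^esub> (x \<oplus>\<^bsub>M\<^esub> y)"
    if "x \<in> carrier M" "y \<in> carrier M" for x y
    using that by (simp add: quot_module_def N.a_rcos_sum)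
  have coset_eq: "N +>\<^bsub>M\<^esub> y = N +>\<^bsub>M\<^esub> x" if "x \<in> carrier M" "n \<in> N" "y = n \<oplus>\<^bsub>M\<^esub> x" for x y n
    using that by (metis M.a_repr_independence M.a_rcosI N.a_subgroup N.a_subset)
  have smult: "c \<odot>\<^bsub>?Q\<^esub> (N +>\<^bsub>M\<^esub> x) = N +>\<^bsub>M\<^esub> (c \<odot>\<^bsub>M\<^esub> x)"
    if c: "c \<in> carrier k" and x: "x \<in> carrier M" for c x
  proof -
    have "N +>\<^bsub>M\<^esub> (c \<odot>\<^bsub>M\<^esub> y) = N +>\<^bsub>M\<^esub> (c \<odot>\<^bsub>M\<^esub> x)" if "y \<in> N +>\<^bsub>M\<^esub> x" for y
    proof -
      from that obtain n where n: "n \<in> N" "y = n \<oplus>\<^bsub>M\<^esub> x"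
        by (auto simp: a_r_coset_def')
      then show ?thesis
        using c x by (intro coset_eq[of _ "c \<odot>\<^bsub>M\<^esub> n"]) (auto simp: M.smult_r_distr)
    qed
    moreover have "x \<in> N +>\<^bsub>M\<^esub> x" using x by (simp add: N.a_rcos_self)
    ultimately have "(\<Union>y\<in>N +>\<^bsub>M\<^esub> x. N +>\<^bsub>M\<^esub> (c \<odot>\<^bsub>M\<^esub> y)) = N +>\<^bsub>M\<^esub> (c \<odot>\<^bsub>M\<^esub> x)"
      by blast
    then show ?thesis by (simp add: quot_module_def)
  qed
  have zero: "\<zero>\<^bsub>?Q\<^esub> = N +>\<^bsub>M\<^esub> \<zero>\<^bsub>M\<^esub>"
    using N.a_subset by (simp add: quot_module_def)
  have "\<exists>Y\<in>carrier ?Q. Y \<oplus>\<^bsub>?Q\<^esub> X = \<zero>\<^bsub>?Q\<^esub>" if "X \<in> carrier ?Q" for X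
  proof -
    from that obtain x where x: "x \<in> carrier M" "X = N +>\<^bsub>M\<^esub> x"
      by (auto simp: carrier)
    then show ?thesis
      by (intro bexI[of _ "N +>\<^bsub>M\<^esub> (\<ominus>\<^bsub>M\<^esub> x)"]) (auto simp: carrier add zero M.l_neg)
  qed
  then have "abelian_group ?Q"
    by (intro abelian_groupI) (auto simp: carrier add zero M.a_ac)
  then show "module k ?Q"
    by (intro moduleI)
      (auto simp: carrier add smult is_cring M.smult_l_distr M.smult_r_distr M.smult_assoc1)
  show "linear_map k M ?Q (\<lambda>x. N +>\<^bsub>M\<^esub> x)"
    by (rule linear_mapI) (auto simp: carrier add smult)
qed

end

text \<open>This is the sum that \<open>pres_lift\<close> evaluates on each representative of a
  class; its linearity is proved before classes enter.\<close>

definition free_lift :: "'k ring \<Rightarrow> ('k, 'q) module \<Rightarrow> ('s \<Rightarrow> 'q) \<Rightarrow> ('s \<Rightarrow> 'k) \<Rightarrow> 'q" where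
  "free_lift k Q \<phi> f = (\<Oplus>\<^bsub>Q\<^esub>s\<in>{s. f s \<noteq> \<zero>\<^bsub>k\<^esub>}. f s \<odot>\<^bsub>Q\<^esub> \<phi> s)"

text \<open>The supports of \<open>f\<close>, \<open>g\<close> and their sum differ, so the proof of
  linearity has to bring all sums to one common finite index set.\<close>

lemma free_lift_superset:
  assumes "module k Q" "\<phi> \<in> S \<rightarrow> carrier Q" "f \<in> carrier (free_module k S)"
    and "finite B" "{s. f s \<noteq> \<zero>\<^bsub>k\<^esub>} \<subseteq> B" "B \<subseteq> S"
  shows "free_lift k Q \<phi> f = (\<Oplus>\<^bsub>Q\<^esub>s\<in>B. f s \<odot>\<^bsub>Q\<^esub> \<phi> s)"
proof -
  interpret Q: module k Q by fact
  interpret K: scalars k ..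
  show ?thesis
    unfolding free_lift_def
    by (rule Q.M.add.finprod_mono_neutral_cong_left)
      (use assms in \<open>auto simp: K.free_module_apply Pi_iff subset_iff\<close>)
qed

lemma free_lift_linear:
  assumes Q: "module k Q" and \<phi>: "\<phi> \<in> S \<rightarrow> carrier Q"
  shows "linear_map k (free_module k S) Q (free_lift k Q \<phi>)"
proof -
  interpret Q: module k Q by fact
  interpret K: scalars k ..
  let ?F = "free_module k S"
  interpret F: module k ?F by (rule K.free_module_is_module)
  note app = K.free_module_apply
  have supp: "finite {s. f s \<noteq> \<zero>\<^bsub>k\<^esub>}" "{s. f s \<noteq> \<zero>\<^bsub>k\<^esub>} \<subseteq> S" if "f \<in> carrier ?F" for f
    using that by (auto simp: mem_free_module)
  show ?thesis
  proof (rule linear_mapI)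
    fix f assume f: "f \<in> carrier ?F"
    show "free_lift k Q \<phi> f \<in> carrier Q"
      unfolding free_lift_def
      by (rule Q.finsum_closed) (use f \<phi> supp[OF f] in \<open>auto simp: app Pi_iff subset_iff\<close>)
  next
    fix f g assume f: "f \<in> carrier ?F" and g: "g \<in> carrier ?F"
    let ?B = "{s. f s \<noteq> \<zero>\<^bsub>k\<^esub>} \<union> {s. g s \<noteq> \<zero>\<^bsub>k\<^esub>}"
    have B: "finite ?B" "?B \<subseteq> S" using supp f g by auto
    have fg: "f \<oplus>\<^bsub>?F\<^esub> g \<in> carrier ?F" using f g by (rule F.a_closed)
    have "free_lift k Q \<phi> (f \<oplus>\<^bsub>?F\<^esub> g) = (\<Oplus>\<^bsub>Q\<^esub>s\<in>?B. (f s \<oplus>\<^bsub>k\<^esub> g s) \<odot>\<^bsub>Q\<^esub> \<phi> s)"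
    proof -
      have "{s. (f \<oplus>\<^bsub>?F\<^esub> g) s \<noteq> \<zero>\<^bsub>k\<^esub>} \<subseteq> ?B" by (auto simp: free_module_simps)
      from free_lift_superset[OF Q \<phi> fg B(1) this B(2)] show ?thesis by (simp add: free_module_simps)
    qed
    also have "\<dots> = (\<Oplus>\<^bsub>Q\<^esub>s\<in>?B. f s \<odot>\<^bsub>Q\<^esub> \<phi> s \<oplus>\<^bsub>Q\<^esub> g s \<odot>\<^bsub>Q\<^esub> \<phi> s)"
      by (rule Q.finsum_cong') (use f g \<phi> B(2) in \<open>auto simp: app Pi_iff subset_iff Q.smult_l_distr\<close>)
    also have "\<dots> = (\<Oplus>\<^bsub>Q\<^esub>s\<in>?B. f s \<odot>\<^bsub>Q\<^esub> \<phi> s) \<oplus>\<^bsub>Q\<^esub> (\<Oplus>\<^bsub>Q\<^esub>s\<in>?B. g s \<odot>\<^bsub>Q\<^esub> \<phi> s)"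
      by (rule Q.finsum_addf) (use f g \<phi> B(2) in \<open>auto simp: app Pi_iff subset_iff\<close>)
    also have "\<dots> = free_lift k Q \<phi> f \<oplus>\<^bsub>Q\<^esub> free_lift k Q \<phi> g"
      using free_lift_superset[OF Q \<phi> f B(1) _ B(2)] free_lift_superset[OF Q \<phi> g B(1) _ B(2)] by auto
    finally show "free_lift k Q \<phi> (f \<oplus>\<^bsub>?F\<^esub> g) = \<dots>" .
  next
    fix c f assume c: "c \<in> carrier k" and f: "f \<in> carrier ?F"
    let ?B = "{s. f s \<noteq> \<zero>\<^bsub>k\<^esub>}"
    have cf: "c \<odot>\<^bsub>?F\<^esub> f \<in> carrier ?F" using c f by (rule F.smult_closed)
    have "free_lift k Q \<phi> (c \<odot>\<^bsub>?F\<^esub> f) = (\<Oplus>\<^bsub>Q\<^esub>s\<in>?B. (c \<otimes>\<^bsub>k\<^esub> f s) \<odot>\<^bsub>Q\<^esub> \<phi> s)"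
    proof -
      have "{s. (c \<odot>\<^bsub>?F\<^esub> f) s \<noteq> \<zero>\<^bsub>k\<^esub>} \<subseteq> ?B" using c by (auto simp: free_module_simps)
      from free_lift_superset[OF Q \<phi> cf supp(1)[OF f] this supp(2)[OF f]] show ?thesis by (simp add: free_module_simps)
    qed
    also have "\<dots> = (\<Oplus>\<^bsub>Q\<^esub>s\<in>?B. c \<odot>\<^bsub>Q\<^esub> (f s \<odot>\<^bsub>Q\<^esub> \<phi> s))"
      by (rule Q.finsum_cong') (use f c \<phi> supp[OF f] in \<open>auto simp: app Pi_iff subset_iff Q.smult_assoc1\<close>)
    also have "\<dots> = c \<odot>\<^bsub>Q\<^esub> free_lift k Q \<phi> f"
      unfolding free_lift_def
      by (rule Q.finsum_smult_ldistr[symmetric]) (use f c \<phi> supp[OF f] in \<open>auto simp: app Pi_iff subset_iff\<close>)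
    finally show "free_lift k Q \<phi> (c \<odot>\<^bsub>?F\<^esub> f) = \<dots>" .
  qed
qed

lemma free_lift_gen:
  assumes Q: "module k Q" and "\<phi> \<in> S \<rightarrow> carrier Q" "s \<in> S"
  shows "free_lift k Q \<phi> (free_gen k s) = \<phi> s"
proof -
  interpret Q: module k Q by fact
  interpret K: scalars k ..
  have "free_lift k Q \<phi> (free_gen k s) = (\<Oplus>\<^bsub>Q\<^esub>t\<in>{s}. free_gen k s t \<odot>\<^bsub>Q\<^esub> \<phi> t)"
    using assms by (intro free_lift_superset[OF Q, of _ S])
      (auto simp: K.free_gen_closed, auto simp: free_gen_def split: if_splits)
  also have "\<dots> = \<phi> s"
    using assms by (subst Q.finsum_insert) (auto simp: free_gen_def Pi_iff)
  finally show ?thesis .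
qed

text \<open>Tensor products and the direct sum of all tensor powers are both instances; what follows
  from generators and relations alone is proved here once.\<close>

locale presentation = scalars k for k :: "'k ring" (structure) +
  fixes S :: "'s set" and rels :: "('s \<Rightarrow> 'k) set"
  assumes rels_closed: "rels \<subseteq> carrier (free_module k S)"
begin

definition "rel_span = submodule_span k (free_module k S) rels"

definition "presented = quot_module (free_module k S) rel_span"

definition "gen_class s = rel_span +>\<^bsub>free_module k S\<^esub> free_gen k s"

definition compatible :: "('k, 'q) module \<Rightarrow> ('s \<Rightarrow> 'q) \<Rightarrow> bool" where
  "compatible Q \<phi> \<longleftrightarrow> \<phi> \<in> S \<rightarrow> carrier Q \<and> (\<forall>r\<in>rels. free_lift k Q \<phi> r = \<zero>\<^bsub>Q\<^esub>)"

lemma rel_span_submodule: "submodule rel_span k (free_module k S)"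
  unfolding rel_span_def using free_module_is_module rels_closed by (rule submodule_span_submodule)

lemma presented_module: "module k presented"
  unfolding presented_def using free_module_is_module rel_span_submodule by (rule quot_module_is_module)

lemma quotient_map_linear: "linear_map k (free_module k S) presented (\<lambda>f. rel_span +>\<^bsub>free_module k S\<^esub> f)"
  unfolding presented_def using free_module_is_module rel_span_submodule by (rule quot_module_is_module)

lemma gen_class_closed: "s \<in> S \<Longrightarrow> gen_class s \<in> carrier presented"
  unfolding gen_class_def using quotient_map_linear free_gen_closed by (rule linear_map_closed)

lemma presented_rep:
  assumes "X \<in> carrier presented"
  obtains f where "f \<in> carrier (free_module k S)" "X = rel_span +>\<^bsub>free_module k S\<^esub> f"
  using assms unfolding presented_def quot_module_def A_RCOSETS_def' by auto

lemma quotient_map_rel: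
  assumes "r \<in> rels"
  shows "rel_span +>\<^bsub>free_module k S\<^esub> r = \<zero>\<^bsub>presented\<^esub>"
proof -
  interpret F: module k "free_module k S" by (rule free_module_is_module)
  have "r \<in> rel_span"
    unfolding rel_span_def by (rule subsetD[OF submodule_span_superset assms])
  then show ?thesis
    using F.a_coset_join2[of r rel_span] submodule.axioms(1)[OF rel_span_submodule] assms rels_closed
    by (auto simp: presented_def quot_module_def)
qed

lemma quotient_map_eqI:
  assumes "f \<ominus>\<^bsub>free_module k S\<^esub> g \<in> rels" "f \<in> carrier (free_module k S)" "g \<in> carrier (free_module k S)"
  shows "rel_span +>\<^bsub>free_module k S\<^esub> f = rel_span +>\<^bsub>free_module k S\<^esub> g"
  using quotient_map_rel[OF assms(1)] linear_map_closed[OF quotient_map_linear assms(2)]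
    linear_map_closed[OF quotient_map_linear assms(3)]
    linear_map_minus[OF quotient_map_linear free_module_is_module presented_module assms(2,3)]
  by (auto dest: abelian_group.eq_if_minus_eq_zero[OF module.axioms(2)[OF presented_module]])

lemma presented_induct [consumes 1, case_names zero gen add]:
  assumes "X \<in> carrier presented"
    and "P \<zero>\<^bsub>presented\<^esub>"
    and "\<And>c s. c \<in> carrier k \<Longrightarrow> s \<in> S \<Longrightarrow> P (c \<odot>\<^bsub>presented\<^esub> gen_class s)"
    and "\<And>X Y. X \<in> carrier presented \<Longrightarrow> Y \<in> carrier presented \<Longrightarrow> P X \<Longrightarrow> P Y \<Longrightarrow> P (X \<oplus>\<^bsub>presented\<^esub> Y)"
  shows "P X"
proof -
  let ?\<pi> = "\<lambda>f. rel_span +>\<^bsub>free_module k S\<^esub> f"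
  note \<pi> = quotient_map_linear
  interpret F: module k "free_module k S" by (rule free_module_is_module)
  have "P (?\<pi> f)" if "f \<in> carrier (free_module k S)" for f
    using that
  proof (induction rule: free_module_induct)
    case zero
    then show ?case
      using linear_map_zero[OF \<pi> F.module_axioms presented_module] assms(2) by (simp add: free_module_simps)
  next
    case (gen c s)
    then show ?case
      using linear_map_smult[OF \<pi> free_gen_closed gen(1), of s] assms(3)[of c s]
      by (simp add: gen_class_def)
  next
    case (add f g)
    then show ?case
      using linear_map_add[OF \<pi> add(1,2)] assms(4) linear_map_closed[OF \<pi>]
      by (simp)
  qed
  with assms(1) show ?thesis by (auto elim: presented_rep)
qed

text \<open>\<open>pres_lift\<close> takes \<open>the_elem\<close> of the image of a class, so the
  image must be a singleton: the relation span lies in the kernel of the free extension, and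
  \<open>f\<close> itself belongs to its class.\<close>

lemma pres_lift_quotient_map:
  assumes Q: "module k Q" and \<phi>: "compatible Q \<phi>" and f: "f \<in> carrier (free_module k S)"
  shows "pres_lift k Q \<phi> (rel_span +>\<^bsub>free_module k S\<^esub> f) = free_lift k Q \<phi> f"
proof -
  let ?F = "free_module k S"
  interpret F: module k ?F by (rule free_module_is_module)
  interpret Q: module k Q by fact
  interpret N: submodule rel_span k ?F by (rule rel_span_submodule)
  have \<phi>': "\<phi> \<in> S \<rightarrow> carrier Q" using \<phi> by (simp add: compatible_def)
  note lin = free_lift_linear[OF Q \<phi>']
  have sub: "rel_span \<subseteq> {x \<in> carrier ?F. free_lift k Q \<phi> x = \<zero>\<^bsub>Q\<^esub>}"
    unfolding rel_span_def
    by (rule submodule_span_least[OF linear_map_kernel_submodule[OF lin F.module_axioms Q]])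
      (use \<phi> rels_closed in \<open>auto simp: compatible_def\<close>)
  have "free_lift k Q \<phi> g = free_lift k Q \<phi> f" if "g \<in> rel_span +>\<^bsub>?F\<^esub> f" for g
  proof -
    from that obtain n where n: "n \<in> rel_span" "g = n \<oplus>\<^bsub>?F\<^esub> f"
      by (auto simp: a_r_coset_def')
    then have "n \<in> carrier ?F" "free_lift k Q \<phi> n = \<zero>\<^bsub>Q\<^esub>" using sub by auto
    then show ?thesis
      using linear_map_add[OF lin _ f] linear_map_closed[OF lin f] n(2) by simp
  qed
  moreover have "f \<in> rel_span +>\<^bsub>?F\<^esub> f"
    using F.a_rcosI[of "\<zero>\<^bsub>?F\<^esub>" rel_span f] N.one_closed N.subset f F.M.l_zero[OF f] by auto
  ultimately have "free_lift k Q \<phi> ` (rel_span +>\<^bsub>?F\<^esub> f) = {free_lift k Q \<phi> f}"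
    by blast
  then show ?thesis
    by (simp add: pres_lift_def free_lift_def)
qed

lemma pres_lift_linear:
  assumes Q: "module k Q" and \<phi>: "compatible Q \<phi>"
  shows "linear_map k presented Q (pres_lift k Q \<phi>)"
proof -
  let ?F = "free_module k S" and ?\<pi> = "\<lambda>f. rel_span +>\<^bsub>free_module k S\<^esub> f"
  interpret F: module k ?F by (rule free_module_is_module)
  have lin: "linear_map k ?F Q (free_lift k Q \<phi>)"
    using Q \<phi> by (intro free_lift_linear) (auto simp: compatible_def)
  note lift = pres_lift_quotient_map[OF Q \<phi>]
  show ?thesis
  proof (rule linear_mapI)
    fix X assume "X \<in> carrier presented"
    then show "pres_lift k Q \<phi> X \<in> carrier Q"
      by (elim presented_rep) (simp add: lift linear_map_closed[OF lin])
  next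
    fix X Y assume X: "X \<in> carrier presented" and Y: "Y \<in> carrier presented"
    from X obtain f where "f \<in> carrier ?F" "X = ?\<pi> f" by (rule presented_rep)
    moreover from Y obtain g where "g \<in> carrier ?F" "Y = ?\<pi> g" by (rule presented_rep)
    ultimately show "pres_lift k Q \<phi> (X \<oplus>\<^bsub>presented\<^esub> Y) = pres_lift k Q \<phi> X \<oplus>\<^bsub>Q\<^esub> pres_lift k Q \<phi> Y"
      using lift[OF F.a_closed] by (simp add: lift linear_map_add[OF quotient_map_linear, symmetric] linear_map_add[OF lin])
  next
    fix c X assume c: "c \<in> carrier k" and X: "X \<in> carrier presented"
    from X obtain f where "f \<in> carrier ?F" "X = ?\<pi> f" by (rule presented_rep)
    with c show "pres_lift k Q \<phi> (c \<odot>\<^bsub>presented\<^esub> X) = c \<odot>\<^bsub>Q\<^esub> pres_lift k Q \<phi> X"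
      using lift[OF F.smult_closed] by (simp add: lift linear_map_smult[OF quotient_map_linear, symmetric] linear_map_smult[OF lin])
  qed
qed

lemma pres_lift_gen_class:
  assumes Q: "module k Q" and \<phi>: "compatible Q \<phi>" and s: "s \<in> S"
  shows "pres_lift k Q \<phi> (gen_class s) = \<phi> s"
  using pres_lift_quotient_map[OF Q \<phi> free_gen_closed[OF s]] free_lift_gen[OF Q _ s] \<phi>
  by (auto simp: gen_class_def compatible_def)

text \<open>Maps given by a \<open>case\<close> or a length test match the intended map on
  \<open>S\<close> only. The two sums agree on each representative in \<open>X\<close>, so the
  images of \<open>X\<close> coincide.\<close>

lemma pres_lift_cong:
  assumes X: "X \<in> carrier presented" and eq: "\<And>s. s \<in> S \<Longrightarrow> \<phi> s = \<psi> s" and "\<psi> \<in> S \<rightarrow> carrier Q" "module k Q"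
  shows "pres_lift k Q \<phi> X = pres_lift k Q \<psi> X"
proof -
  interpret F: module k "free_module k S" by (rule free_module_is_module)
  interpret Q: module k Q by fact
  have "X \<subseteq> carrier (free_module k S)"
    using X F.submoduleE(1)[OF rel_span_submodule] F.a_r_coset_subset_G by (elim presented_rep) blast
  then have "free_lift k Q \<phi> f = free_lift k Q \<psi> f" if "f \<in> X" for f
  proof -
    have f: "f \<in> carrier (free_module k S)" using that \<open>X \<subseteq> _\<close> by auto
    then have "s \<in> S" if "f s \<noteq> \<zero>" for s using that by (auto simp: mem_free_module)
    then show ?thesis
      unfolding free_lift_def
      by (intro Q.finsum_cong') (use eq assms(3) free_module_apply[OF f] in \<open>auto simp: Pi_iff\<close>)
  qed
  then have "(\<lambda>f. free_lift k Q \<phi> f) ` X = (\<lambda>f. free_lift k Q \<psi> f) ` X"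
    by (intro image_cong) auto
  then show ?thesis
    unfolding pres_lift_def free_lift_def by simp
qed

text \<open>Closure of compatibility under linear combinations carries the induction on the inner
  argument of an iterated lift.\<close>

lemma
  assumes Q: "module k Q"
  shows compatible_zero: "compatible Q (\<lambda>s. \<zero>\<^bsub>Q\<^esub>)"
    and compatible_add: "compatible Q \<phi> \<Longrightarrow> compatible Q \<psi> \<Longrightarrow> compatible Q (\<lambda>s. \<phi> s \<oplus>\<^bsub>Q\<^esub> \<psi> s)"
    and compatible_smult: "c \<in> carrier k \<Longrightarrow> compatible Q \<phi> \<Longrightarrow> compatible Q (\<lambda>s. c \<odot>\<^bsub>Q\<^esub> \<phi> s)"
    and compatible_cong: "(\<And>s. s \<in> S \<Longrightarrow> \<phi> s = \<psi> s) \<Longrightarrow> compatible Q \<phi> \<longleftrightarrow> compatible Q \<psi>"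
proof -
  interpret Q: module k Q by fact
  let ?F = "free_module k S"
  interpret F: module k ?F by (rule free_module_is_module)
  \<comment> \<open>A linear map on a free module is determined by its values on generators; each
    identity between free extensions below is an instance.\<close>
  have eqI: "f r = g r" if "linear_map k ?F Q f" "linear_map k ?F Q g" "r \<in> carrier ?F"
    "\<And>s. s \<in> S \<Longrightarrow> f (free_gen k s) = g (free_gen k s)" for f g r
    using that(3)
  proof (induction rule: free_module_induct)
    case zero
    then show ?case using linear_map_zero[OF that(1) F.module_axioms Q] linear_map_zero[OF that(2) F.module_axioms Q] by (simp add: free_module_simps)
  next
    case (gen c s)
    then show ?case using that by (simp add: linear_map_smult free_gen_closed)
  next
    case (add f g)
    then show ?case using that by (simp add: linear_map_add)
  qed
  note lin = free_lift_linear[OF Q] and gen = free_lift_gen[OF Q, where S = S]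
  show "compatible Q (\<lambda>s. \<zero>\<^bsub>Q\<^esub>)"
    using eqI[OF lin[of "\<lambda>s. \<zero>\<^bsub>Q\<^esub>" S] linear_map_const_zero[OF Q]] rels_closed
    by (auto simp: compatible_def gen)
  show "compatible Q (\<lambda>s. \<phi> s \<oplus>\<^bsub>Q\<^esub> \<psi> s)" if "compatible Q \<phi>" "compatible Q \<psi>"
  proof -
    from that have \<phi>: "\<phi> \<in> S \<rightarrow> carrier Q" and \<psi>: "\<psi> \<in> S \<rightarrow> carrier Q"
      by (auto simp: compatible_def)
    then have \<phi>\<psi>: "(\<lambda>s. \<phi> s \<oplus>\<^bsub>Q\<^esub> \<psi> s) \<in> S \<rightarrow> carrier Q" by auto
    have "free_lift k Q (\<lambda>s. \<phi> s \<oplus>\<^bsub>Q\<^esub> \<psi> s) r = free_lift k Q \<phi> r \<oplus>\<^bsub>Q\<^esub> free_lift k Q \<psi> r" if "r \<in> carrier ?F" for r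
      by (rule eqI[OF lin linear_map_plus[OF Q lin lin]]) (use \<phi> \<psi> \<phi>\<psi> that in \<open>auto simp: gen\<close>)
    moreover have "r \<in> carrier ?F" if "r \<in> rels" for r using that rels_closed by auto
    ultimately show ?thesis using that \<phi>\<psi> by (simp add: compatible_def)
  qed
  show "compatible Q (\<lambda>s. c \<odot>\<^bsub>Q\<^esub> \<phi> s)" if c: "c \<in> carrier k" and "compatible Q \<phi>"
  proof -
    from that have \<phi>: "\<phi> \<in> S \<rightarrow> carrier Q" by (auto simp: compatible_def)
    then have \<phi>\<psi>: "(\<lambda>s. c \<odot>\<^bsub>Q\<^esub> \<phi> s) \<in> S \<rightarrow> carrier Q" using c by auto
    have "free_lift k Q (\<lambda>s. c \<odot>\<^bsub>Q\<^esub> \<phi> s) r = c \<odot>\<^bsub>Q\<^esub> free_lift k Q \<phi> r" if "r \<in> carrier ?F" for r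
      by (rule eqI[OF lin linear_map_scale[OF Q lin]]) (use \<phi> c \<phi>\<psi> that in \<open>auto simp: gen\<close>)
    moreover have "r \<in> carrier ?F" if "r \<in> rels" for r using that rels_closed by auto
    ultimately show ?thesis using that \<phi>\<psi> by (simp add: compatible_def)
  qed
  show "compatible Q \<phi> \<longleftrightarrow> compatible Q \<psi>" if eq: "\<And>s. s \<in> S \<Longrightarrow> \<phi> s = \<psi> s"
  proof -
    have "free_lift k Q \<phi> r = free_lift k Q \<psi> r" if "\<phi> \<in> S \<rightarrow> carrier Q" "\<psi> \<in> S \<rightarrow> carrier Q" "r \<in> carrier ?F" for r
      by (rule eqI[OF lin lin]) (use eq that in \<open>auto simp: gen\<close>)
    moreover have "\<phi> \<in> S \<rightarrow> carrier Q \<longleftrightarrow> \<psi> \<in> S \<rightarrow> carrier Q" using eq by (simp add: Pi_iff)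
    moreover have "r \<in> carrier ?F" if "r \<in> rels" for r using that rels_closed by auto
    ultimately show ?thesis by (auto simp: compatible_def)
  qed
qed

end

text \<open>The products on tensor products, on \<open>Sh_plus\<close> and on \<open>Sh\<close> are
  all defined by a lift inside a lift. The outer lift makes sense only if the inner one, at a fixed
  \<open>Y\<close>, respects the relations in \<open>s\<close>. This follows by induction on
  \<open>Y\<close>: for a generator it is the second compatibility assumption.\<close>

lemma double_pres_lift:
  assumes "presentation k S R" "presentation k S' R'" and Q: "module k Q"
    and \<phi>: "\<And>s. s \<in> S \<Longrightarrow> presentation.compatible k S' R' Q (\<phi> s)"
    and \<phi>': "\<And>s'. s' \<in> S' \<Longrightarrow> presentation.compatible k S R Q (\<lambda>s. \<phi> s s')"
  shows "bilinear_map k (presentation.presented k S R) (presentation.presented k S' R') Q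
      (\<lambda>X Y. pres_lift k Q (\<lambda>s. pres_lift k Q (\<phi> s) Y) X)"
    and "s \<in> S \<Longrightarrow> s' \<in> S' \<Longrightarrow>
      pres_lift k Q (\<lambda>s. pres_lift k Q (\<phi> s) (presentation.gen_class k S' R' s')) (presentation.gen_class k S R s) = \<phi> s s'"
proof -
  interpret S: presentation k S R by fact
  interpret S': presentation k S' R' by fact
  interpret Q: module k Q by fact
  interpret P': module k S'.presented by (rule S'.presented_module)
  have lin: "linear_map k S'.presented Q (pres_lift k Q (\<phi> s))" if "s \<in> S" for s
    using Q \<phi>[OF that] by (rule S'.pres_lift_linear)
  have compatible: "S.compatible Q (\<lambda>s. pres_lift k Q (\<phi> s) Y)" if "Y \<in> carrier S'.presented" for Y
    using that
  proof (induction rule: S'.presented_induct)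
    case zero
    show ?case
      by (rule S.compatible_cong[OF Q, THEN iffD1, OF _ S.compatible_zero[OF Q]])
        (simp add: linear_map_zero[OF lin S'.presented_module Q])
  next
    case (gen c s')
    show ?case
      by (rule S.compatible_cong[OF Q, THEN iffD1, OF _ S.compatible_smult[OF Q gen(1) \<phi>'[OF gen(2)]]])
        (simp add: gen linear_map_smult[OF lin] S'.gen_class_closed S'.pres_lift_gen_class[OF Q \<phi>])
  next
    case (add X Y)
    show ?case
      by (rule S.compatible_cong[OF Q, THEN iffD1, OF _ S.compatible_add[OF Q add(3,4)]])
        (simp add: add linear_map_add[OF lin])
  qed
  show "bilinear_map k S.presented S'.presented Q (\<lambda>X Y. pres_lift k Q (\<lambda>s. pres_lift k Q (\<phi> s) Y) X)"
  proof (rule bilinear_mapI)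
    fix Y assume "Y \<in> carrier S'.presented"
    then show "linear_map k S.presented Q (\<lambda>X. pres_lift k Q (\<lambda>s. pres_lift k Q (\<phi> s) Y) X)"
      using S.pres_lift_linear[OF Q compatible] by simp
  next
    fix X assume "X \<in> carrier S.presented"
    then show "linear_map k S'.presented Q (\<lambda>Y. pres_lift k Q (\<lambda>s. pres_lift k Q (\<phi> s) Y) X)"
    proof (induction rule: S.presented_induct)
      case zero
      show ?case
        by (rule linear_map_cong[OF S'.presented_module, THEN iffD1, OF _ linear_map_const_zero[OF Q]])
          (simp add: linear_map_zero[OF S.pres_lift_linear[OF Q compatible] S.presented_module Q])
    next
      case (gen c s)
      show ?case
        by (rule linear_map_cong[OF S'.presented_module, THEN iffD1, OF _ linear_map_scale[OF Q lin[OF gen(2)] gen(1)]])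
          (simp add: gen linear_map_smult[OF S.pres_lift_linear[OF Q compatible]] S.gen_class_closed S.pres_lift_gen_class[OF Q compatible])
    next
      case (add X Y)
      show ?case
        by (rule linear_map_cong[OF S'.presented_module, THEN iffD1, OF _ linear_map_plus[OF Q add(3,4)]])
          (simp add: add linear_map_add[OF S.pres_lift_linear[OF Q compatible]])
    qed
  qed
  show "pres_lift k Q (\<lambda>s. pres_lift k Q (\<phi> s) (S'.gen_class s')) (S.gen_class s) = \<phi> s s'"
    if "s \<in> S" "s' \<in> S'"
    using that by (simp add: S.pres_lift_gen_class[OF Q compatible] S'.gen_class_closed S'.pres_lift_gen_class[OF Q \<phi>])
qed


section \<open>Tensor products\<close>

text \<open>The relators before the span is taken, in the form that an instance of
  \<open>presentation\<close> expects.\<close>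

definition tensor_relators :: "'k ring \<Rightarrow> ('k, 'm) module \<Rightarrow> ('k, 'n) module \<Rightarrow> ('m \<times> 'n \<Rightarrow> 'k) set" where
  "tensor_relators k M N =
    (let F = free_module k (carrier M \<times> carrier N); g = free_gen k in
      {g (x \<oplus>\<^bsub>M\<^esub> x', y) \<ominus>\<^bsub>F\<^esub> (g (x, y) \<oplus>\<^bsub>F\<^esub> g (x', y)) | x x' y.
          x \<in> carrier M \<and> x' \<in> carrier M \<and> y \<in> carrier N} \<union>
       {g (x, y \<oplus>\<^bsub>N\<^esub> y') \<ominus>\<^bsub>F\<^esub> (g (x, y) \<oplus>\<^bsub>F\<^esub> g (x, y')) | x y y'.
          x \<in> carrier M \<and> y \<in> carrier N \<and> y' \<in> carrier N} \<union>
       {g (c \<odot>\<^bsub>M\<^esub> x, y) \<ominus>\<^bsub>F\<^esub> c \<odot>\<^bsub>F\<^esub> g (x, y) | c x y.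
          c \<in> carrier k \<and> x \<in> carrier M \<and> y \<in> carrier N} \<union>
       {g (x, c \<odot>\<^bsub>N\<^esub> y) \<ominus>\<^bsub>F\<^esub> c \<odot>\<^bsub>F\<^esub> g (x, y) | c x y.
          c \<in> carrier k \<and> x \<in> carrier M \<and> y \<in> carrier N})"

lemma tensor_rels_eq: "tensor_rels k M N = submodule_span k (free_module k (carrier M \<times> carrier N)) (tensor_relators k M N)"
  by (simp only: tensor_rels_def tensor_relators_def Let_def)

lemma tensor_simps [simp]:
  "carrier (tensor k M N) = carrier (tensor_module k M N)"
  "zero (tensor k M N) = zero (tensor_module k M N)"
  "add (tensor k M N) = add (tensor_module k M N)"
  "smult (tensor k M N) = smult (tensor_module k M N)"
  "one (tensor k M N) = pure k M N \<one>\<^bsub>M\<^esub> \<one>\<^bsub>N\<^esub>"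
  by (simp_all add: tensor_def)

text \<open>A lift uses only addition, zero and scaling of its target, which the multiplication
  added by \<open>tensor\<close> leaves unchanged.\<close>

lemma pres_lift_tensor: "pres_lift k (tensor_module k M N) = pres_lift k (tensor k M N)"
  by (simp add: pres_lift_def finsum_def fun_eq_iff)

lemma linear_map_tensor_simps [simp]:
  "linear_map k Q (tensor_module k M N) = linear_map k Q (tensor k M N)"
  "linear_map k (tensor_module k M N) Q = linear_map k (tensor k M N) Q"
  by (simp_all add: linear_map_def fun_eq_iff)

locale module_pair = M: module k M + N: module k N
  for k :: "'k ring" and M :: "('k, 'm) module" and N :: "('k, 'n) module"
begin

sublocale pres: presentation k "carrier M \<times> carrier N" "tensor_relators k M N"
proof -
  interpret scalars k ..
  interpret F: module k "free_module k (carrier M \<times> carrier N)" by (rule free_module_is_module)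
  show "presentation k (carrier M \<times> carrier N) (tensor_relators k M N)"
    by unfold_locales
      (auto simp: tensor_relators_def Let_def
        intro!: F.minus_closed F.a_closed F.smult_closed free_gen_closed)
qed

lemma presented_eq: "pres.presented = tensor_module k M N"
  by (simp add: pres.presented_def pres.rel_span_def tensor_module_def tensor_rels_eq)

lemma gen_class_eq: "pres.gen_class (x, y) = pure k M N x y"
  by (simp add: pres.gen_class_def pres.rel_span_def pure_def tensor_rels_eq)

lemma tensor_is_module: "module k (tensor k M N)"
  by (rule module_cong[OF pres.presented_module]) (simp_all add: presented_eq)

sublocale T: module k "tensor k M N"
  by (rule tensor_is_module)

lemma pure_bilinear: "bilinear_map k M N (tensor k M N) (pure k M N)"
proof -
  let ?F = "free_module k (carrier M \<times> carrier N)"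
  let ?\<pi> = "\<lambda>f. pres.rel_span +>\<^bsub>?F\<^esub> f"
  interpret F: module k ?F by (rule pres.free_module_is_module)
  note \<pi> = pres.quotient_map_linear
  note gen = pres.free_gen_closed[of _ "carrier M \<times> carrier N"]
  have \<pi>_gen: "?\<pi> (free_gen k (x, y)) = pure k M N x y" for x y
    using gen_class_eq by (simp add: pres.gen_class_def)
  have pure_closed: "pure k M N x y \<in> carrier (tensor k M N)" if "x \<in> carrier M" "y \<in> carrier N" for x y
    using pres.gen_class_closed[of "(x, y)"] that by (simp add: presented_eq gen_class_eq)
  note lin = linear_map_add[OF \<pi>] linear_map_smult[OF \<pi>]
  note rel = tensor_relators_def Let_def
  show ?thesis
  proof (intro bilinear_mapI linear_mapI)
    fix x y y' assume *: "x \<in> carrier M" "y \<in> carrier N" "y' \<in> carrier N"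
    have "?\<pi> (free_gen k (x, y \<oplus>\<^bsub>N\<^esub> y')) = ?\<pi> (free_gen k (x, y) \<oplus>\<^bsub>?F\<^esub> free_gen k (x, y'))"
      by (rule pres.quotient_map_eqI, unfold rel) (use * in blast, use * gen in simp_all)
    then show "pure k M N x (y \<oplus>\<^bsub>N\<^esub> y') = pure k M N x y \<oplus>\<^bsub>tensor k M N\<^esub> pure k M N x y'"
      using * by (simp add: \<pi>_gen lin gen presented_eq)
  next
    fix c x y assume *: "x \<in> carrier M" "y \<in> carrier N" "c \<in> carrier k"
    have "?\<pi> (free_gen k (x, c \<odot>\<^bsub>N\<^esub> y)) = ?\<pi> (c \<odot>\<^bsub>?F\<^esub> free_gen k (x, y))"
      by (rule pres.quotient_map_eqI, unfold rel) (use * in blast, use * gen in simp_all)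
    then show "pure k M N x (c \<odot>\<^bsub>N\<^esub> y) = c \<odot>\<^bsub>tensor k M N\<^esub> pure k M N x y"
      using * by (simp add: \<pi>_gen lin gen presented_eq)
  next
    fix x x' y assume *: "x \<in> carrier M" "x' \<in> carrier M" "y \<in> carrier N"
    have "?\<pi> (free_gen k (x \<oplus>\<^bsub>M\<^esub> x', y)) = ?\<pi> (free_gen k (x, y) \<oplus>\<^bsub>?F\<^esub> free_gen k (x', y))"
      by (rule pres.quotient_map_eqI, unfold rel) (use * in blast, use * gen in simp_all)
    then show "pure k M N (x \<oplus>\<^bsub>M\<^esub> x') y = pure k M N x y \<oplus>\<^bsub>tensor k M N\<^esub> pure k M N x' y"
      using * by (simp add: \<pi>_gen lin gen presented_eq)
  next
    fix c x y assume *: "x \<in> carrier M" "y \<in> carrier N" "c \<in> carrier k"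
    have "?\<pi> (free_gen k (c \<odot>\<^bsub>M\<^esub> x, y)) = ?\<pi> (c \<odot>\<^bsub>?F\<^esub> free_gen k (x, y))"
      by (rule pres.quotient_map_eqI, unfold rel) (use * in blast, use * gen in simp_all)
    then show "pure k M N (c \<odot>\<^bsub>M\<^esub> x) y = c \<odot>\<^bsub>tensor k M N\<^esub> pure k M N x y"
      using * by (simp add: \<pi>_gen lin gen presented_eq)
  qed (use pure_closed in auto)
qed

lemmas pure_closed = bilinear_map_closed[OF pure_bilinear]

text \<open>Scalars have no case of their own: a scalar is absorbed into the left factor, and zero
  is the pure tensor of two zeros.\<close>

lemma tensor_induct [consumes 1, case_names pure add]:
  assumes "t \<in> carrier (tensor k M N)"
    and "\<And>x y. x \<in> carrier M \<Longrightarrow> y \<in> carrier N \<Longrightarrow> P (pure k M N x y)"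
    and "\<And>t u. t \<in> carrier (tensor k M N) \<Longrightarrow> u \<in> carrier (tensor k M N) \<Longrightarrow> P t \<Longrightarrow> P u
      \<Longrightarrow> P (t \<oplus>\<^bsub>tensor k M N\<^esub> u)"
  shows "P t"
proof -
  have "t \<in> carrier pres.presented" using assms(1) by (simp add: presented_eq)
  then show ?thesis
  proof (induction rule: pres.presented_induct)
    case zero
    have "\<zero>\<^bsub>tensor k M N\<^esub> = pure k M N \<zero>\<^bsub>M\<^esub> \<zero>\<^bsub>N\<^esub>"
      using linear_map_zero[OF bilinear_map_left[OF pure_bilinear] M.module_axioms tensor_is_module, of "\<zero>\<^bsub>N\<^esub>"] by simp
    then show ?case using assms(2) by (simp add: presented_eq)
  next
    case (gen c s)
    obtain x y where s: "s = (x, y)" by (cases s)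
    have "c \<odot>\<^bsub>tensor k M N\<^esub> pure k M N x y = pure k M N (c \<odot>\<^bsub>M\<^esub> x) y"
      using gen s bilinear_map_smult_left[OF pure_bilinear] by simp
    then show ?case using assms(2)[of "c \<odot>\<^bsub>M\<^esub> x" y] gen s by (simp add: presented_eq gen_class_eq)
  next
    case (add X Y)
    then show ?case using assms(3) by (simp add: presented_eq)
  qed
qed

lemma tensor_eqI:
  assumes "t \<in> carrier (tensor k M N)" "linear_map k (tensor k M N) Q f" "linear_map k (tensor k M N) Q g"
    and "\<And>x y. x \<in> carrier M \<Longrightarrow> y \<in> carrier N \<Longrightarrow> f (pure k M N x y) = g (pure k M N x y)"
  shows "f t = g t"
  using assms(1) by (induction rule: tensor_induct)
    (use assms linear_map_add[OF assms(2)] linear_map_add[OF assms(3)] in auto)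

lemma tensor_bilinear_eqI:
  assumes "bilinear_map k (tensor k M N) (tensor k M N) Q f" "bilinear_map k (tensor k M N) (tensor k M N) Q g"
    and t: "t \<in> carrier (tensor k M N)" and u: "u \<in> carrier (tensor k M N)"
    and "\<And>x y x' y'. \<lbrakk>x \<in> carrier M; y \<in> carrier N; x' \<in> carrier M; y' \<in> carrier N\<rbrakk> \<Longrightarrow>
      f (pure k M N x y) (pure k M N x' y') = g (pure k M N x y) (pure k M N x' y')"
  shows "f t u = g t u"
proof (rule tensor_eqI[OF t bilinear_map_left[OF assms(1) u] bilinear_map_left[OF assms(2) u]])
  fix x y assume "x \<in> carrier M" "y \<in> carrier N"
  then show "f (pure k M N x y) u = g (pure k M N x y) u"
    by (intro tensor_eqI[OF u bilinear_map_right[OF assms(1)] bilinear_map_right[OF assms(2)]] pure_closed assms(5))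
qed

lemma compatible_if_bilinear:
  assumes Q: "module k Q" and f: "bilinear_map k M N Q f"
  shows "pres.compatible Q (\<lambda>(x, y). f x y)"
proof -
  let ?F = "free_module k (carrier M \<times> carrier N)"
  interpret F: module k ?F by (rule pres.free_module_is_module)
  interpret Q: module k Q by fact
  let ?L = "free_lift k Q (\<lambda>(x, y). f x y)"
  have \<phi>: "(\<lambda>(x, y). f x y) \<in> carrier M \<times> carrier N \<rightarrow> carrier Q"
    using bilinear_map_closed[OF f] by auto
  have gen: "?L (free_gen k (x, y)) = f x y" if "x \<in> carrier M" "y \<in> carrier N" for x y
    using free_lift_gen[OF Q \<phi>, of "(x, y)"] that by simp
  note lin = free_lift_linear[OF Q \<phi>]
  note lins = linear_map_add[OF lin] linear_map_smult[OF lin]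
    linear_map_minus[OF lin F.module_axioms Q]
  have Q_minus: "x \<ominus>\<^bsub>Q\<^esub> x = \<zero>\<^bsub>Q\<^esub>" if "x \<in> carrier Q" for x
    using that by (simp add: a_minus_def Q.r_neg)
  have "?L r = \<zero>\<^bsub>Q\<^esub>" if "r \<in> tensor_relators k M N" for r
    using that unfolding tensor_relators_def Let_def
    by (auto simp: lins gen pres.free_gen_closed bilinear_map_add_left[OF f] bilinear_map_add_right[OF f]
        bilinear_map_smult_left[OF f] bilinear_map_smult_right[OF f] bilinear_map_closed[OF f]
        Q_minus)
  with \<phi> show ?thesis by (auto simp: pres.compatible_def)
qed

lemma tensor_lift_linear:
  assumes "module k Q" "bilinear_map k M N Q f"
  shows "linear_map k (tensor k M N) Q (pres_lift k Q (\<lambda>(x, y). f x y))"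
  using pres.pres_lift_linear[OF assms(1) compatible_if_bilinear[OF assms]] by (simp add: presented_eq)

lemma tensor_lift_pure:
  assumes "module k Q" "bilinear_map k M N Q f" "x \<in> carrier M" "y \<in> carrier N"
  shows "pres_lift k Q (\<lambda>(x, y). f x y) (pure k M N x y) = f x y"
  using pres.pres_lift_gen_class[OF assms(1) compatible_if_bilinear[OF assms(1,2)], of "(x, y)"] assms(3,4)
  by (simp add: gen_class_eq)

end

lemma tensor_map_linear:
  assumes "module_pair k M N" "module_pair k M' N'" "linear_map k M M' f" "linear_map k N N' g"
  shows "linear_map k (tensor k M N) (tensor k M' N') (tensor_map k M' N' f g)"
    and "x \<in> carrier M \<Longrightarrow> y \<in> carrier N \<Longrightarrow>
      tensor_map k M' N' f g (pure k M N x y) = pure k M' N' (f x) (g y)"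
proof -
  interpret T: module_pair k M N by fact
  interpret T': module_pair k M' N' by fact
  have "bilinear_map k M N (tensor k M' N') (\<lambda>x y. pure k M' N' (f x) (g y))"
    using T'.pure_bilinear assms(3,4) by (rule bilinear_map_compose)
  then show "linear_map k (tensor k M N) (tensor k M' N') (tensor_map k M' N' f g)"
    and "x \<in> carrier M \<Longrightarrow> y \<in> carrier N \<Longrightarrow>
      tensor_map k M' N' f g (pure k M N x y) = pure k M' N' (f x) (g y)"
    unfolding tensor_map_def
    by (auto intro: T.tensor_lift_linear T'.tensor_is_module simp: T.tensor_lift_pure T'.tensor_is_module)
qed

lemma tensor_map_compose:
  assumes "module_pair k M N" "module_pair k M' N'" "module_pair k M'' N''"
    and "linear_map k M M' f" "linear_map k N N' g" "linear_map k M' M'' f'" "linear_map k N' N'' g'"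
    and "t \<in> carrier (tensor k M N)"
  shows "tensor_map k M'' N'' f' g' (tensor_map k M' N' f g t) =
    tensor_map k M'' N'' (\<lambda>x. f' (f x)) (\<lambda>y. g' (g y)) t"
  by (rule module_pair.tensor_eqI[OF assms(1,8),
        OF linear_map_compose[OF tensor_map_linear(1) tensor_map_linear(1)] tensor_map_linear(1)])
    (use assms in \<open>auto simp: tensor_map_linear(2) linear_map_closed linear_map_compose\<close>)

lemma tensor_map_cong:
  assumes "module_pair k M N" "module_pair k M' N'" "linear_map k M M' f" "linear_map k N N' g"
    and "\<And>x. x \<in> carrier M \<Longrightarrow> f x = f' x" "\<And>y. y \<in> carrier N \<Longrightarrow> g y = g' y"
    and "t \<in> carrier (tensor k M N)"
  shows "tensor_map k M' N' f g t = tensor_map k M' N' f' g' t"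
proof -
  interpret module_pair k M N by fact
  have lin: "linear_map k M M' f'" "linear_map k N N' g'"
    using assms linear_map_cong[OF M.module_axioms, of f f'] linear_map_cong[OF N.module_axioms, of g g'] by auto
  then show ?thesis
    by (intro tensor_eqI[OF assms(7) tensor_map_linear(1) tensor_map_linear(1)])
     (use assms in \<open>auto simp: tensor_map_linear(2)\<close>)
qed

section \<open>Threefold tensor products and the associator\<close>

locale module_triple = LM: module_pair k L M + MN: module_pair k M N
  for k :: "'k ring" and L :: "('k, 'l) module" and M :: "('k, 'm) module" and N :: "('k, 'n) module"
begin

sublocale L_MN: module_pair k L "tensor k M N" ..

sublocale LM_N: module_pair k "tensor k L M" N ..

lemma inner_assoc:
  assumes "z \<in> carrier N"
  shows "bilinear_map k L M (tensor k L (tensor k M N)) (\<lambda>x y. pure k L (tensor k M N) x (pure k M N y z))"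
  using bilinear_map_compose[OF L_MN.pure_bilinear linear_map_id bilinear_map_left[OF MN.pure_bilinear assms]] .

text \<open>Linearity in \<open>z\<close> is not visible from the definition, where \<open>z\<close>
  sits inside a lift over \<open>t\<close>. Induction on \<open>t\<close> reduces it to pure
  tensors, where it is linearity of \<open>pure\<close>.\<close>

lemma tensor_assoc_bilinear:
  "bilinear_map k (tensor k L M) N (tensor k L (tensor k M N)) (\<lambda>t z. pres_lift k (tensor k L (tensor k M N))
          (\<lambda>(x, y). pure k L (tensor k M N) x (pure k M N y z)) t)"
proof (rule bilinear_mapI)
  fix z assume "z \<in> carrier N"
  then show "linear_map k (tensor k L M) (tensor k L (tensor k M N)) (\<lambda>t. pres_lift k (tensor k L (tensor k M N))
          (\<lambda>(x, y). pure k L (tensor k M N) x (pure k M N y z)) t)"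
    using LM.tensor_lift_linear[OF L_MN.tensor_is_module inner_assoc] by simp
next
  fix t assume "t \<in> carrier (tensor k L M)"
  then show "linear_map k N (tensor k L (tensor k M N)) (\<lambda>z. pres_lift k (tensor k L (tensor k M N))
          (\<lambda>(x, y). pure k L (tensor k M N) x (pure k M N y z)) t)"
  proof (induction rule: LM.tensor_induct)
    case (pure x y)
    show ?case
      by (rule linear_map_cong[OF MN.N.module_axioms, THEN iffD2, OF _
            linear_map_compose[OF bilinear_map_right[OF L_MN.pure_bilinear pure(1)] bilinear_map_right[OF MN.pure_bilinear pure(2)]]])
        (rule LM.tensor_lift_pure[OF L_MN.tensor_is_module inner_assoc], use pure in auto)
  next
    case (add t u)
    show ?case
      by (rule linear_map_cong[OF MN.N.module_axioms, THEN iffD2, OF _ linear_map_plus[OF L_MN.tensor_is_module add(3,4)]])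
        (rule linear_map_add[OF LM.tensor_lift_linear[OF L_MN.tensor_is_module inner_assoc] add(1,2)])
  qed
qed

lemma tensor_assoc_linear:
  "linear_map k (tensor k (tensor k L M) N) (tensor k L (tensor k M N)) (tensor_assoc k L M N)"
  unfolding tensor_assoc_def
  by (rule LM_N.tensor_lift_linear[OF L_MN.tensor_is_module tensor_assoc_bilinear])

lemma tensor_assoc_pure:
  assumes "x \<in> carrier L" "y \<in> carrier M" "z \<in> carrier N"
  shows "tensor_assoc k L M N (pure k (tensor k L M) N (pure k L M x y) z) = pure k L (tensor k M N) x (pure k M N y z)"
  using assms LM_N.tensor_lift_pure[OF L_MN.tensor_is_module tensor_assoc_bilinear LM.pure_closed]
    LM.tensor_lift_pure[OF L_MN.tensor_is_module inner_assoc]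
  by (simp add: tensor_assoc_def)

lemma tensor_triple_eqI:
  assumes t: "t \<in> carrier (tensor k (tensor k L M) N)" and lin: "linear_map k (tensor k (tensor k L M) N) Q f"
    "linear_map k (tensor k (tensor k L M) N) Q g" and eq: "\<And>x y z. x \<in> carrier L \<Longrightarrow> y \<in> carrier M \<Longrightarrow> z \<in> carrier N \<Longrightarrow>
      f (pure k (tensor k L M) N (pure k L M x y) z) = g (pure k (tensor k L M) N (pure k L M x y) z)"
  shows "f t = g t"
proof (rule LM_N.tensor_eqI[OF t lin])
  fix u z assume u: "u \<in> carrier (tensor k L M)" and z: "z \<in> carrier N"
  note pure = bilinear_map_left[OF LM_N.pure_bilinear z]
  show "f (pure k (tensor k L M) N u z) = g (pure k (tensor k L M) N u z)"
    by (rule LM.tensor_eqI[OF u linear_map_compose[OF lin(1) pure] linear_map_compose[OF lin(2) pure]])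
      (use eq z in auto)
qed

end

text \<open>Naturality transports coassociativity from \<open>A\<close> to the letters of Sh(A) and
  moves the operator \<open>P\<close> past the associator.\<close>

lemma tensor_assoc_natural:
  assumes "module_triple k L M N" "module_triple k L' M' N'"
    and "linear_map k L L' f" "linear_map k M M' g" "linear_map k N N' h"
    and t: "t \<in> carrier (tensor k (tensor k L M) N)"
  shows "tensor_assoc k L' M' N' (tensor_map k (tensor k L' M') N' (tensor_map k L' M' f g) h t) =
    tensor_map k L' (tensor k M' N') f (tensor_map k M' N' g h) (tensor_assoc k L M N t)"
proof -
  interpret A: module_triple k L M N by fact
  interpret B: module_triple k L' M' N' by fact
  note fg = tensor_map_linear[OF A.LM.module_pair_axioms B.LM.module_pair_axioms assms(3,4)]
  note gh = tensor_map_linear[OF A.MN.module_pair_axioms B.MN.module_pair_axioms assms(4,5)]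
  note fg_h = tensor_map_linear[OF A.LM_N.module_pair_axioms B.LM_N.module_pair_axioms fg(1) assms(5)]
  note f_gh = tensor_map_linear[OF A.L_MN.module_pair_axioms B.L_MN.module_pair_axioms assms(3) gh(1)]
  show ?thesis
    by (rule A.tensor_triple_eqI[OF t linear_map_compose[OF B.tensor_assoc_linear fg_h(1)]
          linear_map_compose[OF f_gh(1) A.tensor_assoc_linear]])
      (use assms in \<open>simp add: fg(2) gh(2) fg_h(2) f_gh(2) A.tensor_assoc_pure B.tensor_assoc_pure linear_map_closed
        A.LM.pure_closed[simplified] A.MN.pure_closed[simplified]\<close>)
qed

subsection \<open>Tensor products of algebras\<close>

lemma algebra_if_bilinear:
  assumes M: "module k M" and bil: "bilinear_map k M M M (mult M)" and one: "\<one>\<^bsub>M\<^esub> \<in> carrier M"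
    and "\<And>x y z. x \<in> carrier M \<Longrightarrow> y \<in> carrier M \<Longrightarrow> z \<in> carrier M \<Longrightarrow>
      (x \<otimes>\<^bsub>M\<^esub> y) \<otimes>\<^bsub>M\<^esub> z = x \<otimes>\<^bsub>M\<^esub> (y \<otimes>\<^bsub>M\<^esub> z)"
    and "\<And>x y. x \<in> carrier M \<Longrightarrow> y \<in> carrier M \<Longrightarrow> x \<otimes>\<^bsub>M\<^esub> y = y \<otimes>\<^bsub>M\<^esub> x"
    and "\<And>x. x \<in> carrier M \<Longrightarrow> \<one>\<^bsub>M\<^esub> \<otimes>\<^bsub>M\<^esub> x = x"
  shows "algebra k M"
proof -
  interpret M: module k M by fact
  have "cring M"
    by (rule cringI)
      (auto intro!: M.abelian_group_axioms comm_monoidI assms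
        simp: bilinear_map_closed[OF bil] bilinear_map_add_left[OF bil])
  then show ?thesis
    by (intro algebraI)
      (auto simp: M.R.is_cring M.smult_l_distr M.smult_r_distr M.smult_assoc1 bilinear_map_smult_left[OF bil])
qed

lemma algebra_mult_bilinear:
  fixes k :: "'k ring" and M :: "('k, 'm) module"
  assumes "algebra k M"
  shows "bilinear_map k M M M (mult M)"
proof -
  interpret algebra k M by fact
  show ?thesis
  proof (intro bilinear_mapI linear_mapI)
    fix c x y assume "c \<in> carrier k" "x \<in> carrier M" "y \<in> carrier M"
    then show "x \<otimes>\<^bsub>M\<^esub> (c \<odot>\<^bsub>M\<^esub> y) = c \<odot>\<^bsub>M\<^esub> (x \<otimes>\<^bsub>M\<^esub> y)"
      by (metis m_comm smult_assoc2 smult_closed)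
  qed (auto simp: r_distr l_distr smult_assoc2)
qed

locale algebra_pair = M: algebra k M + N: algebra k N
  for k :: "'k ring" and M :: "('k, 'm) module" and N :: "('k, 'n) module"
begin

sublocale module_pair ..

lemma tensor_mult_def: "(\<otimes>\<^bsub>tensor k M N\<^esub>) = (\<lambda>X Y. pres_lift k (tensor k M N)
     (\<lambda>s. pres_lift k (tensor k M N) ((\<lambda>(x, y) (x', y'). pure k M N (x \<otimes>\<^bsub>M\<^esub> x') (y \<otimes>\<^bsub>N\<^esub> y')) s) Y) X)"
proof -
  have "(\<otimes>\<^bsub>tensor k M N\<^esub>) = (\<lambda>X Y. pres_lift k (tensor_module k M N)
     (\<lambda>(x, y). pres_lift k (tensor_module k M N) (\<lambda>(x', y'). pure k M N (x \<otimes>\<^bsub>M\<^esub> x') (y \<otimes>\<^bsub>N\<^esub> y')) Y) X)"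
    by (simp add: tensor_def)
  then show ?thesis by (simp only: pres_lift_tensor case_prod_unfold)
qed

lemma tensor_mult_bilinear: "bilinear_map k (tensor k M N) (tensor k M N) (tensor k M N) (mult (tensor k M N))"
  and tensor_mult_pure: "\<lbrakk>x \<in> carrier M; y \<in> carrier N; x' \<in> carrier M; y' \<in> carrier N\<rbrakk> \<Longrightarrow>
    pure k M N x y \<otimes>\<^bsub>tensor k M N\<^esub> pure k M N x' y' = pure k M N (x \<otimes>\<^bsub>M\<^esub> x') (y \<otimes>\<^bsub>N\<^esub> y')"
proof -
  have "pres.compatible (tensor k M N) (\<lambda>(x', y'). pure k M N (x \<otimes>\<^bsub>M\<^esub> x') (y \<otimes>\<^bsub>N\<^esub> y'))"
    if "x \<in> carrier M" "y \<in> carrier N" for x y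
    by (intro compatible_if_bilinear tensor_is_module
        bilinear_map_compose[OF pure_bilinear bilinear_map_right[OF algebra_mult_bilinear[OF M.algebra_axioms]] bilinear_map_right[OF algebra_mult_bilinear[OF N.algebra_axioms]]] that)
  moreover have "pres.compatible (tensor k M N) (\<lambda>(x, y). pure k M N (x \<otimes>\<^bsub>M\<^esub> x') (y \<otimes>\<^bsub>N\<^esub> y'))"
    if "x' \<in> carrier M" "y' \<in> carrier N" for x' y'
    by (intro compatible_if_bilinear tensor_is_module
        bilinear_map_compose[OF pure_bilinear bilinear_map_left[OF algebra_mult_bilinear[OF M.algebra_axioms]] bilinear_map_left[OF algebra_mult_bilinear[OF N.algebra_axioms]]] that)
  ultimately have *:
    "pres.compatible (tensor k M N) ((\<lambda>(x, y) (x', y'). pure k M N (x \<otimes>\<^bsub>M\<^esub> x') (y \<otimes>\<^bsub>N\<^esub> y')) s)"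
    "pres.compatible (tensor k M N) (\<lambda>s. (\<lambda>(x, y) (x', y'). pure k M N (x \<otimes>\<^bsub>M\<^esub> x') (y \<otimes>\<^bsub>N\<^esub> y')) s s')"
    if "s \<in> carrier M \<times> carrier N" "s' \<in> carrier M \<times> carrier N" for s s'
    using that by (cases s, auto simp: case_prod_unfold)
  note lift = double_pres_lift[OF pres.presentation_axioms pres.presentation_axioms tensor_is_module,
      of "\<lambda>(x, y) (x', y'). pure k M N (x \<otimes>\<^bsub>M\<^esub> x') (y \<otimes>\<^bsub>N\<^esub> y')"]
  \<comment> \<open>Each fact in \<open>*\<close> assumes membership of both pairs, so its use
    leaves a premise on a pair that does not occur in the conclusion; non-emptiness settles
    it.\<close>
  have ne: "carrier M \<times> carrier N \<noteq> {}" by auto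
  show "bilinear_map k (tensor k M N) (tensor k M N) (tensor k M N) (mult (tensor k M N))"
    using lift(1)[OF *] ne unfolding tensor_mult_def presented_eq
    by (auto simp: bilinear_map_def)
  show "pure k M N x y \<otimes>\<^bsub>tensor k M N\<^esub> pure k M N x' y' = pure k M N (x \<otimes>\<^bsub>M\<^esub> x') (y \<otimes>\<^bsub>N\<^esub> y')"
    if "x \<in> carrier M" "y \<in> carrier N" "x' \<in> carrier M" "y' \<in> carrier N"
    using lift(2)[OF *, where s = "(x, y)" and s' = "(x', y')"] ne that unfolding tensor_mult_def
    by (simp add: gen_class_eq)
qed

lemma tensor_is_algebra: "algebra k (tensor k M N)"
proof (rule algebra_if_bilinear[OF tensor_is_module tensor_mult_bilinear])
  let ?T = "tensor k M N"
  note closed = bilinear_map_closed[OF tensor_mult_bilinear]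
  note add = bilinear_map_add_left[OF tensor_mult_bilinear] bilinear_map_add_right[OF tensor_mult_bilinear]
  show one: "\<one>\<^bsub>?T\<^esub> \<in> carrier ?T"
    using pure_closed by simp
  show "t \<otimes>\<^bsub>?T\<^esub> u = u \<otimes>\<^bsub>?T\<^esub> t" if "t \<in> carrier ?T" "u \<in> carrier ?T" for t u
    by (rule tensor_bilinear_eqI[OF tensor_mult_bilinear bilinear_map_flip[OF tensor_mult_bilinear] that])
      (simp add: tensor_mult_pure M.m_comm N.m_comm)
  show "(t \<otimes>\<^bsub>?T\<^esub> u) \<otimes>\<^bsub>?T\<^esub> v = t \<otimes>\<^bsub>?T\<^esub> (u \<otimes>\<^bsub>?T\<^esub> v)"
    if t: "t \<in> carrier ?T" and u: "u \<in> carrier ?T" and v: "v \<in> carrier ?T" for t u v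
    using t
  proof (induction rule: tensor_induct)
    case (pure x y)
    note xy = pure
    from u show ?case
    proof (induction rule: tensor_induct)
      case (pure x' y')
      note xy' = pure
      from v show ?case
      proof (induction rule: tensor_induct)
        case (pure x'' y'')
        then show ?case using xy xy' by (simp add: tensor_mult_pure M.m_assoc N.m_assoc)
      qed (use pure_closed[OF xy] pure_closed[OF xy'] in \<open>simp add: add closed del: tensor_simps\<close>)
    qed (use pure_closed[OF pure] v in \<open>simp add: add closed del: tensor_simps\<close>)
  qed (use u v in \<open>simp add: add closed del: tensor_simps\<close>)
  show "\<one>\<^bsub>?T\<^esub> \<otimes>\<^bsub>?T\<^esub> t = t" if "t \<in> carrier ?T" for t
    using that
  proof (induction rule: tensor_induct)
    case (add t u)
    then show ?case
      using bilinear_map_add_right[OF tensor_mult_bilinear one] by simp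
  qed (simp add: tensor_mult_pure)
qed

sublocale T: algebra k "tensor k M N"
  by (rule tensor_is_algebra)

end

lemma tensor_map_ring_hom:
  assumes "algebra_pair k M N" "algebra_pair k M' N'"
    and f: "linear_map k M M' f" "f \<in> ring_hom M M'" and g: "linear_map k N N' g" "g \<in> ring_hom N N'"
  shows "tensor_map k M' N' f g \<in> ring_hom (tensor k M N) (tensor k M' N')"
proof -
  interpret T: algebra_pair k M N by fact
  interpret T': algebra_pair k M' N' by fact
  note fg = tensor_map_linear[OF T.module_pair_axioms T'.module_pair_axioms f(1) g(1)]
  let ?h = "tensor_map k M' N' f g"
  note closed = linear_map_closed[OF fg(1)]
  have mult: "?h (t \<otimes>\<^bsub>tensor k M N\<^esub> u) = ?h t \<otimes>\<^bsub>tensor k M' N'\<^esub> ?h u"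
    if "t \<in> carrier (tensor k M N)" "u \<in> carrier (tensor k M N)" for t u
    by (rule T.tensor_bilinear_eqI[OF bilinear_map_compose'[OF fg(1) T.tensor_mult_bilinear]
          bilinear_map_compose[OF T'.tensor_mult_bilinear fg(1) fg(1)] that])
      (use f g in \<open>simp add: T.tensor_mult_pure T'.tensor_mult_pure fg(2) ring_hom_mult linear_map_closed\<close>)
  show ?thesis
    using f g closed linear_map_add[OF fg(1)]
    by (intro ring_hom_memI) (auto simp: mult fg(2) ring_hom_one simp del: tensor_simps(1-4))
qed

text \<open>This makes the right-hand side of coassociativity an algebra map, so that uniqueness of
  maps out of Sh(A) can be applied to it.\<close>

lemma tensor_assoc_ring_hom:
  assumes "algebra k L" "algebra k M" "algebra k N"
  shows "tensor_assoc k L M N \<in> ring_hom (tensor k (tensor k L M) N) (tensor k L (tensor k M N))"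
proof -
  interpret LM: algebra_pair k L M by (intro algebra_pair.intro assms)
  interpret MN: algebra_pair k M N by (intro algebra_pair.intro assms)
  interpret L_MN: algebra_pair k L "tensor k M N" ..
  interpret LM_N: algebra_pair k "tensor k L M" N ..
  interpret module_triple k L M N ..
  let ?h = "tensor_assoc k L M N" and ?T = "tensor k (tensor k L M) N" and ?T' = "tensor k L (tensor k M N)"
  note bil = LM_N.tensor_mult_bilinear L_MN.tensor_mult_bilinear
  have mult: "?h (t \<otimes>\<^bsub>?T\<^esub> u) = ?h t \<otimes>\<^bsub>?T'\<^esub> ?h u"
    if t: "t \<in> carrier ?T" and u: "u \<in> carrier ?T" for t u
  proof (rule tensor_triple_eqI[OF t])
    show "linear_map k ?T ?T' (\<lambda>t. ?h (t \<otimes>\<^bsub>?T\<^esub> u))"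
      using u by (intro linear_map_compose[OF tensor_assoc_linear bilinear_map_left[OF bil(1)]])
    show "linear_map k ?T ?T' (\<lambda>t. ?h t \<otimes>\<^bsub>?T'\<^esub> ?h u)"
      using u linear_map_closed[OF tensor_assoc_linear]
      by (intro linear_map_compose[OF bilinear_map_left[OF bil(2)] tensor_assoc_linear])
    fix x y z assume xyz: "x \<in> carrier L" "y \<in> carrier M" "z \<in> carrier N"
    let ?p = "pure k (tensor k L M) N (pure k L M x y) z"
    have p: "?p \<in> carrier ?T" using xyz LM.pure_closed LM_N.pure_closed by blast
    show "?h (?p \<otimes>\<^bsub>?T\<^esub> u) = ?h ?p \<otimes>\<^bsub>?T'\<^esub> ?h u"
    proof (rule tensor_triple_eqI[OF u])
      show "linear_map k ?T ?T' (\<lambda>u. ?h (?p \<otimes>\<^bsub>?T\<^esub> u))"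
        using p by (intro linear_map_compose[OF tensor_assoc_linear bilinear_map_right[OF bil(1)]])
      show "linear_map k ?T ?T' (\<lambda>u. ?h ?p \<otimes>\<^bsub>?T'\<^esub> ?h u)"
        using p linear_map_closed[OF tensor_assoc_linear]
        by (intro linear_map_compose[OF bilinear_map_right[OF bil(2)] tensor_assoc_linear])
    qed (use xyz in \<open>simp add: LM_N.tensor_mult_pure LM.tensor_mult_pure L_MN.tensor_mult_pure MN.tensor_mult_pure
        tensor_assoc_pure LM.pure_closed[simplified] MN.pure_closed[simplified]\<close>)
  qed
  show ?thesis
    using linear_map_closed[OF tensor_assoc_linear] linear_map_add[OF tensor_assoc_linear]
    by (intro ring_hom_memI) (auto simp: mult tensor_assoc_pure simp del: tensor_simps(1-4))
qed

section \<open>The direct sum of the tensor powers\<close>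

definition word_relators :: "'k ring \<Rightarrow> ('k, 'a) module \<Rightarrow> ('a list \<Rightarrow> 'k) set" where
  "word_relators k A =
    (let F = free_module k (lists (carrier A)); g = free_gen k in
      {g (u @ (a \<oplus>\<^bsub>A\<^esub> b) # v) \<ominus>\<^bsub>F\<^esub> (g (u @ a # v) \<oplus>\<^bsub>F\<^esub> g (u @ b # v)) | u v a b.
          u \<in> lists (carrier A) \<and> v \<in> lists (carrier A) \<and> a \<in> carrier A \<and> b \<in> carrier A} \<union>
       {g (u @ (c \<odot>\<^bsub>A\<^esub> a) # v) \<ominus>\<^bsub>F\<^esub> c \<odot>\<^bsub>F\<^esub> g (u @ a # v) | u v c a.
          u \<in> lists (carrier A) \<and> v \<in> lists (carrier A) \<and> c \<in> carrier k \<and> a \<in> carrier A})"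

lemma word_rels_eq: "word_rels k A = submodule_span k (free_module k (lists (carrier A))) (word_relators k A)"
  by (simp only: word_rels_def word_relators_def Let_def)

text \<open>The length is not fixed: one function on words stands for a multilinear map on every
  tensor power at once. The empty word has no letter, so its value is only required to lie in the
  target.\<close>

definition multilinear :: "'k ring \<Rightarrow> ('k, 'a) module \<Rightarrow> ('k, 'q) module \<Rightarrow> ('a list \<Rightarrow> 'q) \<Rightarrow> bool" where
  "multilinear k A Q \<phi> \<longleftrightarrow>
    \<phi> \<in> lists (carrier A) \<rightarrow> carrier Q \<and>
    (\<forall>u\<in>lists (carrier A). \<forall>v\<in>lists (carrier A). linear_map k A Q (\<lambda>a. \<phi> (u @ a # v)))"

lemma multilinearI:
  assumes "\<And>w. w \<in> lists (carrier A) \<Longrightarrow> \<phi> w \<in> carrier Q"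
    and "\<And>u v. u \<in> lists (carrier A) \<Longrightarrow> v \<in> lists (carrier A) \<Longrightarrow> linear_map k A Q (\<lambda>a. \<phi> (u @ a # v))"
  shows "multilinear k A Q \<phi>"
  using assms by (simp add: multilinear_def)

lemma
  assumes "multilinear k A Q \<phi>"
  shows multilinear_closed: "w \<in> lists (carrier A) \<Longrightarrow> \<phi> w \<in> carrier Q"
    and multilinear_linear: "u \<in> lists (carrier A) \<Longrightarrow> v \<in> lists (carrier A) \<Longrightarrow> linear_map k A Q (\<lambda>a. \<phi> (u @ a # v))"
  using assms by (auto simp: multilinear_def)

locale word_module = A: module k A for k :: "'k ring" and A :: "('k, 'a) module"
begin

abbreviation "words \<equiv> lists (carrier A)"

sublocale pres: presentation k words "word_relators k A"
proof -
  interpret scalars k ..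
  interpret F: module k "free_module k (words)" by (rule free_module_is_module)
  show "presentation k (words) (word_relators k A)"
    by unfold_locales
      (auto simp: word_relators_def Let_def
        intro!: F.minus_closed F.a_closed F.smult_closed free_gen_closed)
qed

lemma presented_eq: "pres.presented = Sh_plus k A"
  by (simp add: pres.presented_def pres.rel_span_def Sh_plus_def word_rels_eq)

lemma gen_class_eq: "pres.gen_class w = word k A w"
  by (simp add: pres.gen_class_def pres.rel_span_def word_def word_rels_eq)

lemma Sh_plus_is_module: "module k (Sh_plus k A)"
  using pres.presented_module by (simp add: presented_eq)

sublocale G: module k "Sh_plus k A"
  by (rule Sh_plus_is_module)

lemma multilinear_cong:
  assumes "\<And>w. w \<in> words \<Longrightarrow> \<phi> w = \<psi> w"
  shows "multilinear k A Q \<phi> \<longleftrightarrow> multilinear k A Q \<psi>"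
proof -
  have "linear_map k A Q (\<lambda>a. \<phi> (u @ a # v)) \<longleftrightarrow> linear_map k A Q (\<lambda>a. \<psi> (u @ a # v))"
    if "u \<in> words" "v \<in> words" for u v
    by (rule linear_map_cong[OF A.module_axioms]) (use assms that in simp)
  with assms show ?thesis
    by (simp add: multilinear_def Pi_iff del: in_lists_conv_set)
qed

lemma word_closed: "w \<in> words \<Longrightarrow> word k A w \<in> carrier (Sh_plus k A)"
  using pres.gen_class_closed[of w] by (simp add: presented_eq gen_class_eq)

lemma word_multilinear: "multilinear k A (Sh_plus k A) (word k A)"
proof -
  let ?F = "free_module k (words)"
  let ?\<pi> = "\<lambda>f. pres.rel_span +>\<^bsub>?F\<^esub> f"
  interpret F: module k ?F by (rule pres.free_module_is_module)
  note \<pi> = pres.quotient_map_linear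
  note gen = pres.free_gen_closed[of _ "words"]
  have \<pi>_gen: "?\<pi> (free_gen k w) = word k A w" for w
    using gen_class_eq by (simp add: pres.gen_class_def)
  note lin = linear_map_add[OF \<pi>] linear_map_smult[OF \<pi>]
  note rel = word_relators_def Let_def
  show ?thesis
  proof (intro multilinearI linear_mapI)
    fix u v a b assume *: "u \<in> words" "v \<in> words" "a \<in> carrier A" "b \<in> carrier A"
    have "?\<pi> (free_gen k (u @ (a \<oplus>\<^bsub>A\<^esub> b) # v)) = ?\<pi> (free_gen k (u @ a # v) \<oplus>\<^bsub>?F\<^esub> free_gen k (u @ b # v))"
      by (rule pres.quotient_map_eqI, unfold rel) (use * in blast, use * gen in simp_all)
    then show "word k A (u @ (a \<oplus>\<^bsub>A\<^esub> b) # v) = word k A (u @ a # v) \<oplus>\<^bsub>Sh_plus k A\<^esub> word k A (u @ b # v)"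
      using * by (simp add: \<pi>_gen lin gen presented_eq)
  next
    fix u v a c assume *: "u \<in> words" "v \<in> words" "a \<in> carrier A" "c \<in> carrier k"
    have "?\<pi> (free_gen k (u @ (c \<odot>\<^bsub>A\<^esub> a) # v)) = ?\<pi> (c \<odot>\<^bsub>?F\<^esub> free_gen k (u @ a # v))"
      by (rule pres.quotient_map_eqI, unfold rel) (use * in blast, use * gen in simp_all)
    then show "word k A (u @ (c \<odot>\<^bsub>A\<^esub> a) # v) = c \<odot>\<^bsub>Sh_plus k A\<^esub> word k A (u @ a # v)"
      using * by (simp add: \<pi>_gen lin gen presented_eq)
  qed (auto simp: word_closed)
qed

lemma word_Cons_linear:
  assumes "w \<in> words"
  shows "linear_map k A (Sh_plus k A) (\<lambda>a. word k A (a # w))"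
  using multilinear_linear[OF word_multilinear, of "[]" w] assms by simp

text \<open>Zero has no case of its own: it is zero times the empty word.\<close>

lemma word_induct [consumes 1, case_names word add]:
  assumes "X \<in> carrier (Sh_plus k A)"
    and word: "\<And>c w. c \<in> carrier k \<Longrightarrow> w \<in> words \<Longrightarrow> P (c \<odot>\<^bsub>Sh_plus k A\<^esub> word k A w)"
    and "\<And>X Y. X \<in> carrier (Sh_plus k A) \<Longrightarrow> Y \<in> carrier (Sh_plus k A) \<Longrightarrow> P X \<Longrightarrow> P Y
      \<Longrightarrow> P (X \<oplus>\<^bsub>Sh_plus k A\<^esub> Y)"
  shows "P X"
proof -
  have "X \<in> carrier pres.presented" using assms(1) by (simp add: presented_eq)
  then show ?thesis
  proof (induction rule: pres.presented_induct)
    case zero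
    show ?case using word[of "\<zero>\<^bsub>k\<^esub>" "[]"] word_closed[of "[]"] by (simp add: presented_eq)
  qed (use assms(2,3) in \<open>simp_all add: presented_eq gen_class_eq\<close>)
qed

lemma word_eqI:
  assumes "X \<in> carrier (Sh_plus k A)" "linear_map k (Sh_plus k A) Q f" "linear_map k (Sh_plus k A) Q g"
    and "\<And>w. w \<in> words \<Longrightarrow> f (word k A w) = g (word k A w)"
  shows "f X = g X"
  using assms(1)
  by (induction rule: word_induct)
    (use assms(4) linear_map_add[OF assms(2)] linear_map_add[OF assms(3)]
      linear_map_smult[OF assms(2)] linear_map_smult[OF assms(3)] word_closed in auto)

lemma compatible_if_multilinear:
  assumes Q: "module k Q" and \<phi>: "multilinear k A Q \<phi>"
  shows "pres.compatible Q \<phi>"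
proof -
  let ?F = "free_module k (words)"
  interpret F: module k ?F by (rule pres.free_module_is_module)
  interpret Q: module k Q by fact
  have \<phi>': "\<phi> \<in> words \<rightarrow> carrier Q"
    using multilinear_closed[OF \<phi>] by auto
  note gen = free_lift_gen[OF Q \<phi>']
  note lin = free_lift_linear[OF Q \<phi>']
  note lins = linear_map_add[OF lin] linear_map_smult[OF lin]
    linear_map_minus[OF lin F.module_axioms Q]
  note mult = linear_map_add[OF multilinear_linear[OF \<phi>]] linear_map_smult[OF multilinear_linear[OF \<phi>]]
    multilinear_closed[OF \<phi>]
  have Q_minus: "x \<ominus>\<^bsub>Q\<^esub> x = \<zero>\<^bsub>Q\<^esub>" if "x \<in> carrier Q" for x
    using that by (simp add: a_minus_def Q.r_neg)
  have "free_lift k Q \<phi> r = \<zero>\<^bsub>Q\<^esub>" if "r \<in> word_relators k A" for r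
  proof -
    have gens: "free_gen k w \<in> carrier ?F" if "w \<in> words" for w
      using that by (rule pres.free_gen_closed)
    have "free_lift k Q \<phi> (free_gen k (u @ (a \<oplus>\<^bsub>A\<^esub> b) # v) \<ominus>\<^bsub>?F\<^esub> (free_gen k (u @ a # v) \<oplus>\<^bsub>?F\<^esub> free_gen k (u @ b # v))) = \<zero>\<^bsub>Q\<^esub>"
      if "u \<in> words" "v \<in> words" "a \<in> carrier A" "b \<in> carrier A" for u v a b
      using that by (simp add: lins gen gens mult Q_minus del: in_lists_conv_set)
    moreover have "free_lift k Q \<phi> (free_gen k (u @ (c \<odot>\<^bsub>A\<^esub> a) # v) \<ominus>\<^bsub>?F\<^esub> c \<odot>\<^bsub>?F\<^esub> free_gen k (u @ a # v)) = \<zero>\<^bsub>Q\<^esub>"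
      if "u \<in> words" "v \<in> words" "c \<in> carrier k" "a \<in> carrier A" for u v c a
      using that by (simp add: lins gen gens mult Q_minus del: in_lists_conv_set)
    ultimately show ?thesis
      using that unfolding word_relators_def Let_def by (elim UnE CollectE exE conjE) simp_all
  qed
  with \<phi>' show ?thesis by (auto simp: pres.compatible_def)
qed

lemma
  assumes "module k Q" "multilinear k A Q \<phi>"
  shows word_lift_linear: "linear_map k (Sh_plus k A) Q (pres_lift k Q \<phi>)"
    and word_lift_word: "w \<in> words \<Longrightarrow> pres_lift k Q \<phi> (word k A w) = \<phi> w"
  using pres.pres_lift_linear[OF assms(1) compatible_if_multilinear[OF assms]]
    pres.pres_lift_gen_class[OF assms(1) compatible_if_multilinear[OF assms]]
  by (simp_all add: presented_eq gen_class_eq)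

lemma word_lift_cong:
  assumes "module k Q" "multilinear k A Q \<psi>" "\<And>w. w \<in> words \<Longrightarrow> \<phi> w = \<psi> w" "X \<in> carrier (Sh_plus k A)"
  shows "pres_lift k Q \<phi> X = pres_lift k Q \<psi> X"
  using pres.pres_lift_cong[of X \<phi> \<psi> Q] assms by (auto simp: presented_eq multilinear_def)

lemma
  assumes Q: "module k Q"
    and "\<And>u. u \<in> words \<Longrightarrow> multilinear k A Q (\<phi> u)"
    and "\<And>v. v \<in> words \<Longrightarrow> multilinear k A Q (\<lambda>u. \<phi> u v)"
  shows word_double_lift_bilinear:
      "bilinear_map k (Sh_plus k A) (Sh_plus k A) Q (\<lambda>X Y. pres_lift k Q (\<lambda>u. pres_lift k Q (\<phi> u) Y) X)"
    and word_double_lift_word: "u \<in> words \<Longrightarrow> v \<in> words \<Longrightarrow>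
      pres_lift k Q (\<lambda>u. pres_lift k Q (\<phi> u) (word k A v)) (word k A u) = \<phi> u v"
  using double_pres_lift[OF pres.presentation_axioms pres.presentation_axioms Q
      compatible_if_multilinear[OF Q assms(2)] compatible_if_multilinear[OF Q assms(3)]]
  unfolding presented_eq gen_class_eq by blast+

lemma prepend_multilinear:
  assumes "a \<in> carrier A"
  shows "multilinear k A (Sh_plus k A) (\<lambda>w. word k A (a # w))"
  using multilinear_linear[OF word_multilinear, of "a # u" for u] assms
  by (intro multilinearI) (auto simp: word_closed)

lemma prepend_word: "a \<in> carrier A \<Longrightarrow> w \<in> words \<Longrightarrow> prepend k A a (word k A w) = word k A (a # w)"
  unfolding prepend_def by (rule word_lift_word[OF Sh_plus_is_module prepend_multilinear])

text \<open>Each letter gives a separate lift, so linearity in the letter is proved by induction on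
  \<open>X\<close>.\<close>

lemma prepend_bilinear: "bilinear_map k A (Sh_plus k A) (Sh_plus k A) (prepend k A)"
proof (rule bilinear_mapI)
  show lin: "linear_map k (Sh_plus k A) (Sh_plus k A) (prepend k A a)" if "a \<in> carrier A" for a
    unfolding prepend_def using that by (intro word_lift_linear Sh_plus_is_module prepend_multilinear)
  fix X assume "X \<in> carrier (Sh_plus k A)"
  then show "linear_map k A (Sh_plus k A) (\<lambda>a. prepend k A a X)"
  proof (induction rule: word_induct)
    case (word c w)
    show ?case
      by (rule linear_map_cong[OF A.module_axioms, THEN iffD2, OF _ linear_map_scale[OF Sh_plus_is_module word_Cons_linear[OF word(2)] word(1)]])
        (simp add: linear_map_smult[OF lin] word word_closed prepend_word)
  next
    case (add X Y)
    show ?case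
      by (rule linear_map_cong[OF A.module_axioms, THEN iffD2, OF _ linear_map_plus[OF Sh_plus_is_module add(3,4)]])
        (simp add: linear_map_add[OF lin] add)
  qed
qed

lemmas prepend_closed = bilinear_map_closed[OF prepend_bilinear]

lemma prepend_linear:
  "a \<in> carrier A \<Longrightarrow> linear_map k M (Sh_plus k A) f \<Longrightarrow> linear_map k M (Sh_plus k A) (\<lambda>x. prepend k A a (f x))"
  by (rule linear_map_compose[OF bilinear_map_right[OF prepend_bilinear]])

end

lemma self_module_simps [simp]:
  "carrier (self_module k) = carrier k" "mult (self_module k) = mult k" "one (self_module k) = one k"
  "zero (self_module k) = zero k" "add (self_module k) = add k" "smult (self_module k) = mult k"
  by (simp_all add: self_module_def)

lemma self_module_is_algebra:
  fixes k :: "'k ring"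
  assumes "cring k"
  shows "algebra k (self_module k)"
proof -
  interpret cring k by fact
  have "abelian_group (self_module k)"
    by (rule abelian_groupI) (auto simp: a_ac intro: l_neg)
  then have "module k (self_module k)"
    by (intro moduleI) (auto simp: is_cring l_distr r_distr m_assoc)
  then show ?thesis
    by (rule algebra_if_bilinear) (auto intro!: bilinear_mapI linear_mapI simp: m_ac l_distr r_distr)
qed

lemma linear_map_smult_left:
  assumes "module k N" "linear_map k M (self_module k) f" "y \<in> carrier N"
  shows "linear_map k M N (\<lambda>x. f x \<odot>\<^bsub>N\<^esub> y)"
proof -
  interpret module k N by fact
  show ?thesis
    by (rule linear_mapI)
      (use assms(3) linear_map_closed[OF assms(2)] linear_map_add[OF assms(2)] linear_map_smult[OF assms(2)]
       in \<open>auto simp: smult_l_distr smult_assoc1\<close>)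
qed


section \<open>The TD shuffle product\<close>

text \<open>On words of positive length, right multiplication by \<open>1\<^sub>A\<close> is \<open>u \<mapsto> 1 \<otimes> u + \<lambda> u\<close>. Substituting this
  in the last summand of the recursion cancels the \<open>\<lambda>\<close>-term, unless both tails are empty, and leaves
  a recursion on shorter words only.\<close>

fun nijenhuis_word :: "'k ring \<Rightarrow> ('k, 'a) module \<Rightarrow> 'k \<Rightarrow> 'a list \<Rightarrow> 'a list \<Rightarrow> ('a list \<Rightarrow> 'k) set" where
  "nijenhuis_word k A l [] v = word k A v"
| "nijenhuis_word k A l (a # u) [] = word k A (a # u)"
| "nijenhuis_word k A l (a # u) (b # v) =
     prepend k A a (nijenhuis_word k A l u (b # v))
     \<oplus>\<^bsub>Sh_plus k A\<^esub> prepend k A b (nijenhuis_word k A l (a # u) v)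
     \<ominus>\<^bsub>Sh_plus k A\<^esub> prepend k A (a \<otimes>\<^bsub>A\<^esub> b) (prepend k A \<one>\<^bsub>A\<^esub> (nijenhuis_word k A l u v))
     \<oplus>\<^bsub>Sh_plus k A\<^esub> (if u = [] \<and> v = [] then l \<odot>\<^bsub>Sh_plus k A\<^esub> word k A [a \<otimes>\<^bsub>A\<^esub> b] else \<zero>\<^bsub>Sh_plus k A\<^esub>)"

lemma (in abelian_group) minus_add_cancel:
  assumes "p \<in> carrier G" "q \<in> carrier G"
  shows "p \<oplus> q \<ominus> q = p"
    and "p \<ominus> q \<oplus> q = p"
    and "s \<in> carrier G \<Longrightarrow> p \<oplus> s \<ominus> (q \<oplus> s) = p \<ominus> q"
    and "s \<in> carrier G \<Longrightarrow> p \<ominus> q \<oplus> (q \<oplus> s) = p \<oplus> s"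
    and "s \<in> carrier G \<Longrightarrow> p \<oplus> s \<ominus> q = p \<ominus> q \<oplus> s"
proof -
  have "x \<oplus> (y \<oplus> \<ominus> x) = y" "\<ominus> x \<oplus> (y \<oplus> x) = y" if "x \<in> carrier G" "y \<in> carrier G" for x y
    using that by (simp_all add: a_lcomm[of _ y] r_neg l_neg)
  then show "p \<oplus> q \<ominus> q = p" "p \<ominus> q \<oplus> q = p"
    "s \<in> carrier G \<Longrightarrow> p \<oplus> s \<ominus> (q \<oplus> s) = p \<ominus> q" "s \<in> carrier G \<Longrightarrow> p \<ominus> q \<oplus> (q \<oplus> s) = p \<oplus> s"
    "s \<in> carrier G \<Longrightarrow> p \<oplus> s \<ominus> q = p \<ominus> q \<oplus> s"
    using assms by (simp_all add: a_minus_def minus_add a_ac r_neg r_neg1 r_neg2)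
qed

text \<open>The pattern of the recursion for the product of two words: all three shorter pairs are
  available as hypotheses.\<close>

lemma two_lists_induct [case_names Nil Cons_Nil Cons_Cons]:
  assumes "\<And>v. P [] v" "\<And>a u. P (a # u) []"
    and "\<And>a u b v. P u (b # v) \<Longrightarrow> P (a # u) v \<Longrightarrow> P u v \<Longrightarrow> P (a # u) (b # v)"
  shows "P u v"
proof (induction u arbitrary: v)
  case (Cons a u)
  show ?case by (induction v) (use assms Cons.IH in auto)
qed (rule assms)

locale td_algebra = A: algebra k A for k :: "'k ring" and A :: "('k, 'a) module" (structure) +
  fixes l :: 'k
  assumes l_closed [simp]: "l \<in> carrier k"
begin

sublocale word_module k A ..

abbreviation "Sh' \<equiv> Sh_plus k A"
abbreviation "wd \<equiv> word k A"
abbreviation "nij \<equiv> nijenhuis_word k A l"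
abbreviation "pre \<equiv> prepend k A"
abbreviation shuffle (infixl "\<star>" 70) where "shuffle \<equiv> td_shuffle k A l"
abbreviation Sh_add (infixl "\<boxplus>" 65) where "X \<boxplus> Y \<equiv> X \<oplus>\<^bsub>Sh'\<^esub> Y"
abbreviation Sh_diff (infixl "\<boxminus>" 65) where "X \<boxminus> Y \<equiv> X \<ominus>\<^bsub>Sh'\<^esub> Y"
abbreviation Sh_smult (infixl "\<bullet>" 70) where "c \<bullet> X \<equiv> c \<odot>\<^bsub>Sh'\<^esub> X"

lemma nij_Nil2 [simp]: "nij u [] = wd u"
  by (cases u) auto

lemma nij_closed:
  "u \<in> words \<Longrightarrow> v \<in> words \<Longrightarrow> nij u v \<in> carrier Sh'"
  by (induction u v rule: two_lists_induct) (auto simp: word_closed prepend_closed)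

text \<open>Exchanging the arguments swaps the first two summands; the other two are symmetric by
  the induction hypothesis and commutativity of \<open>A\<close>.\<close>

lemma nij_commute:
  "u \<in> words \<Longrightarrow> v \<in> words \<Longrightarrow> nij u v = nij v u"
proof (induction u v rule: two_lists_induct)
  case (Cons_Cons a u b v)
  then show ?case
    by (simp add: G.M.a_comm prepend_closed nij_closed A.m_comm del: in_lists_conv_set)
qed auto

lemma nij_multilinear:
  assumes v: "v \<in> words"
  shows "multilinear k A Sh' (\<lambda>u. nij u v)"
proof (rule multilinearI)
  fix p s assume "p \<in> words" and s: "s \<in> words"
  then show "linear_map k A Sh' (\<lambda>a. nij (p @ a # s) v)"
    using v
  proof (induction p v rule: two_lists_induct)
    case (Nil v)
    note left = bilinear_map_left[OF prepend_bilinear]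
    have mult: "linear_map k A A (\<lambda>a. a \<otimes> b)" if "b \<in> carrier A" for b
      using bilinear_map_left[OF algebra_mult_bilinear[OF A.algebra_axioms] that] .
    have *: "nij s v' \<in> carrier Sh'" if "v' \<in> words" for v' using s that by (rule nij_closed)
    \<comment> \<open>With the varying letter in head position, the second summand of the recursion
      keeps the whole left word, so a separate induction on the right word is made.\<close>
    have cons: "linear_map k A Sh' (\<lambda>a. nij (a # s) v)" if "v \<in> words" for v
      using that
    proof (induction v rule: list.induct)
      case Nil
      then show ?case using s by (simp add: word_Cons_linear del: in_lists_conv_set)
    next
      case (Cons b v)
      then have b: "b \<in> carrier A" and v: "v \<in> words" by auto
      show ?case
        unfolding nijenhuis_word.simps
        by (intro linear_map_plus linear_map_diff prepend_linear linear_map_if linear_map_scale linear_map_const_zero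
            Sh_plus_is_module left linear_map_compose[OF left mult] linear_map_compose[OF word_Cons_linear mult]
            prepend_closed * l_closed Cons.IH b v A.one_closed)
          (use b v in auto)
    qed
    show ?case using cons[OF Nil(3)] by simp
  next
    case (Cons_Nil p u)
    then show ?case
      using multilinear_linear[OF word_multilinear, of "p # u" s] by (simp del: in_lists_conv_set)
  next
    case (Cons_Cons c p b v)
    then have c: "c \<in> carrier A" "p \<in> words" "b \<in> carrier A" "v \<in> words" by auto
    note IH = Cons_Cons(1-3)[OF _ s]
    \<comment> \<open>The left tail contains the varying letter and is therefore non-empty, so the
      \<lambda>-term disappears.\<close>
    show ?case
      unfolding append_Cons nijenhuis_word.simps
      by (simp del: in_lists_conv_set nijenhuis_word.simps, intro linear_map_plus linear_map_diff prepend_linear linear_map_const_zero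
            Sh_plus_is_module IH[unfolded append_Cons] A.one_closed A.m_closed)
         (use c in auto)
  qed
qed (use v in \<open>simp add: nij_closed del: in_lists_conv_set\<close>)

lemma nij_multilinear':
  assumes u: "u \<in> words"
  shows "multilinear k A Sh' (nij u)"
proof (rule multilinearI)
  fix p s assume *: "p \<in> words" "s \<in> words"
  show "linear_map k A Sh' (\<lambda>a. nij u (p @ a # s))"
    by (rule linear_map_cong[OF A.module_axioms, THEN iffD1, OF _ multilinear_linear[OF nij_multilinear[OF u] *]])
      (rule nij_commute, use u * in auto)
qed (use u in \<open>simp add: nij_closed del: in_lists_conv_set\<close>)

text \<open>By induction on \<open>v\<close>, the second summand is \<open>b\<close> prepended to
  \<open>pre \<one> (nij u v)\<close>, which cancels the third; the \<lambda>-term is absent because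
  \<open>u\<close> is non-empty.\<close>

lemma nij_one_Cons:
  assumes "u \<in> words" "v \<in> words" "u \<noteq> []"
  shows "nij (\<one> # u) v = pre \<one> (nij u v)"
  using assms(2)
proof (induction v rule: list.induct)
  case Nil
  then show ?case using assms by (simp add: prepend_word del: in_lists_conv_set)
next
  case (Cons b v)
  then have b: "b \<in> carrier A" "v \<in> words" by auto
  then have "nij u v \<in> carrier Sh'" "nij u (b # v) \<in> carrier Sh'" using assms by (auto intro!: nij_closed)
  with b Cons.IH[OF b(2)] assms(3) show ?case
    by (simp add: prepend_closed G.M.minus_add_cancel del: in_lists_conv_set)
qed

text \<open>The second and third summands cancel again, but at the last letter of the right word
  both tails are empty, which produces a \<lambda>-term; prepending carries it outwards.\<close>

lemma nij_one:
  assumes "b \<in> carrier A" "v \<in> words"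
  shows "nij [\<one>] (b # v) = wd (\<one> # b # v) \<boxplus> l \<bullet> wd (b # v)"
  using assms
proof (induction v arbitrary: b rule: list.induct)
  case Nil
  then show ?case
    by (simp add: prepend_word G.M.minus_add_cancel word_closed)
next
  case (Cons c v)
  then have c: "c \<in> carrier A" "v \<in> words" by auto
  have "pre b (nij [\<one>] (c # v)) = wd (b # \<one> # c # v) \<boxplus> l \<bullet> wd (b # c # v)"
    using Cons.prems c Cons.IH[OF c]
    by (simp add: bilinear_map_add_right[OF prepend_bilinear] bilinear_map_smult_right[OF prepend_bilinear]
        word_closed prepend_word)
  then show ?case
    using Cons.prems c
    by (simp only: nijenhuis_word.simps) (simp add: prepend_word word_closed G.M.minus_add_cancel)
qed

lemma td_word_eq_nij:
  "u \<in> words \<Longrightarrow> v \<in> words \<Longrightarrow> td_word k A l u v = nij u v"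
proof (induction "length u + length v" arbitrary: u v rule: less_induct)
  case less
  show ?case
  proof (cases u)
    case u: (Cons a u')
    show ?thesis
    proof (cases v)
      case v: (Cons b v')
      have mem: "a \<in> carrier A" "u' \<in> words" "b \<in> carrier A" "v' \<in> words"
        using less.prems u v by auto
      have IH: "td_word k A l u' (b # v') = nij u' (b # v')" "td_word k A l (a # u') v' = nij (a # u') v'"
        "td_word k A l u' v' = nij u' v'" "td_word k A l u' [\<one>] = nij u' [\<one>]"
        using mem u v by (simp_all add: less.hyps)
      let ?\<phi> = "\<lambda>w. if length w \<le> length u' + 1 then td_word k A l w v' else \<zero>\<^bsub>Sh'\<^esub>"
      \<comment> \<open>\<open>nij u' [\<one>]\<close> is a combination of words of length at most
        \<open>length u' + 1\<close>, so the length test discards nothing. On the words that pass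
        it, the total length with \<open>v'\<close> is below that of \<open>u\<close> and
        \<open>v\<close>, so the induction hypothesis applies.\<close>
      define \<psi> where "\<psi> w = (if length w \<le> length u' + 1 then nij w v' else \<zero>\<^bsub>Sh'\<^esub>)" for w
      have eq: "?\<phi> w = \<psi> w" if "w \<in> words" for w
        using mem u v that less.hyps[of w v'] by (simp add: \<psi>_def)
      have mult: "multilinear k A Sh' \<psi>"
        using mem unfolding \<psi>_def
        by (intro multilinearI) (auto simp: nij_closed intro!: linear_map_const_zero Sh_plus_is_module
            linear_map_if multilinear_linear[OF nij_multilinear])
      have "nij u' [\<one>] \<in> carrier Sh'" using mem by (auto intro!: nij_closed)
      then have lift: "pres_lift k Sh' ?\<phi> (nij u' [\<one>]) = pres_lift k Sh' \<psi> (nij u' [\<one>])"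
        by (intro word_lift_cong[OF Sh_plus_is_module mult eq])
      note lin = word_lift_linear[OF Sh_plus_is_module mult]
      note val = word_lift_word[OF Sh_plus_is_module mult]
      \<comment> \<open>Only when both tails are empty does this product carry no \<lambda>-term
        that could cancel the one in the TD recursion; this is the exceptional case of the Nijenhuis
        recursion.\<close>
      have inner: "pres_lift k Sh' \<psi> (nij u' [\<one>]) =
        (if u' = [] \<and> v' = [] then wd [\<one>] else pre \<one> (nij u' v') \<boxplus> l \<bullet> nij u' v')"
      proof (cases u')
        case Nil
        have "nij [\<one>] v' = (if v' = [] then wd [\<one>] else wd (\<one> # v') \<boxplus> l \<bullet> wd v')"
          using mem nij_one by (cases v') (simp_all del: nijenhuis_word.simps(3))
        then show ?thesis
          using val[of "[\<one>]"] Nil mem by (simp add: prepend_word \<psi>_def)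
      next
        case (Cons c u'')
        have "nij u' [\<one>] = wd (\<one> # u') \<boxplus> l \<bullet> wd u'"
          using mem Cons nij_commute[of u' "[\<one>]"] nij_one[of c u'']
          by (simp del: nijenhuis_word.simps(3))
        then show ?thesis
          using mem Cons nij_one_Cons[of u' v']
          by (simp add: linear_map_add[OF lin] linear_map_smult[OF lin] val word_closed \<psi>_def
              del: nijenhuis_word.simps(3))
      qed
      have N: "nij u' v' \<in> carrier Sh'" "nij u' (b # v') \<in> carrier Sh'" "nij (a # u') v' \<in> carrier Sh'"
        using mem by (auto intro!: nij_closed)
      show ?thesis
      proof (cases "u' = [] \<and> v' = []")
        case True
        then show ?thesis
          unfolding u v td_word.simps IH nijenhuis_word.simps lift inner
          using mem by (simp add: prepend_closed G.M.minus_add_cancel(5) prepend_word word_closed)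
      next
        case False
        then show ?thesis
          unfolding u v td_word.simps IH nijenhuis_word.simps lift inner if_not_P[OF False]
          using mem N
          by (simp add: bilinear_map_add_right[OF prepend_bilinear] bilinear_map_smult_right[OF prepend_bilinear]
              prepend_closed G.M.minus_add_cancel(3) del: in_lists_conv_set)
      qed
    qed (use u in simp)
  qed simp
qed

text \<open>Multilinearity of \<open>td_word\<close> in each argument is inherited from the
  Nijenhuis form, which justifies the lifts in \<open>td_shuffle\<close>.\<close>

lemma shuffle_bilinear: "bilinear_map k Sh' Sh' Sh' shuffle"
  and shuffle_word: "u \<in> words \<Longrightarrow> v \<in> words \<Longrightarrow> wd u \<star> wd v = nij u v"
proof -
  have "multilinear k A Sh' (td_word k A l u)" if "u \<in> words" for u
    by (rule multilinear_cong[THEN iffD2, OF _ nij_multilinear'[OF that]]) (use that in \<open>simp add: td_word_eq_nij\<close>)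
  moreover have "multilinear k A Sh' (\<lambda>u. td_word k A l u v)" if "v \<in> words" for v
    by (rule multilinear_cong[THEN iffD2, OF _ nij_multilinear[OF that]]) (use that in \<open>simp add: td_word_eq_nij\<close>)
  ultimately show "bilinear_map k Sh' Sh' Sh' shuffle"
    and "u \<in> words \<Longrightarrow> v \<in> words \<Longrightarrow> wd u \<star> wd v = nij u v"
    using word_double_lift_bilinear[OF Sh_plus_is_module, of "td_word k A l"]
      word_double_lift_word[OF Sh_plus_is_module, of "td_word k A l"]
    unfolding td_shuffle_def by (auto simp: td_word_eq_nij)
qed

end

text \<open>The projection of \<open>Sh_plus\<close> to its degree-0 part. It turns the condition
  that both tails are empty into the bilinear coefficient \<open>aug X\<close> times
  \<open>aug Y\<close>.\<close>

definition augmentation :: "'k ring \<Rightarrow> ('k, 'a) module \<Rightarrow> ('a list \<Rightarrow> 'k) set \<Rightarrow> 'k" where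
  "augmentation k A = pres_lift k (self_module k) (\<lambda>w. if w = [] then \<one>\<^bsub>k\<^esub> else \<zero>\<^bsub>k\<^esub>)"

text \<open>The cancelling pairs \<open>p\<^sub>1, p\<^sub>2\<close> and \<open>q\<^sub>1, q\<^sub>2\<close> have names that are adjacent in the term order, so
  that ordered rewriting with associativity and commutativity brings them together.\<close>

lemma (in abelian_monoid) cancel_two_pairs:
  assumes "p1 \<oplus> p2 = \<zero>" "q1 \<oplus> q2 = \<zero>"
    and "p1 \<in> carrier G" "p2 \<in> carrier G" "q1 \<in> carrier G" "q2 \<in> carrier G"
    "a1 \<in> carrier G" "a2 \<in> carrier G" "a3 \<in> carrier G" "b1 \<in> carrier G" "b2 \<in> carrier G" "b3 \<in> carrier G"
    "g1 \<in> carrier G" "g2 \<in> carrier G" "g3 \<in> carrier G" "d2 \<in> carrier G" "d4 \<in> carrier G" "d5 \<in> carrier G"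
  shows "a1 \<oplus> a2 \<oplus> a3 \<oplus> (b1 \<oplus> b2 \<oplus> b3) \<oplus> (g1 \<oplus> p2 \<oplus> g2 \<oplus> (g3 \<oplus> (q1 \<oplus> d4))) \<oplus> (p1 \<oplus> d2 \<oplus> q2 \<oplus> d5)
    = a1 \<oplus> b1 \<oplus> (a2 \<oplus> b2 \<oplus> g2 \<oplus> d2) \<oplus> a3 \<oplus> b3 \<oplus> g1 \<oplus> g3 \<oplus> d4 \<oplus> d5"
proof -
  have "p1 \<oplus> (p2 \<oplus> x) = x" "q1 \<oplus> (q2 \<oplus> x) = x" if "x \<in> carrier G" for x
    using that assms(1-6) by (simp_all add: a_assoc[symmetric])
  with assms show ?thesis by (simp add: a_ac)
qed

text \<open>The \<open>a\<close>, \<open>b\<close>, \<open>g\<close> and \<open>d\<close> terms come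
  from the four summands of \<open>x \<star> y\<close>, each multiplied by \<open>z\<close>.
  \<open>d1\<close> and \<open>d3\<close> arise from both the third and the fourth summand and
  cancel; the bracket on the right collects the part with the first letter of \<open>z\<close> in
  front.\<close>

lemma (in abelian_group) triple_shuffle_rearrange:
  assumes "a1 \<in> carrier G" "a2 \<in> carrier G" "a3 \<in> carrier G" "b1 \<in> carrier G" "b2 \<in> carrier G" "b3 \<in> carrier G"
    "g1 \<in> carrier G" "g2 \<in> carrier G" "g3 \<in> carrier G"
    "d1 \<in> carrier G" "d2 \<in> carrier G" "d3 \<in> carrier G" "d4 \<in> carrier G" "d5 \<in> carrier G"
  shows "(a1 \<oplus> a2 \<ominus> a3) \<oplus> (b1 \<oplus> b2 \<ominus> b3) \<ominus> ((g1 \<oplus> d1) \<oplus> g2 \<ominus> (g3 \<oplus> (d3 \<ominus> d4))) \<oplus> (d1 \<oplus> d2 \<ominus> d3 \<oplus> d5)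
    = a1 \<oplus> b1 \<oplus> (a2 \<oplus> b2 \<ominus> g2 \<oplus> d2) \<ominus> a3 \<ominus> b3 \<ominus> g1 \<oplus> g3 \<ominus> d4 \<oplus> d5"
  using cancel_two_pairs[of d1 "\<ominus> d1" d3 "\<ominus> d3" a1 a2 "\<ominus> a3" b1 b2 "\<ominus> b3" "\<ominus> g1" "\<ominus> g2" g3 d2 "\<ominus> d4" d5] assms
  by (simp add: a_minus_def minus_add r_neg)

lemma (in abelian_group) minus_zero_right: "x \<in> carrier G \<Longrightarrow> x \<ominus> \<zero> = x"
  using r_neg[OF zero_closed] by (simp add: a_minus_def)

lemma (in abelian_group) swap_cyclic_sum:
  assumes "a1 \<in> carrier G" "b1 \<in> carrier G" "c1 \<in> carrier G" "a2 \<in> carrier G" "b2 \<in> carrier G" "c2 \<in> carrier G"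
    "g \<in> carrier G" "d \<in> carrier G" "e \<in> carrier G"
  shows "a1 \<oplus> b1 \<oplus> c1 \<ominus> a2 \<ominus> b2 \<ominus> c2 \<oplus> g \<ominus> d \<oplus> e = b1 \<oplus> c1 \<oplus> a1 \<ominus> c2 \<ominus> a2 \<ominus> b2 \<oplus> g \<ominus> d \<oplus> e"
  using assms by (simp add: a_minus_def a_ac)

lemma self_module_a_inv: "a_inv (self_module k) = a_inv k"
  by (simp add: a_inv_def m_inv_def fun_eq_iff)

section \<open>The shuffle product on arbitrary elements and its associativity\<close>

context td_algebra
begin

abbreviation "aug \<equiv> augmentation k A"

lemma self_module: "module k (self_module k)"
  using self_module_is_algebra[OF A.R.is_cring] by (rule algebra.module)

lemma aug_multilinear: "multilinear k A (self_module k) (\<lambda>w. if w = [] then \<one>\<^bsub>k\<^esub> else \<zero>\<^bsub>k\<^esub>)"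
  using linear_map_const_zero[OF self_module] by (intro multilinearI) auto

lemma aug_linear: "linear_map k Sh' (self_module k) aug"
  unfolding augmentation_def using self_module aug_multilinear by (rule word_lift_linear)

lemma aug_closed: "X \<in> carrier Sh' \<Longrightarrow> aug X \<in> carrier k"
  using linear_map_closed[OF aug_linear] by simp

lemma aug_word: "w \<in> words \<Longrightarrow> aug (wd w) = (if w = [] then \<one>\<^bsub>k\<^esub> else \<zero>\<^bsub>k\<^esub>)"
  unfolding augmentation_def using self_module aug_multilinear by (rule word_lift_word)

lemma aug_prepend:
  assumes "a \<in> carrier A" "X \<in> carrier Sh'"
  shows "aug (pre a X) = \<zero>\<^bsub>k\<^esub>"
  using word_eqI[OF assms(2) linear_map_compose[OF aug_linear prepend_linear[OF assms(1) linear_map_id]]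
      linear_map_const_zero[OF self_module]] assms(1)
  by (simp add: prepend_word aug_word)

lemmas shuffle_closed = bilinear_map_closed[OF shuffle_bilinear]

lemma shuffle_linear_left:
  "Y \<in> carrier Sh' \<Longrightarrow> linear_map k M Sh' f \<Longrightarrow> linear_map k M Sh' (\<lambda>x. f x \<star> Y)"
  by (rule linear_map_compose[OF bilinear_map_left[OF shuffle_bilinear]])

lemma shuffle_linear_right:
  "X \<in> carrier Sh' \<Longrightarrow> linear_map k M Sh' f \<Longrightarrow> linear_map k M Sh' (\<lambda>y. X \<star> f y)"
  by (rule linear_map_compose[OF bilinear_map_right[OF shuffle_bilinear]])

lemma shuffle_eqI:
  assumes "bilinear_map k Sh' Sh' Q f" "bilinear_map k Sh' Sh' Q g" "X \<in> carrier Sh'" "Y \<in> carrier Sh'"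
    and "\<And>u v. u \<in> words \<Longrightarrow> v \<in> words \<Longrightarrow> f (wd u) (wd v) = g (wd u) (wd v)"
  shows "f X Y = g X Y"
proof (rule word_eqI[OF assms(3)])
  fix u assume u: "u \<in> words"
  note closed = word_closed[OF u]
  show "f (wd u) Y = g (wd u) Y"
    by (rule word_eqI[OF assms(4) bilinear_map_right[OF assms(1) closed] bilinear_map_right[OF assms(2) closed]])
      (rule assms(5)[OF u])
qed (use assms in \<open>auto intro: bilinear_map_left\<close>)

lemma shuffle_commute:
  assumes "X \<in> carrier Sh'" "Y \<in> carrier Sh'"
  shows "X \<star> Y = Y \<star> X"
proof -
  have "bilinear_map k Sh' Sh' Sh' (\<lambda>X Y. Y \<star> X)"
    using shuffle_bilinear by (simp add: bilinear_map_def)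
  from shuffle_eqI[OF shuffle_bilinear this assms] show ?thesis
    using nij_commute by (simp add: shuffle_word del: in_lists_conv_set)
qed

lemma Nil_shuffle: "X \<in> carrier Sh' \<Longrightarrow> wd [] \<star> X = X"
  by (rule word_eqI[OF _ bilinear_map_right[OF shuffle_bilinear] linear_map_id])
    (auto simp: shuffle_word word_closed)

lemma shuffle_Nil: "X \<in> carrier Sh' \<Longrightarrow> X \<star> wd [] = X"
  using shuffle_commute[of X "wd []"] Nil_shuffle word_closed[of "[]"] by simp

text \<open>The Nijenhuis recursion with arbitrary elements as tails: expressed through
  \<open>aug\<close>, both sides are bilinear, so words suffice.\<close>

lemma prepend_shuffle_prepend:
  assumes a: "a \<in> carrier A" and b: "b \<in> carrier A" and X: "X \<in> carrier Sh'" and Y: "Y \<in> carrier Sh'"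
  shows "pre a X \<star> pre b Y = pre a (X \<star> pre b Y) \<boxplus> pre b (pre a X \<star> Y)
    \<boxminus> pre (a \<otimes> b) (pre \<one> (X \<star> Y))
    \<boxplus> l \<bullet> (aug X \<bullet> (aug Y \<bullet> wd [a \<otimes> b]))"
proof (rule shuffle_eqI[OF _ _ X Y])
  have ab: "wd [a \<otimes> b] \<in> carrier Sh'" using a b by (simp add: word_closed)
  show "bilinear_map k Sh' Sh' Sh' (\<lambda>X Y. pre a X \<star> pre b Y)"
    using a b by (intro bilinear_mapI shuffle_linear_left shuffle_linear_right prepend_linear linear_map_id prepend_closed)
  show "bilinear_map k Sh' Sh' Sh' (\<lambda>X Y. pre a (X \<star> pre b Y) \<boxplus> pre b (pre a X \<star> Y)
    \<boxminus> pre (a \<otimes> b) (pre \<one> (X \<star> Y))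
    \<boxplus> l \<bullet> (aug X \<bullet> (aug Y \<bullet> wd [a \<otimes> b])))"
    using a b ab
    by (intro bilinear_mapI shuffle_linear_left shuffle_linear_right prepend_linear linear_map_id prepend_closed
        linear_map_plus linear_map_diff Sh_plus_is_module A.m_closed A.one_closed l_closed aug_closed
        G.smult_closed linear_map_scale[OF Sh_plus_is_module _ l_closed]
        linear_map_smult_left[OF Sh_plus_is_module aug_linear]
        linear_map_scale[OF Sh_plus_is_module linear_map_smult_left[OF Sh_plus_is_module aug_linear]])
  fix u v assume "u \<in> words" "v \<in> words"
  then show "pre a (wd u) \<star> pre b (wd v) = pre a (wd u \<star> pre b (wd v)) \<boxplus> pre b (pre a (wd u) \<star> wd v)
    \<boxminus> pre (a \<otimes> b) (pre \<one> (wd u \<star> wd v))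
    \<boxplus> l \<bullet> (aug (wd u) \<bullet> (aug (wd v) \<bullet> wd [a \<otimes> b]))"
    using a b ab by (simp add: prepend_word shuffle_word aug_word del: in_lists_conv_set)
qed

text \<open>A product of two non-empty words is a combination of terms of positive length, on which
  the augmentation vanishes.\<close>

lemma aug_shuffle:
  assumes "X \<in> carrier Sh'" "Y \<in> carrier Sh'"
  shows "aug (X \<star> Y) = aug X \<otimes>\<^bsub>k\<^esub> aug Y"
proof (rule shuffle_eqI[OF bilinear_map_compose'[OF aug_linear shuffle_bilinear] _ assms])
  have "bilinear_map k (self_module k) (self_module k) (self_module k) (mult k)"
    using algebra_mult_bilinear[OF self_module_is_algebra[OF A.R.is_cring]] by simp
  then show "bilinear_map k Sh' Sh' (self_module k) (\<lambda>X Y. aug X \<otimes>\<^bsub>k\<^esub> aug Y)"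
    by (rule bilinear_map_compose[OF _ aug_linear aug_linear])
  fix u v assume uv: "u \<in> words" "v \<in> words"
  show "aug (wd u \<star> wd v) = aug (wd u) \<otimes>\<^bsub>k\<^esub> aug (wd v)"
  proof (cases u)
    case u: (Cons a u')
    show ?thesis
    proof (cases v)
      case (Cons b v')
      with uv u have "a \<in> carrier A" "b \<in> carrier A" "wd u' \<in> carrier Sh'" "wd v' \<in> carrier Sh'"
        "wd u = pre a (wd u')" "wd v = pre b (wd v')"
        by (auto simp: word_closed prepend_word)
      then show ?thesis
        by (simp add: prepend_shuffle_prepend prepend_closed shuffle_closed word_closed aug_closed aug_prepend aug_word
            linear_map_add[OF aug_linear] linear_map_smult[OF aug_linear]
            linear_map_minus[OF aug_linear Sh_plus_is_module self_module] linear_map_neg[OF aug_linear Sh_plus_is_module self_module] a_minus_def self_module_a_inv)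
    qed (use uv u in \<open>simp add: shuffle_Nil word_closed aug_word\<close>)
  qed (use uv in \<open>simp add: Nil_shuffle word_closed aug_word\<close>)
qed

text \<open>The two formulas for a left factor beginning with \<open>\<one>\<close>, for an empty
  and for a non-empty tail, are combined through \<open>aug X\<close>.\<close>

lemma prepend_one_shuffle_prepend:
  assumes X: "X \<in> carrier Sh'" and b: "b \<in> carrier A" and Y: "Y \<in> carrier Sh'"
  shows "pre \<one> X \<star> pre b Y = pre \<one> (X \<star> pre b Y) \<boxplus> l \<bullet> (aug X \<bullet> pre b Y)"
proof (rule shuffle_eqI[OF _ _ X Y])
  show "bilinear_map k Sh' Sh' Sh' (\<lambda>X Y. pre \<one> X \<star> pre b Y)"
    using b by (intro bilinear_mapI shuffle_linear_left shuffle_linear_right prepend_linear linear_map_id prepend_closed A.one_closed)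
  show "bilinear_map k Sh' Sh' Sh' (\<lambda>X Y. pre \<one> (X \<star> pre b Y) \<boxplus> l \<bullet> (aug X \<bullet> pre b Y))"
    using b
    by (intro bilinear_mapI shuffle_linear_left shuffle_linear_right prepend_linear linear_map_id prepend_closed
        linear_map_plus Sh_plus_is_module A.one_closed l_closed aug_closed
        linear_map_scale[OF Sh_plus_is_module _ l_closed]
        linear_map_smult_left[OF Sh_plus_is_module aug_linear]
        linear_map_scale[OF Sh_plus_is_module _ aug_closed])
  fix u v assume uv: "u \<in> words" "v \<in> words"
  show "pre \<one> (wd u) \<star> pre b (wd v) = pre \<one> (wd u \<star> pre b (wd v)) \<boxplus> l \<bullet> (aug (wd u) \<bullet> pre b (wd v))"
  proof (cases "u = []")
    case True
    with uv b nij_one show ?thesis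
      by (simp add: prepend_word shuffle_word aug_word word_closed del: in_lists_conv_set nijenhuis_word.simps(3))
  next
    case False
    with uv b nij_one_Cons[of u "b # v"] show ?thesis
      by (simp add: prepend_word shuffle_word aug_word word_closed nij_closed prepend_closed del: in_lists_conv_set nijenhuis_word.simps(3))
  qed
qed

text \<open>\<open>Z \<boxminus> aug Z \<bullet> wd []\<close> is the positive-degree part of
  \<open>Z\<close>; multiplying by the empty word produces no \<lambda>-term.\<close>

lemma prepend_one_shuffle:
  assumes X: "X \<in> carrier Sh'" and Z: "Z \<in> carrier Sh'"
  shows "pre \<one> X \<star> Z = pre \<one> (X \<star> Z) \<boxplus> l \<bullet> (aug X \<bullet> (Z \<boxminus> aug Z \<bullet> wd []))"
proof -
  have e: "wd [] \<in> carrier Sh'" by (simp add: word_closed)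
  have 1: "linear_map k Sh' Sh' (\<lambda>Z. pre \<one> X \<star> Z)"
    using X by (intro shuffle_linear_right linear_map_id prepend_closed A.one_closed)
  have 2: "linear_map k Sh' Sh' (\<lambda>Z. pre \<one> (X \<star> Z) \<boxplus> l \<bullet> (aug X \<bullet> (Z \<boxminus> aug Z \<bullet> wd [])))"
    using X e
    by (intro shuffle_linear_right prepend_linear linear_map_id A.one_closed
        linear_map_plus linear_map_diff Sh_plus_is_module l_closed aug_closed
        linear_map_scale[OF Sh_plus_is_module _ l_closed] linear_map_scale[OF Sh_plus_is_module _ aug_closed]
        linear_map_smult_left[OF Sh_plus_is_module aug_linear])
  show ?thesis
  proof (rule word_eqI[OF Z 1 2])
    fix w assume w: "w \<in> words"
    show "pre \<one> X \<star> wd w = pre \<one> (X \<star> wd w) \<boxplus> l \<bullet> (aug X \<bullet> (wd w \<boxminus> aug (wd w) \<bullet> wd []))"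
    proof (cases w)
      case Nil
      then show ?thesis
        using X e by (simp add: shuffle_Nil prepend_closed aug_word aug_closed a_minus_def G.M.r_neg)
    next
      case (Cons b v)
      with w have "b \<in> carrier A" "wd v \<in> carrier Sh'" "wd w = pre b (wd v)"
        by (auto simp: word_closed prepend_word)
      then show ?thesis
        using X e by (simp add: prepend_one_shuffle_prepend aug_prepend prepend_closed G.M.minus_zero_right)
    qed
  qed
qed

text \<open>A cyclic permutation of \<open>(a, X)\<close>, \<open>(b, Y)\<close>,
  \<open>(c, Z)\<close> permutes the terms on the right, up to the cyclic identity for products with
  fewer letters; the last two terms, with scalar coefficients, are invariant. This is what makes an
  induction for associativity work.\<close>

lemma shuffle_triple:
  assumes abc: "a \<in> carrier A" "b \<in> carrier A" "c \<in> carrier A"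
    and XYZ: "X \<in> carrier Sh'" "Y \<in> carrier Sh'" "Z \<in> carrier Sh'"
    and x: "x = pre a X" and y: "y = pre b Y" and z: "z = pre c Z"
  shows "(x \<star> y) \<star> z =
    pre a ((X \<star> y) \<star> z) \<boxplus> pre b ((x \<star> Y) \<star> z) \<boxplus> pre c ((x \<star> y) \<star> Z)
    \<boxminus> pre (a \<otimes> c) (pre \<one> ((X \<star> y) \<star> Z))
    \<boxminus> pre (b \<otimes> c) (pre \<one> ((x \<star> Y) \<star> Z))
    \<boxminus> pre (a \<otimes> b) (pre \<one> ((X \<star> Y) \<star> z))
    \<boxplus> pre (a \<otimes> b \<otimes> c) (pre \<one> (pre \<one> ((X \<star> Y) \<star> Z)))
    \<boxminus> (l \<otimes>\<^bsub>k\<^esub> (aug X \<otimes>\<^bsub>k\<^esub> aug Y \<otimes>\<^bsub>k\<^esub> aug Z)) \<bullet> wd [a \<otimes> b \<otimes> c, \<one>]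
    \<boxplus> (l \<otimes>\<^bsub>k\<^esub> l \<otimes>\<^bsub>k\<^esub> (aug X \<otimes>\<^bsub>k\<^esub> aug Y \<otimes>\<^bsub>k\<^esub> aug Z)) \<bullet> wd [a \<otimes> b \<otimes> c]"
proof -
  let ?P = "pre \<one>"
  \<comment> \<open>\<open>s\<close> is the coefficient of the exceptional term
    \<open>wd [a \<otimes> b]\<close> in \<open>x \<star> y\<close>.\<close>
  define ab abc s where "ab = a \<otimes> b" and "abc = a \<otimes> b \<otimes> c" and "s = l \<otimes>\<^bsub>k\<^esub> (aug X \<otimes>\<^bsub>k\<^esub> aug Y)"
  define \<alpha> \<beta> \<gamma> \<delta> where "\<alpha> = pre a (X \<star> y)" and "\<beta> = pre b (x \<star> Y)" and "\<gamma> = pre ab (?P (X \<star> Y))" and "\<delta> = wd [ab]"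
  have e: "wd [] \<in> carrier Sh'" by (simp add: word_closed)
  have ab_closed: "ab \<in> carrier A" "abc \<in> carrier A" "ab \<otimes> c = abc"
    using abc by (simp_all add: ab_def abc_def)
  have aug: "aug X \<in> carrier k" "aug Y \<in> carrier k" "aug Z \<in> carrier k" using XYZ by (simp_all add: aug_closed)
  have s: "s \<in> carrier k" using aug by (simp add: s_def)
  have xyz: "x \<in> carrier Sh'" "y \<in> carrier Sh'" "z \<in> carrier Sh'" using abc XYZ x y z by (simp_all add: prepend_closed)
  have smults: "l \<bullet> (aug X \<bullet> (aug Y \<bullet> t)) = s \<bullet> t"
    "l \<bullet> (aug X \<otimes>\<^bsub>k\<^esub> aug Y \<bullet> t) = s \<bullet> t" if "t \<in> carrier Sh'" for t
    using aug that by (simp_all add: s_def G.smult_assoc1)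
  note closed = xyz XYZ shuffle_closed prepend_closed word_closed e abc ab_closed(1,2)
  have greek: "\<alpha> \<in> carrier Sh'" "\<beta> \<in> carrier Sh'" "\<gamma> \<in> carrier Sh'" "\<delta> \<in> carrier Sh'"
    by (simp_all add: \<alpha>_def \<beta>_def \<gamma>_def \<delta>_def closed)
  \<comment> \<open>An element with a letter in front has no degree-0 part, and products inherit
    this. Hence the exceptional \<lambda>-term of the outer recursion occurs in
    \<open>\<delta> \<star> z\<close> only.\<close>
  have aug0: "aug (X \<star> y) = \<zero>\<^bsub>k\<^esub>" "aug (x \<star> Y) = \<zero>\<^bsub>k\<^esub>" "aug (?P (X \<star> Y)) = \<zero>\<^bsub>k\<^esub>" "aug z = \<zero>\<^bsub>k\<^esub>"
    using aug by (simp_all add: aug_shuffle closed aug_prepend x y z)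
  have xy: "x \<star> y = \<alpha> \<boxplus> \<beta> \<boxminus> \<gamma> \<boxplus> s \<bullet> \<delta>"
    using prepend_shuffle_prepend[OF abc(1,2) XYZ(1,2)] greek(4)
    by (simp add: \<alpha>_def \<beta>_def \<gamma>_def \<delta>_def smults ab_def x y)
  have expand: "(x \<star> y) \<star> t = \<alpha> \<star> t \<boxplus> \<beta> \<star> t \<boxminus> \<gamma> \<star> t \<boxplus> s \<bullet> (\<delta> \<star> t)" if "t \<in> carrier Sh'" for t
    using that greek s
    by (simp add: xy bilinear_map_add_left[OF shuffle_bilinear] bilinear_map_smult_left[OF shuffle_bilinear]
        bilinear_map_minus_left[OF shuffle_bilinear Sh_plus_is_module Sh_plus_is_module])
  have \<alpha>: "\<alpha> \<star> z = pre a ((X \<star> y) \<star> z) \<boxplus> pre c (\<alpha> \<star> Z) \<boxminus> pre (a \<otimes> c) (?P ((X \<star> y) \<star> Z))"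
    using prepend_shuffle_prepend[of a c "X \<star> y" Z] aug
    by (simp add: \<alpha>_def z[symmetric] closed aug0 aug_closed)
  have \<beta>: "\<beta> \<star> z = pre b ((x \<star> Y) \<star> z) \<boxplus> pre c (\<beta> \<star> Z) \<boxminus> pre (b \<otimes> c) (?P ((x \<star> Y) \<star> Z))"
    using prepend_shuffle_prepend[of b c "x \<star> Y" Z] aug
    by (simp add: \<beta>_def z[symmetric] closed aug0 aug_closed)
  \<comment> \<open>The remaining \<lambda>-terms of \<open>\<gamma> \<star> z\<close> come from
    inner products whose left factor begins with \<open>\<one>\<close>. Except for the one in
    \<open>wd [abc, \<one>]\<close>, they cancel against terms of
    \<open>s \<bullet> (\<delta> \<star> z)\<close>, since \<gamma> enters
    \<open>x \<star> y\<close> with a minus sign.\<close>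
  have \<gamma>1: "pre ab (?P (X \<star> Y) \<star> z) = pre ab (?P ((X \<star> Y) \<star> z)) \<boxplus> s \<bullet> pre ab z"
    using aug s
    by (simp add: z prepend_one_shuffle_prepend closed aug_shuffle smults bilinear_map_add_right[OF prepend_bilinear]
        bilinear_map_smult_right[OF prepend_bilinear])
  have \<gamma>2: "pre abc (?P (?P (X \<star> Y) \<star> Z)) = pre abc (?P (?P ((X \<star> Y) \<star> Z))) \<boxplus>
      (s \<bullet> pre abc (?P Z) \<boxminus> s \<bullet> (aug Z \<bullet> wd [abc, \<one>]))"
    using aug s
    by (simp add: prepend_one_shuffle closed aug_shuffle smults bilinear_map_add_right[OF prepend_bilinear]
        bilinear_map_smult_right[OF prepend_bilinear] prepend_word a_minus_def G.smult_r_distr G.smult_r_minus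
        linear_map_neg[OF bilinear_map_right[OF prepend_bilinear] Sh_plus_is_module Sh_plus_is_module])
  have \<gamma>: "\<gamma> \<star> z = (pre ab (?P ((X \<star> Y) \<star> z)) \<boxplus> s \<bullet> pre ab z) \<boxplus> pre c (\<gamma> \<star> Z) \<boxminus>
      (pre abc (?P (?P ((X \<star> Y) \<star> Z))) \<boxplus>
       (s \<bullet> pre abc (?P Z) \<boxminus> s \<bullet> (aug Z \<bullet> wd [abc, \<one>])))"
    using prepend_shuffle_prepend[of ab c "?P (X \<star> Y)" Z] aug
    unfolding \<gamma>1[symmetric] \<gamma>2[symmetric]
    by (simp add: \<gamma>_def z[symmetric] closed aug0 aug_closed ab_closed)
  have \<delta>: "\<delta> \<star> z = pre ab z \<boxplus> pre c (\<delta> \<star> Z) \<boxminus> pre abc (?P Z) \<boxplus> l \<bullet> (aug Z \<bullet> wd [abc])"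
    using prepend_shuffle_prepend[of ab c "wd []" Z] aug
    by (simp add: \<delta>_def z[symmetric] closed aug_word ab_closed prepend_word Nil_shuffle)
  \<comment> \<open>Read from right to left: the four summands with \<open>c\<close> in front
    recombine to a single product.\<close>
  have cZ: "pre c ((x \<star> y) \<star> Z) = pre c (\<alpha> \<star> Z) \<boxplus> pre c (\<beta> \<star> Z) \<boxminus> pre c (\<gamma> \<star> Z) \<boxplus> s \<bullet> pre c (\<delta> \<star> Z)"
    using greek s
    by (simp add: expand closed bilinear_map_add_right[OF prepend_bilinear] bilinear_map_smult_right[OF prepend_bilinear]
        linear_map_minus[OF bilinear_map_right[OF prepend_bilinear] Sh_plus_is_module Sh_plus_is_module])
  have "s \<bullet> (\<delta> \<star> z) = s \<bullet> pre ab z \<boxplus> s \<bullet> pre c (\<delta> \<star> Z) \<boxminus> s \<bullet> pre abc (?P Z)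
      \<boxplus> s \<bullet> (l \<bullet> (aug Z \<bullet> wd [abc]))"
    using greek s aug by (simp add: \<delta> closed G.smult_r_distr a_minus_def G.smult_r_minus)
  moreover have "s \<bullet> (aug Z \<bullet> t) = (l \<otimes>\<^bsub>k\<^esub> (aug X \<otimes>\<^bsub>k\<^esub> aug Y \<otimes>\<^bsub>k\<^esub> aug Z)) \<bullet> t"
    "s \<bullet> (l \<bullet> (aug Z \<bullet> t)) = (l \<otimes>\<^bsub>k\<^esub> l \<otimes>\<^bsub>k\<^esub> (aug X \<otimes>\<^bsub>k\<^esub> aug Y \<otimes>\<^bsub>k\<^esub> aug Z)) \<bullet> t"
    if "t \<in> carrier Sh'" for t
    using that aug by (simp_all add: s_def G.smult_assoc1[symmetric] A.R.m_ac)
  ultimately show ?thesis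
    using greek s aug
    by (simp add: expand[OF xyz(3)] \<alpha> \<beta> \<gamma> cZ G.M.triple_shuffle_rearrange closed ab_closed(3)
        ab_def[symmetric] abc_def[symmetric])
qed

text \<open>Both sides are bracketed to the left and expand by \<open>shuffle_triple\<close>; the
  induction hypotheses match the shorter products term by term. Together with commutativity, the
  cyclic identity is associativity.\<close>

lemma shuffle_assoc_words:
  "u \<in> words \<Longrightarrow> v \<in> words \<Longrightarrow> w \<in> words \<Longrightarrow>
    (wd u \<star> wd v) \<star> wd w = (wd v \<star> wd w) \<star> wd u"
proof (induction "length u + length v + length w" arbitrary: u v w rule: less_induct)
  case less
  have closed: "wd u \<in> carrier Sh'" "wd v \<in> carrier Sh'" "wd w \<in> carrier Sh'"
    using less.prems by (simp_all add: word_closed)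
  show ?case
  proof (cases "u = [] \<or> v = [] \<or> w = []")
    case True
    then show ?thesis
      using closed shuffle_commute[of "wd u" "wd v"] shuffle_commute[of "wd w" "wd u"] shuffle_commute[of "wd v" "wd w"]
      by (auto simp: Nil_shuffle shuffle_Nil shuffle_closed)
  next
    case False
    then obtain a u' b v' c w' where uvw: "u = a # u'" "v = b # v'" "w = c # w'"
      by (meson neq_Nil_conv)
    then have mem: "a \<in> carrier A" "b \<in> carrier A" "c \<in> carrier A"
      "u' \<in> words" "v' \<in> words" "w' \<in> words"
      using less.prems by auto
    then have closed': "wd u' \<in> carrier Sh'" "wd v' \<in> carrier Sh'" "wd w' \<in> carrier Sh'"
      by (simp_all add: word_closed)
    have pre: "wd u = pre a (wd u')" "wd v = pre b (wd v')" "wd w = pre c (wd w')"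
      using mem uvw by (simp_all add: prepend_word)
    have IH: "(wd p \<star> wd q) \<star> wd r = (wd q \<star> wd r) \<star> wd p"
      if "length p + length q + length r < length u + length v + length w"
        "p \<in> {u, u'}" "q \<in> {v, v'}" "r \<in> {w, w'}" for p q r
      by (rule less.hyps[OF that(1)]) (use that less.prems mem in auto)
    have IHs: "(wd u' \<star> wd v) \<star> wd w = (wd v \<star> wd w) \<star> wd u'"
      "(wd u \<star> wd v') \<star> wd w = (wd v' \<star> wd w) \<star> wd u"
      "(wd u \<star> wd v) \<star> wd w' = (wd v \<star> wd w') \<star> wd u"
      "(wd u' \<star> wd v) \<star> wd w' = (wd v \<star> wd w') \<star> wd u'"
      "(wd u \<star> wd v') \<star> wd w' = (wd v' \<star> wd w') \<star> wd u"
      "(wd u' \<star> wd v') \<star> wd w = (wd v' \<star> wd w) \<star> wd u'"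
      "(wd u' \<star> wd v') \<star> wd w' = (wd v' \<star> wd w') \<star> wd u'"
      by (rule IH; simp add: uvw)+
    have comms: "b \<otimes> c \<otimes> a = a \<otimes> b \<otimes> c" "b \<otimes> a = a \<otimes> b" "c \<otimes> a = a \<otimes> c"
      "aug (wd v') \<otimes>\<^bsub>k\<^esub> aug (wd w') \<otimes>\<^bsub>k\<^esub> aug (wd u') = aug (wd u') \<otimes>\<^bsub>k\<^esub> aug (wd v') \<otimes>\<^bsub>k\<^esub> aug (wd w')"
      using mem closed' by (simp_all add: A.m_ac A.R.m_ac aug_closed)
    show ?thesis
      unfolding shuffle_triple[OF mem(1-3) closed' pre] shuffle_triple[OF mem(2,3,1) closed'(2,3,1) pre(2,3,1)] IHs comms
      by (rule G.M.swap_cyclic_sum)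
        (use mem closed closed' in \<open>auto simp: aug_closed intro!: prepend_closed shuffle_closed G.smult_closed word_closed\<close>)
  qed
qed

lemma shuffle_assoc:
  assumes "X \<in> carrier Sh'" "Y \<in> carrier Sh'" "Z \<in> carrier Sh'"
  shows "(X \<star> Y) \<star> Z = X \<star> (Y \<star> Z)"
proof -
  have "(X \<star> Y) \<star> Z = (Y \<star> Z) \<star> X"
  proof (rule word_eqI[OF assms(1)])
    fix u assume u: "u \<in> words"
    then have uc: "wd u \<in> carrier Sh'" by (rule word_closed)
    show "(wd u \<star> Y) \<star> Z = (Y \<star> Z) \<star> wd u"
    proof (rule word_eqI[OF assms(2)])
      fix v assume v: "v \<in> words"
      then have vc: "wd v \<in> carrier Sh'" by (rule word_closed)
      show "(wd u \<star> wd v) \<star> Z = (wd v \<star> Z) \<star> wd u"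
        by (rule word_eqI[OF assms(3)])
          (use uc vc u v shuffle_assoc_words in \<open>auto intro!: shuffle_linear_left shuffle_linear_right linear_map_id shuffle_closed\<close>)
    qed (use uc assms in \<open>auto intro!: shuffle_linear_left shuffle_linear_right linear_map_id shuffle_closed\<close>)
  qed (use assms in \<open>auto intro!: shuffle_linear_left shuffle_linear_right linear_map_id shuffle_closed\<close>)
  also have "\<dots> = X \<star> (Y \<star> Z)"
    using assms by (simp add: shuffle_commute shuffle_closed)
  finally show ?thesis .
qed

end


section \<open>The algebra \<open>Sh(A)\<close>\<close>

lemma Sh_simps [simp]:
  "zero (Sh k A l) = zero (Sh_plus k A)" "add (Sh k A l) = add (Sh_plus k A)"
  "smult (Sh k A l) = smult (Sh_plus k A)" "one (Sh k A l) = word k A [\<one>\<^bsub>A\<^esub>]"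
  by (simp_all add: Sh_def)

lemma Sh_carrier:
  "carrier (Sh k A l) = submodule_span k (Sh_plus k A) {word k A w | w. w \<in> lists (carrier A) \<and> w \<noteq> []}"
  by (simp add: Sh_def)

lemma Sh_mult: "(\<otimes>\<^bsub>Sh k A l\<^esub>) = (\<lambda>X Y. pres_lift k (Sh_plus k A)
                (\<lambda>u. pres_lift k (Sh_plus k A) (diamond_word k A l u) Y) X)"
  by (simp add: Sh_def)

lemma linear_map_Sh_cong:
  "carrier M \<subseteq> carrier M' \<Longrightarrow> add M = add M' \<Longrightarrow> smult M = smult M' \<Longrightarrow> linear_map k M' Q f \<Longrightarrow> linear_map k M Q f"
  by (simp add: linear_map_def Pi_iff subset_iff)

lemma
  fixes k :: "'k ring" and R :: "('k, 'r) module"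
  assumes "algebra k R" "linear_map k M R f" "y \<in> carrier R"
  shows linear_map_mult_left: "linear_map k M R (\<lambda>x. f x \<otimes>\<^bsub>R\<^esub> y)"
    and linear_map_mult_right: "linear_map k M R (\<lambda>x. y \<otimes>\<^bsub>R\<^esub> f x)"
  using linear_map_compose[OF bilinear_map_left[OF algebra_mult_bilinear[OF assms(1)] assms(3)] assms(2)]
    linear_map_compose[OF bilinear_map_right[OF algebra_mult_bilinear[OF assms(1)] assms(3)] assms(2)]
  by auto

context td_algebra
begin

abbreviation "S \<equiv> Sh k A l"

lemma Sh_submodule: "submodule (carrier S) k Sh'"
  unfolding Sh_carrier by (rule submodule_span_submodule[OF Sh_plus_is_module]) (use word_closed in blast)

lemma Sh_subset: "carrier S \<subseteq> carrier Sh'"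
  using G.submoduleE(1)[OF Sh_submodule] .

lemma Sh_is_module: "module k S"
  by (rule module_cong[OF submodule.submodule_is_module[OF Sh_submodule Sh_plus_is_module]]) simp_all

sublocale S: module k S
  by (rule Sh_is_module)

lemma word_in_Sh:
  assumes "a \<in> carrier A" "w \<in> words"
  shows "wd (a # w) \<in> carrier S"
proof -
  have "a # w \<in> words \<and> a # w \<noteq> []" using assms by simp
  then show ?thesis
    unfolding Sh_carrier by (intro subsetD[OF submodule_span_superset]) blast
qed

text \<open>Scalars are absorbed into the first letter, which exists because the spanning words are
  non-empty.\<close>

lemma Sh_induct [consumes 1, case_names word add]:
  assumes "x \<in> carrier S"
    and word: "\<And>a w. a \<in> carrier A \<Longrightarrow> w \<in> words \<Longrightarrow> P (wd (a # w))"
    and add: "\<And>x y. x \<in> carrier S \<Longrightarrow> y \<in> carrier S \<Longrightarrow> P x \<Longrightarrow> P y \<Longrightarrow> P (x \<oplus>\<^bsub>S\<^esub> y)"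
  shows "P x"
proof -
  note lin = word_Cons_linear
  have zero: "P \<zero>\<^bsub>Sh'\<^esub>"
    using word[of "\<zero>" "[]"] linear_map_zero[OF lin[of "[]"] A.module_axioms Sh_plus_is_module] by simp
  \<comment> \<open>Quantifying over all scalar multiples makes the set closed under negation and
    scaling, neither of which is assumed for \<open>P\<close>.\<close>
  have "submodule {x \<in> carrier S. \<forall>c\<in>carrier k. P (c \<odot>\<^bsub>S\<^esub> x)} k S"
  proof (rule S.submoduleI)
    fix x assume x: "x \<in> {x \<in> carrier S. \<forall>c\<in>carrier k. P (c \<odot>\<^bsub>S\<^esub> x)}"
    then have "c \<odot>\<^bsub>S\<^esub> (\<ominus>\<^bsub>S\<^esub> x) = (\<ominus>\<^bsub>k\<^esub> c) \<odot>\<^bsub>S\<^esub> x" if "c \<in> carrier k" for c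
      using that S.smult_l_minus[of c x] S.smult_r_minus[of c x] by simp
    with x show "\<ominus>\<^bsub>S\<^esub> x \<in> {x \<in> carrier S. \<forall>c\<in>carrier k. P (c \<odot>\<^bsub>S\<^esub> x)}" by simp
  next
    fix x y assume "x \<in> {x \<in> carrier S. \<forall>c\<in>carrier k. P (c \<odot>\<^bsub>S\<^esub> x)}" "y \<in> {x \<in> carrier S. \<forall>c\<in>carrier k. P (c \<odot>\<^bsub>S\<^esub> x)}"
    then show "x \<oplus>\<^bsub>S\<^esub> y \<in> {x \<in> carrier S. \<forall>c\<in>carrier k. P (c \<odot>\<^bsub>S\<^esub> x)}"
      using S.a_closed S.smult_r_distr S.smult_closed add by (simp del: Sh_simps)
  next
    fix c x assume "c \<in> carrier k" "x \<in> {x \<in> carrier S. \<forall>c\<in>carrier k. P (c \<odot>\<^bsub>S\<^esub> x)}"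
    then show "c \<odot>\<^bsub>S\<^esub> x \<in> {x \<in> carrier S. \<forall>c\<in>carrier k. P (c \<odot>\<^bsub>S\<^esub> x)}"
      using S.smult_closed by (simp add: S.smult_assoc1[symmetric] del: Sh_simps)
  qed (use zero S.zero_closed S.smult_r_null in auto)
  \<comment> \<open>The span that defines the carrier is taken in \<open>Sh_plus\<close>, so the set
    has to be a submodule there.\<close>
  then have "submodule {x \<in> carrier S. \<forall>c\<in>carrier k. P (c \<odot>\<^bsub>S\<^esub> x)} k Sh'"
    using Sh_subset
    by (intro G.module_incl_imp_submodule module_cong[OF submodule.submodule_is_module[OF _ Sh_is_module]]) auto
  moreover have "wd w \<in> {x \<in> carrier S. \<forall>c\<in>carrier k. P (c \<odot>\<^bsub>S\<^esub> x)}"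
    if "w \<in> words" "w \<noteq> []" for w
  proof -
    from that obtain a v where w: "w = a # v" "a \<in> carrier A" "v \<in> words" by (cases w) auto
    then have "c \<odot>\<^bsub>S\<^esub> wd w = wd ((c \<odot> a) # v)" if "c \<in> carrier k" for c
      using that linear_map_smult[OF lin] by simp
    with w word word_in_Sh show ?thesis by auto
  qed
  ultimately have "carrier S \<subseteq> {x \<in> carrier S. \<forall>c\<in>carrier k. P (c \<odot>\<^bsub>S\<^esub> x)}"
    by (subst (1) Sh_carrier) (rule submodule_span_least, auto)
  with assms(1) have "P (\<one>\<^bsub>k\<^esub> \<odot>\<^bsub>S\<^esub> x)" by blast
  with assms(1) show ?thesis using S.smult_one by simp
qed

lemma Sh_eqI:
  assumes "x \<in> carrier S" "linear_map k S Q f" "linear_map k S Q g"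
    and "\<And>a w. a \<in> carrier A \<Longrightarrow> w \<in> words \<Longrightarrow> f (wd (a # w)) = g (wd (a # w))"
  shows "f x = g x"
  using assms(1)
  by (induction rule: Sh_induct)
    (use assms(4) linear_map_add[OF assms(2)] linear_map_add[OF assms(3)] in auto)

lemma linear_map_from_Sh: "linear_map k Sh' Q f \<Longrightarrow> linear_map k S Q f"
  using Sh_subset by (rule linear_map_Sh_cong) simp_all

text \<open>Negatives are determined relative to the carrier, so the differences in Sh(A) and in
  \<open>Sh_plus\<close> do not agree by definition.\<close>

lemma Sh_minus: "x \<in> carrier S \<Longrightarrow> y \<in> carrier S \<Longrightarrow> x \<ominus>\<^bsub>S\<^esub> y = x \<boxminus> y"
  by (rule linear_map_minus[OF linear_map_from_Sh[OF linear_map_id] Sh_is_module Sh_plus_is_module])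

lemma linear_map_into_Sh:
  assumes "linear_map k M Sh' f" "\<And>x. x \<in> carrier M \<Longrightarrow> f x \<in> carrier S"
  shows "linear_map k M S f"
  using assms by (simp add: linear_map_def)

lemma prepend_in_Sh:
  assumes a: "a \<in> carrier A" and X: "X \<in> carrier Sh'"
  shows "pre a X \<in> carrier S"
  using X
proof (induction rule: word_induct)
  case (word c w)
  then show ?case
    using a word_in_Sh[OF a word(2)] S.smult_closed[OF word(1)]
    by (simp add: bilinear_map_smult_right[OF prepend_bilinear] word_closed prepend_word)
next
  case (add X Y)
  then show ?case
    using a S.a_closed by (simp add: bilinear_map_add_right[OF prepend_bilinear])
qed

text \<open>Induction on the length of words: the tail of a word of length at least 2 lies in Sh(A)
  again and has an induction hypothesis.\<close>

lemma Sh_induct_prepend [consumes 1, case_names letter prepend add]: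
  assumes "x \<in> carrier S"
    and "\<And>a. a \<in> carrier A \<Longrightarrow> P (wd [a])"
    and "\<And>a x. a \<in> carrier A \<Longrightarrow> x \<in> carrier S \<Longrightarrow> P x \<Longrightarrow> P (pre a x)"
    and "\<And>x y. x \<in> carrier S \<Longrightarrow> y \<in> carrier S \<Longrightarrow> P x \<Longrightarrow> P y \<Longrightarrow> P (x \<oplus>\<^bsub>S\<^esub> y)"
  shows "P x"
  using assms(1)
proof (induction rule: Sh_induct)
  case (word a w)
  then show ?case
  proof (induction w arbitrary: a rule: list.induct)
    case (Cons b w)
    then show ?case
      using assms(3)[of a "wd (b # w)"] word_in_Sh[of b w] by (simp add: prepend_word)
  qed (use assms(2) in simp)
qed (rule assms(4))

lemma diamond_word_multilinear:
  shows "v \<in> words \<Longrightarrow> multilinear k A Sh' (\<lambda>u. diamond_word k A l u v)"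
    and "u \<in> words \<Longrightarrow> multilinear k A Sh' (diamond_word k A l u)"
proof -
  have closed: "diamond_word k A l u v \<in> carrier Sh'" if "u \<in> words" "v \<in> words" for u v
    using that by (cases "(k, A, l, u, v)" rule: diamond_word.cases)
      (auto simp: prepend_closed shuffle_closed word_closed)
  have commute: "diamond_word k A l u v = diamond_word k A l v u" if "u \<in> words" "v \<in> words" for u v
    using that by (cases u; cases v) (simp_all add: A.m_comm shuffle_commute word_closed)
  show left: "multilinear k A Sh' (\<lambda>u. diamond_word k A l u v)" if v: "v \<in> words" for v
  proof (rule multilinearI)
    fix p s assume ps: "p \<in> words" "s \<in> words"
    show "linear_map k A Sh' (\<lambda>a. diamond_word k A l (p @ a # s) v)"
    proof (cases v)
      case Nil
      have "diamond_word k A l (p @ a # s) v = \<zero>\<^bsub>Sh'\<^esub>" for a using Nil by (cases p) auto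
      then show ?thesis using linear_map_const_zero[OF Sh_plus_is_module] by simp
    next
      case (Cons b v')
      then have b: "b \<in> carrier A" and v': "wd v' \<in> carrier Sh'" using v by (simp_all add: word_closed)
      show ?thesis
      proof (cases p)
        case Nil
        have s: "wd s \<in> carrier Sh'" using ps by (simp add: word_closed del: in_lists_conv_set)
        have "linear_map k A A (\<lambda>a. a \<otimes> b)"
          using linear_map_mult_left[OF A.algebra_axioms linear_map_id b] .
        from linear_map_compose[OF bilinear_map_left[OF prepend_bilinear shuffle_closed[OF s v']] this]
        show ?thesis using Nil Cons by simp
      next
        case p: (Cons c p')
        then have "c \<in> carrier A" "p' \<in> words" using ps by auto
        then have "linear_map k A Sh' (\<lambda>a. pre (c \<otimes> b) (wd (p' @ a # s) \<star> wd v'))"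
          using b by (intro prepend_linear shuffle_linear_left multilinear_linear[OF word_multilinear] v' ps A.m_closed)
        then show ?thesis using p Cons by simp
      qed
    qed
  qed (use v closed in blast)
  show "multilinear k A Sh' (diamond_word k A l u)" if "u \<in> words" for u
    by (rule multilinear_cong[THEN iffD2, OF _ left[OF that]]) (rule commute[OF that])
qed

lemmas diamond_lift = word_double_lift_bilinear[OF Sh_plus_is_module diamond_word_multilinear(2,1)]
  word_double_lift_word[OF Sh_plus_is_module diamond_word_multilinear(2,1)]

text \<open>With arbitrary tails allowed, Sh(A) visibly multiplies like a tensor product of the
  algebras \<open>A\<close> and \<open>Sh_plus\<close>; its algebra laws follow from theirs.\<close>

lemma Sh_mult_prepend:
  assumes "a \<in> carrier A" "b \<in> carrier A" and X: "X \<in> carrier Sh'" and Y: "Y \<in> carrier Sh'"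
  shows "pre a X \<otimes>\<^bsub>S\<^esub> pre b Y = pre (a \<otimes> b) (X \<star> Y)"
  unfolding Sh_mult
proof (rule shuffle_eqI[OF _ _ X Y])
  show "bilinear_map k Sh' Sh' Sh' (\<lambda>X Y. pres_lift k Sh' (\<lambda>u. pres_lift k Sh' (diamond_word k A l u) (pre b Y)) (pre a X))"
    using bilinear_map_compose[OF diamond_lift(1) bilinear_map_right[OF prepend_bilinear assms(1)] bilinear_map_right[OF prepend_bilinear assms(2)]] .
  show "bilinear_map k Sh' Sh' Sh' (\<lambda>X Y. pre (a \<otimes> b) (X \<star> Y))"
    using bilinear_map_compose'[OF bilinear_map_right[OF prepend_bilinear] shuffle_bilinear] assms by simp
qed (use assms in \<open>simp add: prepend_word diamond_lift(2) del: in_lists_conv_set\<close>)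

text \<open>The defining lift takes values in \<open>Sh_plus\<close>; that they lie in Sh(A) is
  checked on products of words.\<close>

lemma Sh_mult_bilinear: "bilinear_map k S S S (mult S)"
proof -
  have bil: "bilinear_map k S S Sh' (mult S)"
    using diamond_lift(1) unfolding Sh_mult bilinear_map_def
    using Sh_subset by (auto intro: linear_map_from_Sh)
  have "x \<otimes>\<^bsub>S\<^esub> y \<in> carrier S" if x: "x \<in> carrier S" and y: "y \<in> carrier S" for x y
    using x
  proof (induction rule: Sh_induct)
    case (word a u)
    then have pre: "wd (a # u) = pre a (wd u)" "wd u \<in> carrier Sh'" by (simp_all add: prepend_word word_closed)
    note a = word
    from y show ?case
    proof (induction rule: Sh_induct)
      case (word b v)
      then have "wd (b # v) = pre b (wd v)" "wd v \<in> carrier Sh'" by (simp_all add: prepend_word word_closed)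
      with a word pre show ?case
        by (simp add: Sh_mult_prepend prepend_in_Sh shuffle_closed del: in_lists_conv_set)
    next
      case (add x y)
      then show ?case
        using bilinear_map_add_right[OF bil word_in_Sh[OF a]] S.a_closed by simp
    qed
  next
    case (add x x')
    then show ?case
      using bilinear_map_add_left[OF bil add(1) y add(2)] S.a_closed by simp
  qed
  with bil show ?thesis
    unfolding bilinear_map_def by (auto intro: linear_map_into_Sh)
qed

text \<open>Here the tail ranges over all of \<open>Sh_plus\<close>, degree 0 included, so that one
  case covers every word and products reduce to shuffles of tails.\<close>

lemma Sh_prepend_induct [consumes 1, case_names prepend add]:
  assumes "x \<in> carrier S"
    and "\<And>a X. a \<in> carrier A \<Longrightarrow> X \<in> carrier Sh' \<Longrightarrow> P (pre a X)"
    and "\<And>x y. x \<in> carrier S \<Longrightarrow> y \<in> carrier S \<Longrightarrow> P x \<Longrightarrow> P y \<Longrightarrow> P (x \<oplus>\<^bsub>S\<^esub> y)"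
  shows "P x"
  using assms(1)
proof (induction rule: Sh_induct)
  case (word a w)
  then show ?case using assms(2)[of a "wd w"] by (simp add: prepend_word word_closed)
qed (rule assms(3))

lemma Sh_prepend_eqI:
  assumes "x \<in> carrier S" "linear_map k S Q f" "linear_map k S Q g"
    and "\<And>a X. a \<in> carrier A \<Longrightarrow> X \<in> carrier Sh' \<Longrightarrow> f (pre a X) = g (pre a X)"
  shows "f x = g x"
  using assms(1)
  by (induction rule: Sh_prepend_induct)
    (use assms(4) linear_map_add[OF assms(2)] linear_map_add[OF assms(3)] in auto)

lemma Sh_bilinear_eqI:
  assumes "bilinear_map k S S Q f" "bilinear_map k S S Q g" and x: "x \<in> carrier S" and y: "y \<in> carrier S"
    and "\<And>a X b Y. \<lbrakk>a \<in> carrier A; X \<in> carrier Sh'; b \<in> carrier A; Y \<in> carrier Sh'\<rbrakk> \<Longrightarrow>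
      f (pre a X) (pre b Y) = g (pre a X) (pre b Y)"
  shows "f x y = g x y"
proof (rule Sh_prepend_eqI[OF x bilinear_map_left[OF assms(1) y] bilinear_map_left[OF assms(2) y]])
  fix a X assume "a \<in> carrier A" "X \<in> carrier Sh'"
  then show "f (pre a X) y = g (pre a X) y"
    by (intro Sh_prepend_eqI[OF y bilinear_map_right[OF assms(1)] bilinear_map_right[OF assms(2)]] prepend_in_Sh assms(5))
qed

lemma Sh_is_algebra: "algebra k S"
proof (rule algebra_if_bilinear[OF Sh_is_module Sh_mult_bilinear])
  note bil = Sh_mult_bilinear
  note left = linear_map_compose[OF bilinear_map_left[OF bil]] and right = linear_map_compose[OF bilinear_map_right[OF bil]]
  note closed = bilinear_map_closed[OF bil]
  have one: "\<one>\<^bsub>S\<^esub> = pre \<one> (wd [])" by (simp add: prepend_word)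
  show one_closed: "\<one>\<^bsub>S\<^esub> \<in> carrier S" using word_in_Sh[of "\<one>" "[]"] by simp
  show "x \<otimes>\<^bsub>S\<^esub> y = y \<otimes>\<^bsub>S\<^esub> x" if "x \<in> carrier S" "y \<in> carrier S" for x y
    by (rule Sh_bilinear_eqI[OF bil bilinear_map_flip[OF bil] that])
      (simp add: Sh_mult_prepend A.m_comm shuffle_commute)
  show "(x \<otimes>\<^bsub>S\<^esub> y) \<otimes>\<^bsub>S\<^esub> z = x \<otimes>\<^bsub>S\<^esub> (y \<otimes>\<^bsub>S\<^esub> z)" if x: "x \<in> carrier S" and y: "y \<in> carrier S" and z: "z \<in> carrier S" for x y z
  proof (rule Sh_prepend_eqI[OF x left[OF z bilinear_map_left[OF bil y]] bilinear_map_left[OF bil closed[OF y z]]])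
    fix a X assume aX: "a \<in> carrier A" "X \<in> carrier Sh'"
    note aX' = prepend_in_Sh[OF aX]
    show "(pre a X \<otimes>\<^bsub>S\<^esub> y) \<otimes>\<^bsub>S\<^esub> z = pre a X \<otimes>\<^bsub>S\<^esub> (y \<otimes>\<^bsub>S\<^esub> z)"
    proof (rule Sh_prepend_eqI[OF y left[OF z bilinear_map_right[OF bil aX']] right[OF aX' bilinear_map_left[OF bil z]]])
      fix b Y assume bY: "b \<in> carrier A" "Y \<in> carrier Sh'"
      note bY' = prepend_in_Sh[OF bY]
      show "(pre a X \<otimes>\<^bsub>S\<^esub> pre b Y) \<otimes>\<^bsub>S\<^esub> z = pre a X \<otimes>\<^bsub>S\<^esub> (pre b Y \<otimes>\<^bsub>S\<^esub> z)"
        by (rule Sh_prepend_eqI[OF z bilinear_map_right[OF bil closed[OF aX' bY']] right[OF aX' bilinear_map_right[OF bil bY']]])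
          (use aX bY in \<open>simp add: Sh_mult_prepend A.m_assoc shuffle_assoc shuffle_closed\<close>)
    qed
  qed
  show "\<one>\<^bsub>S\<^esub> \<otimes>\<^bsub>S\<^esub> x = x" if x: "x \<in> carrier S" for x
    by (rule Sh_prepend_eqI[OF x bilinear_map_right[OF bil one_closed] linear_map_id])
      (simp add: one Sh_mult_prepend Nil_shuffle word_closed del: Sh_simps)
qed

sublocale S: algebra k S
  by (rule Sh_is_algebra)

lemma letter_linear: "linear_map k A S (\<lambda>a. wd [a])"
  using word_Cons_linear[of "[]"] word_in_Sh[of _ "[]"] by (intro linear_map_into_Sh) auto

lemma letter_hom: "(\<lambda>a. wd [a]) \<in> ring_hom A S"
proof (rule ring_hom_memI)
  fix a b assume ab: "a \<in> carrier A" "b \<in> carrier A"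
  show "wd [a \<otimes> b] = wd [a] \<otimes>\<^bsub>S\<^esub> wd [b]"
    using ab Sh_mult_prepend[OF ab word_closed[of "[]"] word_closed[of "[]"]]
    by (simp add: prepend_word Nil_shuffle word_closed)
qed (use linear_map_closed[OF letter_linear] linear_map_add[OF letter_linear] in auto)

lemma Sh_P_linear: "linear_map k S S (Sh_P k A)"
  unfolding Sh_P_def
  by (intro linear_map_into_Sh linear_map_from_Sh bilinear_map_right[OF prepend_bilinear])
    (use Sh_subset in \<open>auto intro: prepend_in_Sh\<close>)

text \<open>A word of length at least 2 is thus a letter times a value of \<open>P\<close>. Letters,
  products and \<open>P\<close> generate Sh(A), which is the reason why extensions are
  unique.\<close>

lemma letter_mult_Sh_P:
  assumes "a \<in> carrier A" "x \<in> carrier S"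
  shows "wd [a] \<otimes>\<^bsub>S\<^esub> Sh_P k A x = pre a x"
proof -
  have x: "x \<in> carrier Sh'" using assms Sh_subset by auto
  show ?thesis
    using Sh_mult_prepend[OF assms(1) A.one_closed word_closed[of "[]"] x] assms x
    by (simp add: Sh_P_def prepend_word Nil_shuffle)
qed

end


section \<open>TD operators and the universal property of \<open>Sh(A)\<close>\<close>

text \<open>The TD equation of weight \<open>l\<close> says that \<open>Q\<close> carries this
  product to the multiplication of \<open>R\<close>.\<close>

definition td_product :: "('k, 'r) module \<Rightarrow> 'k \<Rightarrow> ('r \<Rightarrow> 'r) \<Rightarrow> 'r \<Rightarrow> 'r \<Rightarrow> 'r" where
  "td_product R l Q x y =
    x \<otimes>\<^bsub>R\<^esub> Q y \<oplus>\<^bsub>R\<^esub> Q x \<otimes>\<^bsub>R\<^esub> y \<oplus>\<^bsub>R\<^esub> l \<odot>\<^bsub>R\<^esub> (x \<otimes>\<^bsub>R\<^esub> y) \<ominus>\<^bsub>R\<^esub> x \<otimes>\<^bsub>R\<^esub> Q \<one>\<^bsub>R\<^esub> \<otimes>\<^bsub>R\<^esub> y"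

definition td_operator :: "'k ring \<Rightarrow> ('k, 'r) module \<Rightarrow> 'k \<Rightarrow> ('r \<Rightarrow> 'r) \<Rightarrow> bool" where
  "td_operator k R l Q \<longleftrightarrow> linear_map k R R Q \<and>
    (\<forall>x\<in>carrier R. \<forall>y\<in>carrier R. Q x \<otimes>\<^bsub>R\<^esub> Q y = Q (td_product R l Q x y))"

text \<open>Both sides of the TD equation are bilinear, so that it may be checked on spanning
  elements.\<close>

lemma
  fixes k :: "'k ring" and R :: "('k, 'r) module"
  assumes "algebra k R" and Q: "linear_map k R R Q" and l: "l \<in> carrier k"
  shows operator_mult_bilinear: "bilinear_map k R R R (\<lambda>x y. Q x \<otimes>\<^bsub>R\<^esub> Q y)"
    and operator_td_product_bilinear: "bilinear_map k R R R (\<lambda>x y. Q (td_product R l Q x y))"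
proof -
  interpret R: algebra k R by fact
  note mult = linear_map_mult_left[OF assms(1)] linear_map_mult_right[OF assms(1)]
  show "bilinear_map k R R R (\<lambda>x y. Q x \<otimes>\<^bsub>R\<^esub> Q y)"
    by (intro bilinear_mapI mult Q linear_map_closed[OF Q])
  show "bilinear_map k R R R (\<lambda>x y. Q (td_product R l Q x y))"
    unfolding td_product_def
    by (intro bilinear_mapI linear_map_compose[OF Q] linear_map_plus linear_map_diff linear_map_scale mult Q l
        linear_map_id linear_map_closed[OF Q] R.module R.one_closed R.m_closed)
qed

context td_algebra
begin

text \<open>Commutativity and associativity move the middle factor \<open>wd [\<one>]\<close> to the
  front, where multiplication by it is explicit.\<close>

lemma shuffle_letter_one_shuffle:
  assumes X: "X \<in> carrier Sh'" and Y: "Y \<in> carrier Sh'"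
  shows "(X \<star> wd [\<one>]) \<star> Y =
    pre \<one> (X \<star> Y) \<boxplus> l \<bullet> (X \<star> Y) \<boxminus> l \<bullet> (aug X \<bullet> (aug Y \<bullet> wd []))"
proof -
  have e: "wd [] \<in> carrier Sh'" "wd [\<one>] \<in> carrier Sh'" by (simp_all add: word_closed)
  have aug: "aug X \<in> carrier k" "aug Y \<in> carrier k" using X Y by (simp_all add: aug_closed)
  note closed = e aug X Y prepend_closed shuffle_closed
  have "(X \<star> wd [\<one>]) \<star> Y = wd [\<one>] \<star> (X \<star> Y)"
    using X Y e by (simp add: shuffle_commute[of X] shuffle_assoc)
  also have "\<dots> = pre \<one> (wd []) \<star> (X \<star> Y)" by (simp add: prepend_word)
  also have "\<dots> = pre \<one> (X \<star> Y) \<boxplus>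
      (l \<bullet> (X \<star> Y) \<boxminus> l \<bullet> (aug X \<bullet> (aug Y \<bullet> wd [])))"
    by (simp add: prepend_one_shuffle closed Nil_shuffle aug_word aug_shuffle a_minus_def G.smult_r_distr G.smult_r_minus G.smult_assoc1)
  also have "\<dots> = pre \<one> (X \<star> Y) \<boxplus> l \<bullet> (X \<star> Y) \<boxminus> l \<bullet> (aug X \<bullet> (aug Y \<bullet> wd []))"
    by (simp add: a_minus_def closed G.M.a_assoc)
  finally show ?thesis .
qed

text \<open>The original TD recursion, recovered for arbitrary tails. Its last summand corresponds
  to the term with \<open>Q \<one>\<close> in the TD equation, which the Nijenhuis form
  hides.\<close>

lemma prepend_shuffle_prepend_td:
  assumes a: "a \<in> carrier A" and b: "b \<in> carrier A" and X: "X \<in> carrier Sh'" and Y: "Y \<in> carrier Sh'"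
  shows "pre a X \<star> pre b Y = pre a (X \<star> pre b Y) \<boxplus> pre b (pre a X \<star> Y)
    \<boxplus> l \<bullet> pre (a \<otimes> b) (X \<star> Y)
    \<boxminus> pre (a \<otimes> b) ((X \<star> wd [\<one>]) \<star> Y)"
proof -
  have e: "wd [] \<in> carrier Sh'" "wd [a \<otimes> b] \<in> carrier Sh'" using a b by (simp_all add: word_closed)
  have aug: "aug X \<in> carrier k" "aug Y \<in> carrier k" using X Y by (simp_all add: aug_closed)
  note closed = e aug X Y a b prepend_closed shuffle_closed
  have rearrange: "p \<boxminus> q \<boxplus> s = p \<boxplus> t \<boxminus> (q \<boxplus> t \<boxminus> s)"
    if "p \<in> carrier Sh'" "q \<in> carrier Sh'" "s \<in> carrier Sh'" "t \<in> carrier Sh'" for p q s t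
  proof -
    have "p \<boxplus> t \<boxminus> (q \<boxplus> t \<boxminus> s) = (p \<boxplus> s \<boxplus> t) \<boxminus> (q \<boxplus> t)"
      using that by (simp add: a_minus_def G.M.minus_add G.M.a_ac)
    then show ?thesis
      using that G.M.minus_add_cancel(3)[of "p \<boxplus> s" q t] G.M.minus_add_cancel(5)[of p q s] by simp
  qed
  have "pre (a \<otimes> b) ((X \<star> wd [\<one>]) \<star> Y) = pre (a \<otimes> b) (pre \<one> (X \<star> Y)) \<boxplus> l \<bullet> pre (a \<otimes> b) (X \<star> Y)
      \<boxminus> l \<bullet> (aug X \<bullet> (aug Y \<bullet> wd [a \<otimes> b]))"
    by (simp add: shuffle_letter_one_shuffle closed bilinear_map_add_right[OF prepend_bilinear]
        bilinear_map_smult_right[OF prepend_bilinear] prepend_word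
        linear_map_minus[OF bilinear_map_right[OF prepend_bilinear] Sh_plus_is_module Sh_plus_is_module])
  then show ?thesis
    unfolding prepend_shuffle_prepend[OF assms] by (simp add: rearrange closed)
qed

text \<open>For \<open>x = pre a X\<close> and \<open>y = pre b Y\<close>, the TD product of
  \<open>x\<close> and \<open>y\<close> in Sh(A) is \<open>x \<star> y\<close>, since multiplying by
  \<open>P\<close> of the unit shuffles a tail with \<open>wd [\<one>]\<close>. Both sides of the TD
  equation are then \<open>pre \<one> (x \<star> y)\<close>.\<close>

lemma Sh_P_td_operator: "td_operator k S l (Sh_P k A)"
  unfolding td_operator_def
proof (intro conjI Sh_P_linear ballI)
  fix x y assume "x \<in> carrier S" "y \<in> carrier S"
  then show "Sh_P k A x \<otimes>\<^bsub>S\<^esub> Sh_P k A y = Sh_P k A (td_product S l (Sh_P k A) x y)"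
  proof (rule Sh_bilinear_eqI[OF operator_mult_bilinear[OF Sh_is_algebra Sh_P_linear l_closed]
        operator_td_product_bilinear[OF Sh_is_algebra Sh_P_linear l_closed]])
    fix a X b Y assume aX: "a \<in> carrier A" "X \<in> carrier Sh'" and bY: "b \<in> carrier A" "Y \<in> carrier Sh'"
    have "pre a X \<otimes>\<^bsub>S\<^esub> Sh_P k A \<one>\<^bsub>S\<^esub> = pre a (X \<star> wd [\<one>])"
      using aX by (simp add: Sh_P_def Sh_mult_prepend word_closed)
    then show "Sh_P k A (pre a X) \<otimes>\<^bsub>S\<^esub> Sh_P k A (pre b Y) = Sh_P k A (td_product S l (Sh_P k A) (pre a X) (pre b Y))"
      using aX bY S.a_closed S.smult_closed
      by (simp add: td_product_def Sh_P_def Sh_mult_prepend prepend_closed shuffle_closed word_closed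
          prepend_shuffle_prepend_td Sh_minus prepend_in_Sh)
  qed
qed

end

text \<open>These values are forced, because a longer word is its first letter times
  \<open>P\<close> of its tail. The empty word is not among the generators of Sh(A); zero is a
  default there.\<close>

fun td_lift_word :: "('k, 'r) module \<Rightarrow> ('a \<Rightarrow> 'r) \<Rightarrow> ('r \<Rightarrow> 'r) \<Rightarrow> 'a list \<Rightarrow> 'r" where
  "td_lift_word R f Q [] = \<zero>\<^bsub>R\<^esub>"
| "td_lift_word R f Q [a] = f a"
| "td_lift_word R f Q (a # b # w) = f a \<otimes>\<^bsub>R\<^esub> Q (td_lift_word R f Q (b # w))"

section \<open>Extension of an algebra map to Sh(A) along a TD operator\<close>

locale td_hom = td_algebra k A l + R: algebra k R
  for k :: "'k ring" and A :: "('k, 'a) module" and l :: 'k and R :: "('k, 'r) module" (structure) +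
  fixes f :: "'a \<Rightarrow> 'r" and Q :: "'r \<Rightarrow> 'r"
  assumes f_linear: "linear_map k A R f"
    and f_hom: "f \<in> ring_hom A R"
    and Q_td: "td_operator k R l Q"
begin

lemma Q_linear: "linear_map k R R Q"
  using Q_td by (simp add: td_operator_def)

lemmas f_closed = linear_map_closed[OF f_linear]
lemmas Q_closed = linear_map_closed[OF Q_linear]

abbreviation "lift_word \<equiv> td_lift_word R f Q"

lemma lift_word_closed: "w \<in> words \<Longrightarrow> lift_word w \<in> carrier R"
  by (induction w rule: induct_list012) (auto simp: f_closed Q_closed)

lemma lift_word_multilinear: "multilinear k A R lift_word"
proof (rule multilinearI)
  fix p s assume "p \<in> words" and s: "s \<in> words"
  then show "linear_map k A R (\<lambda>a. lift_word (p @ a # s))"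
  proof (induction p rule: list.induct)
    case Nil
    show ?case
    proof (cases s)
      case (Cons b w)
      then show ?thesis
        using linear_map_mult_left[OF R.algebra_axioms f_linear] s Q_closed lift_word_closed by simp
    qed (simp add: f_linear)
  next
    case (Cons c p)
    then have c: "f c \<in> carrier R" by (simp add: f_closed)
    have "lift_word ((c # p) @ a # s) = f c \<otimes> Q (lift_word (p @ a # s))" for a
      by (cases p) auto
    with linear_map_mult_right[OF R.algebra_axioms linear_map_compose[OF Q_linear Cons.IH] c] Cons.prems s
    show ?case by simp
  qed
qed (rule lift_word_closed)

definition "lift = pres_lift k R lift_word"

lemma lift_linear': "linear_map k Sh' R lift"
  unfolding lift_def by (rule word_lift_linear[OF R.module_axioms lift_word_multilinear])

lemma lift_linear: "linear_map k S R lift"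
  by (rule linear_map_from_Sh[OF lift_linear'])

lemma lift_word: "w \<in> words \<Longrightarrow> lift (wd w) = lift_word w"
  unfolding lift_def by (rule word_lift_word[OF R.module_axioms lift_word_multilinear])

text \<open>The extension of \<open>Q \<circ> lift\<close> to \<open>Sh\<^sup>+(A)\<close> that sends the unit of \<open>A\<^sup>\<otimes>\<^sup>0 = k\<close> to \<open>1\<close>. It is the map that
  is multiplicative for the shuffle product.\<close>

definition "tail_lift = pres_lift k R (\<lambda>w. if w = [] then \<one> else Q (lift_word w))"

lemma tail_lift_multilinear: "multilinear k A R (\<lambda>w. if w = [] then \<one> else Q (lift_word w))"
  using lift_word_closed linear_map_compose[OF Q_linear multilinear_linear[OF lift_word_multilinear]]
  by (intro multilinearI) (auto simp: Q_closed)

lemma tail_lift_linear: "linear_map k Sh' R tail_lift"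
  unfolding tail_lift_def by (rule word_lift_linear[OF R.module_axioms tail_lift_multilinear])

lemma tail_lift_word: "w \<in> words \<Longrightarrow> tail_lift (wd w) = (if w = [] then \<one> else Q (lift_word w))"
  unfolding tail_lift_def by (rule word_lift_word[OF R.module_axioms tail_lift_multilinear])

lemma tail_lift_Sh:
  assumes "x \<in> carrier S"
  shows "tail_lift x = Q (lift x)"
  by (rule Sh_eqI[OF assms linear_map_from_Sh[OF tail_lift_linear] linear_map_compose[OF Q_linear lift_linear]])
    (simp add: tail_lift_word lift_word del: in_lists_conv_set)

text \<open>The tail may have a degree-0 part: on the empty word \<open>tail_lift\<close> is
  \<open>\<one>\<close>, in accordance with the value \<open>f a\<close> on a letter.\<close>

lemma lift_prepend:
  assumes "a \<in> carrier A" "X \<in> carrier Sh'"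
  shows "lift (pre a X) = f a \<otimes> tail_lift X"
proof (rule word_eqI[OF assms(2)])
  show "linear_map k Sh' R (\<lambda>X. lift (pre a X))"
    by (rule linear_map_compose[OF lift_linear' bilinear_map_right[OF prepend_bilinear assms(1)]])
  show "linear_map k Sh' R (\<lambda>X. f a \<otimes> tail_lift X)"
    by (rule linear_map_mult_right[OF R.algebra_axioms tail_lift_linear f_closed[OF assms(1)]])
  fix w assume "w \<in> words"
  then show "lift (pre a (wd w)) = f a \<otimes> tail_lift (wd w)"
    using assms(1) f_closed
    by (cases w) (simp_all add: prepend_word lift_word tail_lift_word)
qed

lemmas tail_lift_closed = linear_map_closed[OF tail_lift_linear]

lemma f_one: "f \<one>\<^bsub>A\<^esub> = \<one>"
  using f_hom by (rule ring_hom_one)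

text \<open>On non-empty words this is the TD equation with first argument \<open>\<one>\<close>, in
  which the two summands \<open>Q \<one> \<otimes> y\<close> cancel. The \<open>aug\<close> term
  adjusts the value on the empty word, where the two \<lambda>-terms cancel.\<close>

lemma tail_lift_prepend_one:
  assumes "X \<in> carrier Sh'"
  shows "tail_lift (pre \<one>\<^bsub>A\<^esub> X) = Q \<one> \<otimes> tail_lift X \<ominus> l \<odot> tail_lift X \<oplus> l \<odot> (aug X \<odot> \<one>)"
proof (rule word_eqI[OF assms])
  show "linear_map k Sh' R (\<lambda>X. tail_lift (pre \<one>\<^bsub>A\<^esub> X))"
    by (rule linear_map_compose[OF tail_lift_linear bilinear_map_right[OF prepend_bilinear A.one_closed]])
  show "linear_map k Sh' R (\<lambda>X. Q \<one> \<otimes> tail_lift X \<ominus> l \<odot> tail_lift X \<oplus> l \<odot> (aug X \<odot> \<one>))"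
    by (intro linear_map_plus[OF R.module_axioms] linear_map_diff[OF R.module_axioms] linear_map_scale[OF R.module_axioms _ l_closed]
        linear_map_mult_right[OF R.algebra_axioms] tail_lift_linear linear_map_smult_left[OF R.module_axioms aug_linear] Q_closed R.one_closed)
  fix w assume w: "w \<in> words"
  show "tail_lift (pre \<one>\<^bsub>A\<^esub> (wd w)) = Q \<one> \<otimes> tail_lift (wd w) \<ominus> l \<odot> tail_lift (wd w) \<oplus> l \<odot> (aug (wd w) \<odot> \<one>)"
  proof (cases w)
    case Nil
    then show ?thesis
      by (simp add: prepend_word tail_lift_word aug_word f_one Q_closed R.minus_add_cancel)
  next
    case (Cons a v)
    let ?z = "lift_word w"
    have z: "?z \<in> carrier R" using w by (rule lift_word_closed)
    have "Q \<one> \<otimes> Q ?z = Q (Q ?z \<oplus> Q \<one> \<otimes> ?z \<oplus> l \<odot> ?z \<ominus> Q \<one> \<otimes> ?z)"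
      using Q_td z by (simp add: td_operator_def td_product_def Q_closed)
    also have "Q ?z \<oplus> Q \<one> \<otimes> ?z \<oplus> l \<odot> ?z \<ominus> Q \<one> \<otimes> ?z = Q ?z \<oplus> l \<odot> ?z"
      using z by (simp add: Q_closed R.minus_add_cancel)
    also have "Q \<dots> = Q (Q ?z) \<oplus> l \<odot> Q ?z"
      using z by (simp add: linear_map_add[OF Q_linear] linear_map_smult[OF Q_linear] Q_closed)
    finally have "Q \<one> \<otimes> Q ?z = Q (Q ?z) \<oplus> l \<odot> Q ?z" .
    moreover have "tail_lift (pre \<one>\<^bsub>A\<^esub> (wd w)) = Q (Q ?z)"
      using w Cons z by (simp add: prepend_word tail_lift_word f_one Q_closed)
    ultimately show ?thesis
      using w Cons z by (simp add: tail_lift_word aug_word Q_closed R.minus_add_cancel)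
  qed
qed

text \<open>For two non-empty words, the lift of their shuffle turns out to be the TD product of
  their lifts \<open>x\<close> and \<open>y\<close>; applying \<open>Q\<close>, the TD equation
  gives \<open>Q x \<otimes> Q y\<close>.\<close>

lemma tail_lift_shuffle:
  assumes "X \<in> carrier Sh'" "Y \<in> carrier Sh'"
  shows "tail_lift (X \<star> Y) = tail_lift X \<otimes> tail_lift Y"
proof (rule shuffle_eqI[OF bilinear_map_compose'[OF tail_lift_linear shuffle_bilinear]
      bilinear_map_compose[OF algebra_mult_bilinear[OF R.algebra_axioms] tail_lift_linear tail_lift_linear] assms])
  fix u v assume "u \<in> words" "v \<in> words"
  then show "tail_lift (wd u \<star> wd v) = tail_lift (wd u) \<otimes> tail_lift (wd v)"
  proof (induction u v rule: two_lists_induct)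
    case (Nil v)
    then show ?case
      using tail_lift_closed[OF word_closed] by (simp add: Nil_shuffle word_closed tail_lift_word[of "[]"] del: in_lists_conv_set)
  next
    case (Cons_Nil a u)
    then show ?case
      using tail_lift_closed[OF word_closed[of "a # u"]] by (simp add: shuffle_Nil word_closed tail_lift_word[of "[]"])
  next
    case (Cons_Cons a u b v)
    then have mem: "a \<in> carrier A" "b \<in> carrier A" "u \<in> words" "v \<in> words" by auto
    define X Y where "X = wd u" and "Y = wd v"
    have XY: "X \<in> carrier Sh'" "Y \<in> carrier Sh'" using mem by (simp_all add: X_def Y_def word_closed)
    have pre: "wd (a # u) = pre a X" "wd (b # v) = pre b Y"
      using mem by (simp_all add: X_def Y_def prepend_word)
    have IH: "tail_lift (X \<star> pre b Y) = tail_lift X \<otimes> tail_lift (pre b Y)"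
      "tail_lift (pre a X \<star> Y) = tail_lift (pre a X) \<otimes> tail_lift Y"
      "tail_lift (X \<star> Y) = tail_lift X \<otimes> tail_lift Y"
      using Cons_Cons pre by (simp_all add: X_def Y_def)
    define x y where "x = lift (pre a X)" and "y = lift (pre b Y)"
    have f: "f a \<in> carrier R" "f b \<in> carrier R" using mem f_closed by auto
    have fab: "f (a \<otimes>\<^bsub>A\<^esub> b) = f a \<otimes> f b" using mem ring_hom_mult[OF f_hom] by simp
    have t: "tail_lift X \<in> carrier R" "tail_lift Y \<in> carrier R" using XY tail_lift_closed by auto
    have aug: "aug X \<in> carrier k" "aug Y \<in> carrier k" using XY by (simp_all add: aug_closed)
    have xy: "x = f a \<otimes> tail_lift X" "y = f b \<otimes> tail_lift Y"
      using mem XY by (simp_all add: x_def y_def lift_prepend)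
    have xyR: "x \<in> carrier R" "y \<in> carrier R" using f t by (simp_all add: xy)
    have tails: "tail_lift (pre a X) = Q x" "tail_lift (pre b Y) = Q y"
      using mem XY by (simp_all add: tail_lift_Sh prepend_in_Sh x_def y_def)
    have QR: "Q x \<in> carrier R" "Q y \<in> carrier R" "Q \<one> \<in> carrier R" using xyR by (simp_all add: Q_closed)
    have e: "wd [a \<otimes>\<^bsub>A\<^esub> b] \<in> carrier Sh'" using mem by (simp add: word_closed)
    note closed = mem XY f t aug xyR QR e prepend_closed shuffle_closed
    let ?W = "f a \<otimes> f b"
    have pm: "lift (X' \<boxminus> Y') = lift X' \<ominus> lift Y'" if "X' \<in> carrier Sh'" "Y' \<in> carrier Sh'" for X' Y'
      using linear_map_minus[OF lift_linear' Sh_plus_is_module R.module_axioms that] .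
    have "lift (pre a X \<star> pre b Y) = f a \<otimes> (tail_lift X \<otimes> Q y) \<oplus> f b \<otimes> (Q x \<otimes> tail_lift Y)
        \<ominus> ?W \<otimes> (Q \<one> \<otimes> (tail_lift X \<otimes> tail_lift Y) \<ominus> l \<odot> (tail_lift X \<otimes> tail_lift Y)
            \<oplus> l \<odot> (aug X \<otimes>\<^bsub>k\<^esub> aug Y \<odot> \<one>))
        \<oplus> l \<odot> (aug X \<odot> (aug Y \<odot> ?W))"
      by (simp add: prepend_shuffle_prepend closed linear_map_add[OF lift_linear'] linear_map_smult[OF lift_linear'] pm
          lift_prepend IH tails tail_lift_prepend_one fab aug_shuffle lift_word)
    also have "?W \<otimes> (Q \<one> \<otimes> (tail_lift X \<otimes> tail_lift Y) \<ominus> l \<odot> (tail_lift X \<otimes> tail_lift Y)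
            \<oplus> l \<odot> (aug X \<otimes>\<^bsub>k\<^esub> aug Y \<odot> \<one>)) =
        x \<otimes> Q \<one> \<otimes> y \<ominus> l \<odot> (x \<otimes> y) \<oplus> l \<odot> (aug X \<odot> (aug Y \<odot> ?W))"
    proof -
      have "?W \<otimes> (c \<odot> t) = c \<odot> (?W \<otimes> t)" if "c \<in> carrier k" "t \<in> carrier R" for c t
        using that f bilinear_map_smult_right[OF algebra_mult_bilinear[OF R.algebra_axioms]] by simp
      moreover have "?W \<otimes> (Q \<one> \<otimes> (tail_lift X \<otimes> tail_lift Y)) = x \<otimes> Q \<one> \<otimes> y"
        "?W \<otimes> (tail_lift X \<otimes> tail_lift Y) = x \<otimes> y"
        using closed by (simp_all add: xy R.m_ac)
      ultimately show ?thesis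
        using closed by (simp add: R.r_distr R.r_minus a_minus_def R.smult_assoc1)
    qed
    also have "f a \<otimes> (tail_lift X \<otimes> Q y) = x \<otimes> Q y"
      using closed by (simp add: xy(1) R.m_assoc)
    also have "f b \<otimes> (Q x \<otimes> tail_lift Y) = Q x \<otimes> y"
      using closed by (simp add: xy(2) R.m_lcomm)
    \<comment> \<open>The exceptional \<lambda>-term of the shuffle recursion cancels the
      \<open>aug\<close> term produced by the leading \<open>\<one>\<close> in the third
      summand.\<close>
    also have "x \<otimes> Q y \<oplus> Q x \<otimes> y \<ominus> (x \<otimes> Q \<one> \<otimes> y \<ominus> l \<odot> (x \<otimes> y)
          \<oplus> l \<odot> (aug X \<odot> (aug Y \<odot> ?W))) \<oplus> l \<odot> (aug X \<odot> (aug Y \<odot> ?W))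
        = x \<otimes> Q y \<oplus> Q x \<otimes> y \<oplus> l \<odot> (x \<otimes> y) \<ominus> x \<otimes> Q \<one> \<otimes> y"
    proof -
      have "p \<ominus> (q \<ominus> t \<oplus> s) \<oplus> s = p \<oplus> t \<ominus> q"
        if "p \<in> carrier R" "q \<in> carrier R" "s \<in> carrier R" "t \<in> carrier R" for p q s t
      proof -
        have "p \<ominus> (q \<ominus> t \<oplus> s) \<oplus> s = p \<oplus> t \<ominus> q \<ominus> s \<oplus> s"
          using that by (simp add: a_minus_def R.minus_add R.a_ac)
        then show ?thesis
          using that R.minus_add_cancel(2)[of "p \<oplus> t \<ominus> q" s] by simp
      qed
      then show ?thesis using closed by simp
    qed
    finally have "Q (lift (pre a X \<star> pre b Y)) = Q x \<otimes> Q y"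
      using Q_td xyR by (simp add: td_operator_def td_product_def)
    moreover have "pre a X \<star> pre b Y \<in> carrier S"
      using closed S.a_closed S.smult_closed S.minus_closed
      by (simp add: prepend_shuffle_prepend_td prepend_in_Sh word_closed Sh_minus[symmetric])
    ultimately show ?case
      unfolding pre by (simp add: tail_lift_Sh tails)
  qed
qed

text \<open>On \<open>pre a X\<close> the lift is \<open>f a\<close> times
  \<open>tail_lift X\<close>; the first factor is multiplicative on \<open>A\<close>, the second for
  the shuffle of tails.\<close>

lemma lift_ring_hom: "lift \<in> ring_hom S R"
proof (rule ring_hom_memI)
  fix x y assume "x \<in> carrier S" "y \<in> carrier S"
  then show "lift (x \<otimes>\<^bsub>S\<^esub> y) = lift x \<otimes> lift y"
  proof (rule Sh_bilinear_eqI[OF bilinear_map_compose'[OF lift_linear Sh_mult_bilinear]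
        bilinear_map_compose[OF algebra_mult_bilinear[OF R.algebra_axioms] lift_linear lift_linear]])
    fix a X b Y assume *: "a \<in> carrier A" "X \<in> carrier Sh'" "b \<in> carrier A" "Y \<in> carrier Sh'"
    then have "f a \<in> carrier R" "f b \<in> carrier R" "tail_lift X \<in> carrier R" "tail_lift Y \<in> carrier R"
      using f_closed tail_lift_closed by auto
    with * show "lift (pre a X \<otimes>\<^bsub>S\<^esub> pre b Y) = lift (pre a X) \<otimes> lift (pre b Y)"
      by (simp add: Sh_mult_prepend lift_prepend shuffle_closed tail_lift_shuffle ring_hom_mult[OF f_hom] R.m_ac)
  qed
qed (use linear_map_closed[OF lift_linear] linear_map_add[OF lift_linear] in \<open>auto simp: lift_word f_one\<close>)

lemma lift_letter: "a \<in> carrier A \<Longrightarrow> lift (wd [a]) = f a"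
  by (simp add: lift_word)

lemma lift_prepend_Sh: "a \<in> carrier A \<Longrightarrow> x \<in> carrier S \<Longrightarrow> lift (pre a x) = f a \<otimes> Q (lift x)"
  using Sh_subset by (auto simp: lift_prepend tail_lift_Sh)

lemma lift_Sh_P: "x \<in> carrier S \<Longrightarrow> lift (Sh_P k A x) = Q (lift x)"
  using linear_map_closed[OF lift_linear] by (simp add: Sh_P_def lift_prepend_Sh f_one Q_closed)

end

lemma (in td_algebra) hom_eqI:
  assumes "linear_map k S R g" "g \<in> ring_hom S R" "linear_map k S R h" "h \<in> ring_hom S R"
    and "\<And>a. a \<in> carrier A \<Longrightarrow> g (wd [a]) = h (wd [a])"
    and "\<And>x. x \<in> carrier S \<Longrightarrow> g (Sh_P k A x) = Q (g x)" "\<And>x. x \<in> carrier S \<Longrightarrow> h (Sh_P k A x) = Q (h x)"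
    and "x \<in> carrier S"
  shows "g x = h x"
  using assms(8)
proof (induction rule: Sh_induct_prepend)
  case (prepend a x)
  then show ?case
    using letter_mult_Sh_P[of a x] ring_hom_mult[OF assms(2), of "wd [a]" "Sh_P k A x"]
      ring_hom_mult[OF assms(4), of "wd [a]" "Sh_P k A x"] assms(5-7)
      linear_map_closed[OF letter_linear] linear_map_closed[OF Sh_P_linear] by metis
next
  case (add x y)
  then show ?case using linear_map_add[OF assms(1)] linear_map_add[OF assms(3)] by simp
qed (rule assms(5))


section \<open>Convolution and the right antipode of a connected filtered bialgebra\<close>

lemma ring_hom_compose: "g \<in> ring_hom N Q \<Longrightarrow> f \<in> ring_hom M N \<Longrightarrow> (\<lambda>x. g (f x)) \<in> ring_hom M Q"
  by (auto simp: ring_hom_def Pi_iff)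

lemma tensor_map_id:
  assumes "module_pair k M N" "t \<in> carrier (tensor k M N)"
  shows "tensor_map k M N (\<lambda>x. x) (\<lambda>y. y) t = t"
  by (rule module_pair.tensor_eqI[OF assms tensor_map_linear(1)[OF assms(1,1) linear_map_id linear_map_id] linear_map_id])
    (rule tensor_map_linear(2)[OF assms(1,1) linear_map_id linear_map_id])

lemma
  fixes k :: "'k ring" and H :: "('k, 'a) module"
  assumes "algebra k H"
  shows mult_lift_linear: "linear_map k (tensor k H H) H (pres_lift k H (\<lambda>(x, y). x \<otimes>\<^bsub>H\<^esub> y))"
    and mult_lift_pure: "x \<in> carrier H \<Longrightarrow> y \<in> carrier H \<Longrightarrow>
      pres_lift k H (\<lambda>(x, y). x \<otimes>\<^bsub>H\<^esub> y) (pure k H H x y) = x \<otimes>\<^bsub>H\<^esub> y"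
proof -
  interpret algebra_pair k H H by (intro algebra_pair.intro assms)
  note * = M.module algebra_mult_bilinear[OF assms]
  show "linear_map k (tensor k H H) H (pres_lift k H (\<lambda>(x, y). x \<otimes>\<^bsub>H\<^esub> y))"
    by (rule tensor_lift_linear[OF *])
  show "pres_lift k H (\<lambda>(x, y). x \<otimes>\<^bsub>H\<^esub> y) (pure k H H x y) = x \<otimes>\<^bsub>H\<^esub> y" if "x \<in> carrier H" "y \<in> carrier H"
    by (rule tensor_lift_pure[OF * that])
qed

context connected_filtered_left_counital_bialgebra
begin

interpretation HH: algebra_pair k H H
  by (intro algebra_pair.intro algebra_axioms)

abbreviation "conv \<equiv> convolution k H \<Delta>"
abbreviation "mu \<equiv> pres_lift k H (\<lambda>(x, y). x \<otimes>\<^bsub>H\<^esub> y)"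

lemma mu_map_linear:
  assumes "linear_map k H H f" "linear_map k H H g"
  shows "linear_map k (tensor k H H) H (\<lambda>t. mu (tensor_map k H H f g t))"
  by (rule linear_map_compose[OF mult_lift_linear[OF algebra_axioms]
        tensor_map_linear(1)[OF HH.module_pair_axioms HH.module_pair_axioms assms]])

lemma mu_map_pure:
  assumes "linear_map k H H f" "linear_map k H H g" "x \<in> carrier H" "y \<in> carrier H"
  shows "mu (tensor_map k H H f g (pure k H H x y)) = f x \<otimes>\<^bsub>H\<^esub> g y"
  using assms by (simp add: tensor_map_linear(2)[OF HH.module_pair_axioms HH.module_pair_axioms]
      mult_lift_pure[OF algebra_axioms] linear_map_closed)

lemma \<Delta>_closed: "x \<in> carrier H \<Longrightarrow> \<Delta> x \<in> carrier (tensor k H H)"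
  by (rule linear_map_closed[OF \<Delta>_linear])

lemma conv_linear: "linear_map k H H f \<Longrightarrow> linear_map k H H g \<Longrightarrow> linear_map k H H (conv f g)"
  unfolding convolution_def by (rule linear_map_compose[OF mu_map_linear \<Delta>_linear])

definition "unit_counit x = \<epsilon> x \<odot>\<^bsub>H\<^esub> \<one>\<^bsub>H\<^esub>"

definition "reduced_id x = x \<ominus>\<^bsub>H\<^esub> unit_counit x"

lemma unit_counit_linear: "linear_map k H H unit_counit"
  unfolding unit_counit_def by (rule linear_map_smult_left[OF module \<epsilon>_linear]) simp

lemma reduced_id_linear: "linear_map k H H reduced_id"
  unfolding reduced_id_def by (rule linear_map_diff[OF module linear_map_id unit_counit_linear])

text \<open>On the left factor, \<open>unit_counit\<close> passes through the counit: the map is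
  \<open>\<epsilon> \<otimes> id\<close> followed by the linear map taking
  \<open>c \<otimes> y\<close> to \<open>c\<close> times \<open>g y\<close>. Left counitality
  evaluates the latter at \<open>1 \<otimes> x\<close>.\<close>

lemma conv_unit_counit:
  assumes g: "linear_map k H H g" and x: "x \<in> carrier H"
  shows "conv unit_counit g x = g x"
proof -
  interpret K: algebra k "self_module k"
    by (rule self_module_is_algebra) (rule R_cring)
  interpret KH: module_pair k "self_module k" H ..
  let ?\<psi> = "pres_lift k H (\<lambda>(c, y). c \<odot>\<^bsub>H\<^esub> g y)"
  have bil: "bilinear_map k (self_module k) H H (\<lambda>c y. c \<odot>\<^bsub>H\<^esub> g y)"
  proof (rule bilinear_mapI)
    show "linear_map k H H (\<lambda>y. c \<odot>\<^bsub>H\<^esub> g y)" if "c \<in> carrier (self_module k)" for c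
      using that by (intro linear_map_scale[OF module g]) simp
    show "linear_map k (self_module k) H (\<lambda>c. c \<odot>\<^bsub>H\<^esub> g y)" if "y \<in> carrier H" for y
      by (rule linear_map_smult_left[OF module linear_map_id linear_map_closed[OF g that]])
  qed
  note \<psi> = KH.tensor_lift_linear[OF module bil]
  note \<epsilon>_id = tensor_map_linear[OF HH.module_pair_axioms KH.module_pair_axioms \<epsilon>_linear linear_map_id]
  have "mu (tensor_map k H H unit_counit g t) = ?\<psi> (tensor_map k (self_module k) H \<epsilon> (\<lambda>x. x) t)"
    if "t \<in> carrier (tensor k H H)" for t
  proof (rule HH.tensor_eqI[OF that mu_map_linear[OF unit_counit_linear g] linear_map_compose[OF \<psi> \<epsilon>_id(1)]])
    fix x y assume xy: "x \<in> carrier H" "y \<in> carrier H"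
    then have "\<epsilon> x \<in> carrier k" "g y \<in> carrier H"
      using linear_map_closed[OF \<epsilon>_linear] linear_map_closed[OF g] by auto
    then show "mu (tensor_map k H H unit_counit g (pure k H H x y)) = ?\<psi> (tensor_map k (self_module k) H \<epsilon> (\<lambda>x. x) (pure k H H x y))"
      using xy by (simp add: mu_map_pure[OF unit_counit_linear g] \<epsilon>_id(2) KH.tensor_lift_pure[OF module bil]
          unit_counit_def smult_assoc2)
  qed
  from this[OF \<Delta>_closed[OF x]] have "conv unit_counit g x = ?\<psi> (pure k (self_module k) H \<one>\<^bsub>k\<^esub> x)"
    using x by (simp add: convolution_def left_counit)
  also have "\<dots> = g x"
    using x linear_map_closed[OF g x] by (simp add: KH.tensor_lift_pure[OF module bil])
  finally show ?thesis .
qed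

text \<open>Splitting the identity into \<open>reduced_id\<close> and the left convolution unit is
  what turns the antipode equation into a fixed-point equation.\<close>

lemma conv_id:
  assumes g: "linear_map k H H g" and x: "x \<in> carrier H"
  shows "conv (\<lambda>x. x) g x = conv reduced_id g x \<oplus>\<^bsub>H\<^esub> g x"
proof -
  have "mu (tensor_map k H H (\<lambda>x. x) g t) = mu (tensor_map k H H reduced_id g t) \<oplus>\<^bsub>H\<^esub> mu (tensor_map k H H unit_counit g t)"
    if "t \<in> carrier (tensor k H H)" for t
  proof (rule HH.tensor_eqI[OF that mu_map_linear[OF linear_map_id g]
        linear_map_plus[OF module mu_map_linear[OF reduced_id_linear g] mu_map_linear[OF unit_counit_linear g]]])
    fix x y assume xy: "x \<in> carrier H" "y \<in> carrier H"
    then have *: "unit_counit x \<in> carrier H" "g y \<in> carrier H" "reduced_id x \<in> carrier H"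
      using linear_map_closed[OF unit_counit_linear] linear_map_closed[OF reduced_id_linear] linear_map_closed[OF g] by auto
    then have "reduced_id x \<oplus>\<^bsub>H\<^esub> unit_counit x = x"
      using xy by (simp add: reduced_id_def M.minus_add_cancel)
    then have "x \<otimes>\<^bsub>H\<^esub> g y = reduced_id x \<otimes>\<^bsub>H\<^esub> g y \<oplus>\<^bsub>H\<^esub> unit_counit x \<otimes>\<^bsub>H\<^esub> g y"
      using * by (metis l_distr)
    then show "mu (tensor_map k H H (\<lambda>x. x) g (pure k H H x y)) =
        mu (tensor_map k H H reduced_id g (pure k H H x y)) \<oplus>\<^bsub>H\<^esub> mu (tensor_map k H H unit_counit g (pure k H H x y))"
      using xy g by (simp add: mu_map_pure linear_map_id reduced_id_linear unit_counit_linear)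
  qed
  from this[OF \<Delta>_closed[OF x]] have "conv (\<lambda>x. x) g x = conv reduced_id g x \<oplus>\<^bsub>H\<^esub> conv unit_counit g x"
    by (simp add: convolution_def)
  then show ?thesis by (simp add: conv_unit_counit assms)
qed

lemma F_subset: "F n \<subseteq> carrier H"
  using F_exhaustive by auto

lemma F_le: "n \<le> m \<Longrightarrow> F n \<subseteq> F m"
  by (rule lift_Suc_mono_le[of F]) (rule F_mono)

text \<open>Connectedness makes \<open>F 0\<close> the set of multiples of the unit, on which
  \<mu>\<epsilon> is the identity because \<epsilon> preserves units.\<close>

lemma reduced_id_F0: "x \<in> F 0 \<Longrightarrow> reduced_id x = \<zero>\<^bsub>H\<^esub>"
  using ring_hom_one[OF \<epsilon>_hom] linear_map_smult[OF \<epsilon>_linear, of "\<one>\<^bsub>H\<^esub>"]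
  by (auto simp: connected reduced_id_def unit_counit_def a_minus_def M.r_neg)

text \<open>On \<open>F n\<close> the convolution with \<open>reduced_id\<close> on the left sees only the values of the right factor in
  filtration degree below \<open>n\<close>: the summand \<open>F 0 \<otimes> F n\<close> is killed because \<open>reduced_id\<close> vanishes on \<open>F 0\<close>.\<close>

lemma conv_reduced_id_cong:
  assumes f: "linear_map k H H f" and g: "linear_map k H H g"
    and eq: "\<And>q y. q < n \<Longrightarrow> y \<in> F q \<Longrightarrow> f y = g y" and x: "x \<in> F n"
  shows "conv reduced_id f x = conv reduced_id g x"
proof -
  let ?f = "\<lambda>t. mu (tensor_map k H H reduced_id f t)" and ?g = "\<lambda>t. mu (tensor_map k H H reduced_id g t)"
  let ?X = "\<Union>(p, q)\<in>insert (0, n) {(p, q). p + q = n \<and> p > 0 \<and> q > 0}. tensor_image k H H (F p) (F q)"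
  have image: "t \<in> carrier (tensor k H H) \<and> ?f t = ?g t"
    if t: "t \<in> tensor_image k H H (F p) (F q)" and pq: "(p, q) = (0, n) \<or> q < n" for t p q
  proof -
    let ?U = "H\<lparr>carrier := F p\<rparr>" and ?V = "H\<lparr>carrier := F q\<rparr>"
    have "module k ?U" "module k ?V"
      using submodule.submodule_is_module[OF F_submodule module] by auto
    then have UV: "module_pair k ?U ?V" by (intro module_pair.intro)
    have incl: "linear_map k ?U H (\<lambda>x. x)" "linear_map k ?V H (\<lambda>x. x)"
      using F_subset by (auto simp: linear_map_def)
    note incl_map = tensor_map_linear[OF UV HH.module_pair_axioms incl]
    \<comment> \<open>An element of the image is lifted to the tensor product of \<open>F p\<close>
      and \<open>F q\<close> themselves, which is spanned by pure tensors with factors in these two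
      filtration steps.\<close>
    from t obtain t' where t': "t' \<in> carrier (tensor k ?U ?V)" "t = tensor_map k H H (\<lambda>x. x) (\<lambda>y. y) t'"
      by (auto simp: tensor_image_def)
    have "?f (tensor_map k H H (\<lambda>x. x) (\<lambda>y. y) t') = ?g (tensor_map k H H (\<lambda>x. x) (\<lambda>y. y) t')"
    proof (rule module_pair.tensor_eqI[OF UV t'(1) linear_map_compose[OF mu_map_linear[OF reduced_id_linear f] incl_map(1)]
          linear_map_compose[OF mu_map_linear[OF reduced_id_linear g] incl_map(1)]])
      fix u v assume uv: "u \<in> carrier ?U" "v \<in> carrier ?V"
      then have uv': "u \<in> F p" "v \<in> F q" "u \<in> carrier H" "v \<in> carrier H" using F_subset by auto
      then have "reduced_id u \<otimes>\<^bsub>H\<^esub> f v = reduced_id u \<otimes>\<^bsub>H\<^esub> g v"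
        using pq eq reduced_id_F0 linear_map_closed[OF f] linear_map_closed[OF g] by auto
      then show "?f (tensor_map k H H (\<lambda>x. x) (\<lambda>y. y) (pure k ?U ?V u v)) = ?g (tensor_map k H H (\<lambda>x. x) (\<lambda>y. y) (pure k ?U ?V u v))"
        using uv uv' f g by (simp add: incl_map(2) mu_map_pure reduced_id_linear)
    qed
    with t' linear_map_closed[OF incl_map(1) t'(1)] show ?thesis by simp
  qed
  have X: "t \<in> carrier (tensor k H H) \<and> ?f t = ?g t" if "t \<in> ?X" for t
    using that image by auto
  have span: "\<Delta> x \<in> submodule_span k (tensor k H H) ?X"
    using F_comult x by blast
  have "?X \<subseteq> carrier (tensor k H H)"
    by (rule subsetI) (rule conjunct1[OF X])
  from linear_map_eq_on_span[OF mu_map_linear[OF reduced_id_linear f] mu_map_linear[OF reduced_id_linear g]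
      HH.tensor_is_module module this conjunct2[OF X] span]
  have "?f (\<Delta> x) = ?g (\<Delta> x)" .
  then show ?thesis by (simp add: convolution_def)
qed

text \<open>The starting map is already final on \<open>F 0\<close>, where convolution with
  \<open>reduced_id\<close> on the left vanishes; each further step gains one filtration
  degree.\<close>

primrec antipode_approx :: "nat \<Rightarrow> 'b \<Rightarrow> 'b" where
  "antipode_approx 0 = unit_counit"
| "antipode_approx (Suc n) = (\<lambda>x. unit_counit x \<ominus>\<^bsub>H\<^esub> conv reduced_id (antipode_approx n) x)"

lemma antipode_approx_linear: "linear_map k H H (antipode_approx n)"
  by (induction n) (auto intro: unit_counit_linear linear_map_diff[OF module unit_counit_linear conv_linear[OF reduced_id_linear]])

lemma antipode_approx_stable:
  "x \<in> F n \<Longrightarrow> n \<le> m \<Longrightarrow> antipode_approx m x = antipode_approx n x"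
proof (induction n arbitrary: m x rule: less_induct)
  case (less n)
  note lin = antipode_approx_linear
  have xH: "x \<in> carrier H" using less.prems F_subset by auto
  show ?case
  proof (cases n)
    case 0
    show ?thesis
    proof (cases m)
      case (Suc m')
      note zero = linear_map_const_zero[OF module]
      \<comment> \<open>On \<open>F 0\<close> the right factor may be replaced by the zero map,
        because agreement in degrees below 0 is vacuous.\<close>
      have "conv reduced_id (antipode_approx m') x = conv reduced_id (\<lambda>x. \<zero>\<^bsub>H\<^esub>) x"
        by (rule conv_reduced_id_cong[OF lin zero _ less.prems(1)]) (use 0 in simp)
      also have "\<dots> = \<zero>\<^bsub>H\<^esub>"
        unfolding convolution_def
        by (rule HH.tensor_eqI[OF \<Delta>_closed[OF xH] mu_map_linear[OF reduced_id_linear zero] zero])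
          (simp add: mu_map_pure[OF reduced_id_linear zero] linear_map_closed[OF reduced_id_linear])
      finally show ?thesis
        using 0 Suc linear_map_closed[OF unit_counit_linear xH] by (simp add: M.minus_zero_right)
    qed (use 0 in simp)
  next
    case (Suc n')
    with less.prems obtain m' where m: "m = Suc m'" "n' \<le> m'" by (cases m) auto
    have "conv reduced_id (antipode_approx m') x = conv reduced_id (antipode_approx n') x"
    proof (rule conv_reduced_id_cong[OF lin lin _ less.prems(1)])
      fix q y assume "q < n" "y \<in> F q"
      then show "antipode_approx m' y = antipode_approx n' y"
        using less.IH[of q y m'] less.IH[of q y n'] Suc m by simp
    qed
    then show ?thesis using Suc m by simp
  qed
qed

text \<open>The value is the same for every filtration step that contains \<open>x\<close>;
  \<open>LEAST\<close> merely fixes one of them.\<close>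

definition "antipode x = antipode_approx (LEAST n. x \<in> F n) x"

lemma antipode_eq: "x \<in> F n \<Longrightarrow> antipode x = antipode_approx n x"
  unfolding antipode_def by (rule antipode_approx_stable[symmetric]) (auto intro: LeastI Least_le)

lemma antipode_linear: "linear_map k H H antipode"
proof (rule linear_mapI)
  note lin = antipode_approx_linear
  have ex: "\<exists>n. x \<in> F n" if "x \<in> carrier H" for x using that F_exhaustive by auto
  fix x assume x: "x \<in> carrier H"
  then obtain n where n: "x \<in> F n" using ex by auto
  show "antipode x \<in> carrier H"
    using n x linear_map_closed[OF lin] by (simp add: antipode_eq)
  show "antipode (c \<odot>\<^bsub>H\<^esub> x) = c \<odot>\<^bsub>H\<^esub> antipode x" if "c \<in> carrier k" for c
    using n x that linear_map_smult[OF lin] submodule.smult_closed[OF F_submodule]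
    by (simp add: antipode_eq[of _ n])
  show "antipode (x \<oplus>\<^bsub>H\<^esub> y) = antipode x \<oplus>\<^bsub>H\<^esub> antipode y" if y: "y \<in> carrier H" for y
  proof -
    obtain m where m: "y \<in> F m" using ex y by auto
    define N where "N = max n m"
    have N: "x \<in> F N" "y \<in> F N" using n m F_le[of n N] F_le[of m N] by (auto simp: N_def)
    then have "x \<oplus>\<^bsub>H\<^esub> y \<in> F N" using submoduleE(5)[OF F_submodule] by auto
    with N x y show ?thesis
      by (simp add: antipode_eq[of _ N] linear_map_add[OF lin])
  qed
qed

lemma right_antipode_antipode: "right_antipode k H \<Delta> \<epsilon> antipode"
  unfolding right_antipode_def
proof (intro conjI antipode_linear ballI)
  fix x assume x: "x \<in> carrier H"
  then obtain n where n: "x \<in> F n" using F_exhaustive by auto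
  \<comment> \<open>One step more than \<open>n\<close>: the recursion can then be unfolded once,
    and the inner approximation \<open>antipode_approx n\<close> is exact in all degrees below
    \<open>n\<close>.\<close>
  then have "antipode x = antipode_approx (Suc n) x" using F_mono by (intro antipode_eq) auto
  also have "\<dots> = unit_counit x \<ominus>\<^bsub>H\<^esub> conv reduced_id antipode x"
  proof -
    have "conv reduced_id (antipode_approx n) x = conv reduced_id antipode x"
    proof (rule conv_reduced_id_cong[OF antipode_approx_linear antipode_linear _ n])
      fix q y assume "q < n" "y \<in> F q"
      then show "antipode_approx n y = antipode y" using F_le[of q n] by (intro antipode_eq[symmetric]) auto
    qed
    then show ?thesis by simp
  qed
  finally have "antipode x = unit_counit x \<ominus>\<^bsub>H\<^esub> conv reduced_id antipode x" .
  moreover have "unit_counit x \<in> carrier H" "conv reduced_id antipode x \<in> carrier H"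
    using x linear_map_closed[OF unit_counit_linear] linear_map_closed[OF conv_linear[OF reduced_id_linear antipode_linear]] by auto
  ultimately have "antipode x \<oplus>\<^bsub>H\<^esub> conv reduced_id antipode x = unit_counit x"
    and "conv reduced_id antipode x \<in> carrier H"
    by (simp_all add: M.minus_add_cancel)
  then have "conv reduced_id antipode x \<oplus>\<^bsub>H\<^esub> antipode x = unit_counit x"
    using x linear_map_closed[OF antipode_linear] M.a_comm by metis
  then show "convolution k H \<Delta> (\<lambda>x. x) antipode x = \<epsilon> x \<odot>\<^bsub>H\<^esub> \<one>\<^bsub>H\<^esub>"
    using x by (simp add: conv_id antipode_linear unit_counit_def)
qed

end


section \<open>The left counital Hopf algebra \<open>Sh(A)\<close>\<close>

text \<open>On pure tensors all four terms of the TD product share the left factor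
  \<open>x \<otimes> x'\<close>, because \<open>id \<otimes> Q\<close> sends the unit to
  \<open>\<one> \<otimes> Q \<one>\<close>. The TD equation of \<open>Q\<close> then applies in the
  right factor.\<close>

lemma tensor_map_td_operator:
  assumes "algebra_pair k M N" "td_operator k N l Q" and l: "l \<in> carrier k"
  shows "td_operator k (tensor k M N) l (tensor_map k M N (\<lambda>x. x) Q)"
proof -
  interpret algebra_pair k M N by fact
  let ?T = "tensor k M N" and ?Q = "tensor_map k M N (\<lambda>x. x) Q"
  have Q: "linear_map k N N Q" using assms(2) by (simp add: td_operator_def)
  note lin = tensor_map_linear(1)[OF module_pair_axioms module_pair_axioms linear_map_id Q]
  note val = tensor_map_linear(2)[OF module_pair_axioms module_pair_axioms linear_map_id Q]
  show ?thesis
    unfolding td_operator_def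
  proof (intro conjI lin ballI)
    fix t u assume "t \<in> carrier ?T" "u \<in> carrier ?T"
    then show "?Q t \<otimes>\<^bsub>?T\<^esub> ?Q u = ?Q (td_product ?T l ?Q t u)"
    proof (rule tensor_bilinear_eqI[OF operator_mult_bilinear[OF tensor_is_algebra lin l]
          operator_td_product_bilinear[OF tensor_is_algebra lin l]])
      fix x y x' y' assume xy: "x \<in> carrier M" "y \<in> carrier N" "x' \<in> carrier M" "y' \<in> carrier N"
      let ?r = "pure k M N (x \<otimes>\<^bsub>M\<^esub> x')"
      have QN: "Q y \<in> carrier N" "Q y' \<in> carrier N" "Q \<one>\<^bsub>N\<^esub> \<in> carrier N"
        using xy linear_map_closed[OF Q] by auto
      have r: "linear_map k N ?T ?r" using xy by (intro bilinear_map_right[OF pure_bilinear]) simp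
      have "?Q (pure k M N x y) \<otimes>\<^bsub>?T\<^esub> ?Q (pure k M N x' y') = ?r (Q y \<otimes>\<^bsub>N\<^esub> Q y')"
        using xy QN by (simp add: val tensor_mult_pure del: tensor_simps)
      also have "Q y \<otimes>\<^bsub>N\<^esub> Q y' = Q (td_product N l Q y y')"
        using assms(2) xy by (simp add: td_operator_def)
      also have "?r \<dots> = ?Q (?r (td_product N l Q y y'))"
        using xy QN l by (simp add: val td_product_def)
      also have "?r (td_product N l Q y y') = td_product ?T l ?Q (pure k M N x y) (pure k M N x' y')"
        using xy QN l
        by (simp add: td_product_def tensor_simps(5) val tensor_mult_pure linear_map_add[OF r] linear_map_smult[OF r]
            linear_map_minus[OF r N.module tensor_is_module] del: tensor_simps(1-4))
      finally show "?Q (pure k M N x y) \<otimes>\<^bsub>?T\<^esub> ?Q (pure k M N x' y') = ?Q (td_product ?T l ?Q (pure k M N x y) (pure k M N x' y'))" .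
    qed
  qed
qed

section \<open>Comultiplication, counit and antipode of Sh(A)\<close>

locale td_bialgebra = td_algebra k A l + B: left_counital_bialgebra k A \<Delta> \<epsilon>
  for k :: "'k ring" and A :: "('k, 'a) module" and l :: 'k and \<Delta> :: "'a \<Rightarrow> ('a \<times> 'a \<Rightarrow> 'k) set" and \<epsilon> :: "'a \<Rightarrow> 'k"
begin

abbreviation "K \<equiv> self_module k"
abbreviation "AA \<equiv> tensor k A A"
abbreviation "SS \<equiv> tensor k S S"
abbreviation "letter a \<equiv> wd [a]"
abbreviation "P \<equiv> Sh_P k A"
abbreviation "id_P \<equiv> tensor_map k S S (\<lambda>x. x) P"
abbreviation "letter_\<Delta> \<equiv> Sh_\<Delta>_letter k A l \<Delta>"
abbreviation "D \<equiv> Sh_\<Delta> k A l \<Delta>"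
abbreviation "E \<equiv> Sh_\<epsilon> k \<epsilon>"

lemma K_is_algebra: "algebra k K"
  by (rule self_module_is_algebra[OF A.R_cring])

sublocale K: algebra k K
  by (rule K_is_algebra)

sublocale AA: algebra_pair k A A ..
sublocale SS: algebra_pair k S S ..
sublocale S_SS: algebra_pair k S SS ..
sublocale SS_S: algebra_pair k SS S ..
sublocale A_AA: algebra_pair k A AA ..
sublocale AA_A: algebra_pair k AA A ..
sublocale KS: algebra_pair k K S ..
sublocale KA: algebra_pair k K A ..
sublocale AAA: module_triple k A A A ..
sublocale SSS: module_triple k S S S ..

lemmas pairs = AA.module_pair_axioms SS.module_pair_axioms S_SS.module_pair_axioms SS_S.module_pair_axioms
  A_AA.module_pair_axioms AA_A.module_pair_axioms KS.module_pair_axioms KA.module_pair_axioms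

lemmas letters = tensor_map_linear[OF pairs(1,2) letter_linear letter_linear]

lemma letter_\<Delta>_linear: "linear_map k A SS letter_\<Delta>"
  unfolding Sh_\<Delta>_letter_def by (rule linear_map_compose[OF letters(1) B.\<Delta>_linear])

lemma letter_\<Delta>_hom: "letter_\<Delta> \<in> ring_hom A SS"
  unfolding Sh_\<Delta>_letter_def
  by (rule ring_hom_compose[OF tensor_map_ring_hom[OF AA.algebra_pair_axioms SS.algebra_pair_axioms
        letter_linear letter_hom letter_linear letter_hom] B.\<Delta>_hom])

sublocale D: td_hom k A l SS letter_\<Delta> id_P
  by unfold_locales
    (rule letter_\<Delta>_linear letter_\<Delta>_hom tensor_map_td_operator[OF SS.algebra_pair_axioms Sh_P_td_operator l_closed])+

lemma D_eq: "D = D.lift"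
proof -
  have "Sh_\<Delta>_word k A l \<Delta> w = D.lift_word w" for w
    by (induction w rule: induct_list012) simp_all
  then have "Sh_\<Delta>_word k A l \<Delta> = D.lift_word" by (rule ext)
  then show ?thesis by (simp add: Sh_\<Delta>_def D.lift_def)
qed

sublocale E: td_hom k A l K \<epsilon> "\<lambda>_. \<zero>\<^bsub>k\<^esub>"
proof unfold_locales
  show "td_operator k K l (\<lambda>_. \<zero>\<^bsub>k\<^esub>)"
    using linear_map_const_zero[OF K.module] by (simp add: td_operator_def)
qed (rule B.\<epsilon>_linear B.\<epsilon>_hom)+

text \<open>With the zero operator, the factor contributed by the tail vanishes on every word of
  length at least 2.\<close>

lemma E_eq:
  assumes "X \<in> carrier S"
  shows "E X = E.lift X"
  unfolding Sh_\<epsilon>_def E.lift_def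
proof (rule word_lift_cong[OF K.module E.lift_word_multilinear])
  show "(case w of [a] \<Rightarrow> \<epsilon> a | _ \<Rightarrow> \<zero>\<^bsub>k\<^esub>) = E.lift_word w" if "w \<in> words" for w
    using that E.f_closed by (cases w rule: remdups_adj.cases) auto
qed (use assms Sh_subset in auto)

lemma D_linear: "linear_map k S SS D"
  unfolding D_eq by (rule D.lift_linear)

lemma D_hom: "D \<in> ring_hom S SS"
  unfolding D_eq by (rule D.lift_ring_hom)

lemma D_letter: "a \<in> carrier A \<Longrightarrow> D (letter a) = tensor_map k S S letter letter (\<Delta> a)"
  unfolding D_eq by (simp add: D.lift_letter Sh_\<Delta>_letter_def)

lemma D_P: "x \<in> carrier S \<Longrightarrow> D (P x) = id_P (D x)"
  unfolding D_eq by (rule D.lift_Sh_P)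

lemma E_linear: "linear_map k S K E"
  by (rule linear_map_cong[OF Sh_is_module E_eq, THEN iffD2, OF _ E.lift_linear])

lemma E_hom: "E \<in> ring_hom S K"
  using E.lift_ring_hom S.m_closed S.a_closed S.one_closed E_eq
  by (simp add: ring_hom_def Pi_iff del: Sh_simps)

lemma E_letter: "a \<in> carrier A \<Longrightarrow> E (letter a) = \<epsilon> a"
  using linear_map_closed[OF letter_linear] by (simp add: E_eq E.lift_letter)

lemma E_prepend: "a \<in> carrier A \<Longrightarrow> x \<in> carrier S \<Longrightarrow> E (pre a x) = \<zero>\<^bsub>k\<^esub>"
  using Sh_subset E.f_closed by (auto simp: E_eq prepend_in_Sh E.lift_prepend_Sh)

lemmas D_closed = linear_map_closed[OF D_linear]
lemmas \<Delta>_closed = linear_map_closed[OF B.\<Delta>_linear]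
lemmas S_id = linear_map_id[of k S]
lemmas A_id = linear_map_id[of k A]

lemma id_P_linear: "linear_map k SS SS id_P"
  by (rule D.Q_linear)

text \<open>Both sides intertwine \<open>P\<close> with
  \<open>id \<otimes> (id \<otimes> P)\<close>. On the left this is the rule for \<open>D\<close>
  after \<open>P\<close>, used in the outer and in the right factor; on the right it holds because
  the associator carries \<open>(id \<otimes> id) \<otimes> P\<close> to
  \<open>id \<otimes> (id \<otimes> P)\<close>. On letters the claim is coassociativity of
  \<open>A\<close>.\<close>

lemma D_coassoc:
  assumes x: "x \<in> carrier S"
  shows "tensor_map k S SS (\<lambda>x. x) D (D x) = tensor_assoc k S S S (tensor_map k SS S D (\<lambda>x. x) (D x))"
proof (rule hom_eqI[where Q = "tensor_map k S SS (\<lambda>x. x) id_P", OF _ _ _ _ _ _ _ x])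
  note id_D = tensor_map_linear[OF pairs(2,3) S_id D_linear]
  note D_id = tensor_map_linear[OF pairs(2,4) D_linear S_id]
  show "linear_map k S (tensor k S SS) (\<lambda>x. tensor_map k S SS (\<lambda>x. x) D (D x))"
    by (rule linear_map_compose[OF id_D(1) D_linear])
  show "linear_map k S (tensor k S SS) (\<lambda>x. tensor_assoc k S S S (tensor_map k SS S D (\<lambda>x. x) (D x)))"
    by (rule linear_map_compose[OF SSS.tensor_assoc_linear linear_map_compose[OF D_id(1) D_linear]])
  have id_hom: "(\<lambda>x. x) \<in> ring_hom S S" by (auto intro: ring_hom_memI)
  show "(\<lambda>x. tensor_map k S SS (\<lambda>x. x) D (D x)) \<in> ring_hom S (tensor k S SS)"
    by (rule ring_hom_compose[OF tensor_map_ring_hom[OF SS.algebra_pair_axioms S_SS.algebra_pair_axioms S_id id_hom D_linear D_hom] D_hom])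
  show "(\<lambda>x. tensor_assoc k S S S (tensor_map k SS S D (\<lambda>x. x) (D x))) \<in> ring_hom S (tensor k S SS)"
    by (rule ring_hom_compose[OF tensor_assoc_ring_hom[OF Sh_is_algebra Sh_is_algebra Sh_is_algebra]
        ring_hom_compose[OF tensor_map_ring_hom[OF SS.algebra_pair_axioms SS_S.algebra_pair_axioms D_linear D_hom S_id id_hom] D_hom]])
  show "tensor_map k S SS (\<lambda>x. x) D (D (letter a)) = tensor_assoc k S S S (tensor_map k SS S D (\<lambda>x. x) (D (letter a)))"
    if a: "a \<in> carrier A" for a
  proof -
    let ?\<iota> = "tensor_map k S S letter letter"
    note \<Delta>a = \<Delta>_closed[OF a]
    note D_letter_linear = linear_map_compose[OF D_linear letter_linear]
    have "tensor_map k S SS (\<lambda>x. x) D (D (letter a)) = tensor_map k S SS letter (\<lambda>b. D (letter b)) (\<Delta> a)"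
      using tensor_map_compose[OF pairs(1,2,3) letter_linear letter_linear S_id D_linear \<Delta>a] a by (simp add: D_letter)
    also have "\<dots> = tensor_map k S SS letter (\<lambda>b. ?\<iota> (\<Delta> b)) (\<Delta> a)"
      by (rule tensor_map_cong[OF pairs(1,3) letter_linear D_letter_linear _ _ \<Delta>a]) (simp_all add: D_letter)
    also have "\<dots> = tensor_map k S SS letter ?\<iota> (tensor_map k A AA (\<lambda>x. x) \<Delta> (\<Delta> a))"
      using tensor_map_compose[OF pairs(1,5,3) A_id B.\<Delta>_linear letter_linear letters(1) \<Delta>a] by simp
    also have "\<dots> = tensor_map k S SS letter ?\<iota> (tensor_assoc k A A A (tensor_map k AA A \<Delta> (\<lambda>x. x) (\<Delta> a)))"
      using B.coassoc[OF a] by simp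
    \<comment> \<open>Naturality of the associator for the embedding of letters in all three
      factors.\<close>
    also have "\<dots> = tensor_assoc k S S S (tensor_map k SS S ?\<iota> letter (tensor_map k AA A \<Delta> (\<lambda>x. x) (\<Delta> a)))"
      by (rule tensor_assoc_natural[OF AAA.module_triple_axioms SSS.module_triple_axioms letter_linear letter_linear letter_linear, symmetric])
        (rule linear_map_closed[OF tensor_map_linear(1)[OF pairs(1,6) B.\<Delta>_linear A_id] \<Delta>a])
    also have "tensor_map k SS S ?\<iota> letter (tensor_map k AA A \<Delta> (\<lambda>x. x) (\<Delta> a)) = tensor_map k SS S (\<lambda>b. ?\<iota> (\<Delta> b)) letter (\<Delta> a)"
      using tensor_map_compose[OF pairs(1,6,4) B.\<Delta>_linear A_id letters(1) letter_linear \<Delta>a] by simp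
    also have "\<dots> = tensor_map k SS S (\<lambda>b. D (letter b)) letter (\<Delta> a)"
      by (rule tensor_map_cong[OF pairs(1,4) D_letter_linear letter_linear _ _ \<Delta>a, symmetric]) (simp_all add: D_letter)
    also have "\<dots> = tensor_map k SS S D (\<lambda>x. x) (D (letter a))"
      using tensor_map_compose[OF pairs(1,2,4) letter_linear letter_linear D_linear S_id \<Delta>a] a by (simp add: D_letter)
    finally show ?thesis .
  qed
  fix y assume y: "y \<in> carrier S"
  note Dy = D_closed[OF y]
  show "tensor_map k S SS (\<lambda>x. x) D (D (P y)) = tensor_map k S SS (\<lambda>x. x) id_P (tensor_map k S SS (\<lambda>x. x) D (D y))"
  proof -
    have "tensor_map k S SS (\<lambda>x. x) D (D (P y)) = tensor_map k S SS (\<lambda>x. x) (\<lambda>z. D (P z)) (D y)"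
      using tensor_map_compose[OF pairs(2,2,3) S_id Sh_P_linear S_id D_linear Dy] y by (simp add: D_P)
    also have "\<dots> = tensor_map k S SS (\<lambda>x. x) (\<lambda>z. id_P (D z)) (D y)"
      by (rule tensor_map_cong[OF pairs(2,3) S_id linear_map_compose[OF D_linear Sh_P_linear] _ _ Dy]) (simp_all add: D_P)
    also have "\<dots> = tensor_map k S SS (\<lambda>x. x) id_P (tensor_map k S SS (\<lambda>x. x) D (D y))"
      using tensor_map_compose[OF pairs(2,3,3) S_id D_linear S_id id_P_linear Dy] by simp
    finally show ?thesis .
  qed
  show "tensor_assoc k S S S (tensor_map k SS S D (\<lambda>x. x) (D (P y))) =
      tensor_map k S SS (\<lambda>x. x) id_P (tensor_assoc k S S S (tensor_map k SS S D (\<lambda>x. x) (D y)))"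
  proof -
    \<comment> \<open>The identity on the left pair is written as \<open>id \<otimes> id\<close>, so
      that naturality of the associator applies with the maps id, id and \<open>P\<close>.\<close>
    let ?id = "tensor_map k S S (\<lambda>x. x) (\<lambda>x. x)"
    note id = tensor_map_linear(1)[OF pairs(2,2) S_id S_id]
    have "tensor_map k SS S D (\<lambda>x. x) (D (P y)) = tensor_map k SS S D P (D y)"
      using tensor_map_compose[OF pairs(2,2,4) S_id Sh_P_linear D_linear S_id Dy] y by (simp add: D_P)
    also have "\<dots> = tensor_map k SS S (\<lambda>x. ?id (D x)) P (D y)"
      by (rule tensor_map_cong[OF pairs(2,4) D_linear Sh_P_linear _ _ Dy]) (simp_all add: tensor_map_id[OF pairs(2)] D_closed del: tensor_simps)
    also have "\<dots> = tensor_map k SS S ?id P (tensor_map k SS S D (\<lambda>x. x) (D y))"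
      using tensor_map_compose[OF pairs(2,4,4) D_linear S_id id Sh_P_linear Dy] by simp
    finally show ?thesis
      using tensor_assoc_natural[OF SSS.module_triple_axioms SSS.module_triple_axioms S_id S_id Sh_P_linear
          linear_map_closed[OF D_id(1) Dy]] by simp
  qed
qed

text \<open>The map taking \<open>x\<close> to \<open>1 \<otimes> x\<close> is itself an algebra map
  that intertwines \<open>P\<close> with \<open>id \<otimes> P\<close>. Since \<open>D\<close> moves
  \<open>P\<close> into the right factor only, applying \<open>E\<close> in the left factor commutes
  with it.\<close>

lemma D_left_counit:
  assumes x: "x \<in> carrier S"
  shows "tensor_map k K S E (\<lambda>x. x) (D x) = pure k K S \<one>\<^bsub>k\<^esub> x"
proof (rule hom_eqI[where Q = "tensor_map k K S (\<lambda>x. x) P", OF _ _ _ _ _ _ _ x])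
  note E_id = tensor_map_linear[OF pairs(2,7) E_linear S_id]
  have id_hom: "(\<lambda>x. x) \<in> ring_hom S S" by (auto intro: ring_hom_memI)
  have K_id: "linear_map k K K (\<lambda>x. x)" by (rule linear_map_id)
  show "linear_map k S (tensor k K S) (\<lambda>x. tensor_map k K S E (\<lambda>x. x) (D x))"
    by (rule linear_map_compose[OF E_id(1) D_linear])
  show "(\<lambda>x. tensor_map k K S E (\<lambda>x. x) (D x)) \<in> ring_hom S (tensor k K S)"
    by (rule ring_hom_compose[OF tensor_map_ring_hom[OF SS.algebra_pair_axioms KS.algebra_pair_axioms E_linear E_hom S_id id_hom] D_hom])
  show pure_linear: "linear_map k S (tensor k K S) (pure k K S \<one>\<^bsub>k\<^esub>)"
    by (rule bilinear_map_right[OF KS.pure_bilinear]) simp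
  show "pure k K S \<one>\<^bsub>k\<^esub> \<in> ring_hom S (tensor k K S)"
  proof (rule ring_hom_memI)
    fix x y assume "x \<in> carrier S" "y \<in> carrier S"
    then show "pure k K S \<one>\<^bsub>k\<^esub> (x \<otimes>\<^bsub>S\<^esub> y) = pure k K S \<one>\<^bsub>k\<^esub> x \<otimes>\<^bsub>tensor k K S\<^esub> pure k K S \<one>\<^bsub>k\<^esub> y"
      by (simp add: KS.tensor_mult_pure)
  qed (use linear_map_closed[OF pure_linear] linear_map_add[OF pure_linear] in auto)
  show "tensor_map k K S E (\<lambda>x. x) (D (letter a)) = pure k K S \<one>\<^bsub>k\<^esub> (letter a)" if a: "a \<in> carrier A" for a
  proof -
    note \<Delta>a = \<Delta>_closed[OF a]
    have "tensor_map k K S E (\<lambda>x. x) (D (letter a)) = tensor_map k K S (\<lambda>b. E (letter b)) letter (\<Delta> a)"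
      using tensor_map_compose[OF pairs(1,2,7) letter_linear letter_linear E_linear S_id \<Delta>a] a by (simp add: D_letter)
    also have "\<dots> = tensor_map k K S \<epsilon> letter (\<Delta> a)"
      by (rule tensor_map_cong[OF pairs(1,7) linear_map_compose[OF E_linear letter_linear] letter_linear _ _ \<Delta>a]) (simp_all add: E_letter)
    also have "\<dots> = tensor_map k K S (\<lambda>x. x) letter (tensor_map k K A \<epsilon> (\<lambda>x. x) (\<Delta> a))"
      using tensor_map_compose[OF pairs(1,8,7) B.\<epsilon>_linear A_id K_id letter_linear \<Delta>a] by simp
    also have "\<dots> = pure k K S \<one>\<^bsub>k\<^esub> (letter a)"
      using a tensor_map_linear(2)[OF pairs(8,7) K_id letter_linear, of "\<one>\<^bsub>k\<^esub>" a] by (simp add: B.left_counit)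
    finally show ?thesis .
  qed
  fix y assume y: "y \<in> carrier S"
  note Dy = D_closed[OF y]
  show "tensor_map k K S E (\<lambda>x. x) (D (P y)) = tensor_map k K S (\<lambda>x. x) P (tensor_map k K S E (\<lambda>x. x) (D y))"
    using tensor_map_compose[OF pairs(2,2,7) S_id Sh_P_linear E_linear S_id Dy]
      tensor_map_compose[OF pairs(2,7,7) E_linear S_id K_id Sh_P_linear Dy] y by (simp add: D_P)
  show "pure k K S \<one>\<^bsub>k\<^esub> (P y) = tensor_map k K S (\<lambda>x. x) P (pure k K S \<one>\<^bsub>k\<^esub> y)"
    using y tensor_map_linear(2)[OF pairs(7,7) K_id Sh_P_linear, of "\<one>\<^bsub>k\<^esub>" y] by simp
qed

lemma Sh_right_antipode:
  assumes "right_antipode k A \<Delta> \<epsilon> s"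
  shows "\<exists>s'. right_antipode k S D E s'"
proof -
  have s: "linear_map k A A s" and anti: "\<And>a. a \<in> carrier A \<Longrightarrow> convolution k A \<Delta> (\<lambda>x. x) s a = \<epsilon> a \<odot>\<^bsub>A\<^esub> \<one>\<^bsub>A\<^esub>"
    using assms by (auto simp: right_antipode_def)
  \<comment> \<open>The length test confines \<open>hd\<close> to one-letter words. That longer
    words are sent to zero is what the argument below relies on.\<close>
  define \<phi> where "\<phi> w = (if length w = 1 then letter (s (hd w)) else \<zero>\<^bsub>S\<^esub>)" for w
  have letter_s: "linear_map k A S (\<lambda>a. letter (s a))"
    by (rule linear_map_compose[OF letter_linear s])
  have \<phi>: "multilinear k A S \<phi>"
  proof (rule multilinearI)
    show "\<phi> w \<in> carrier S" if "w \<in> words" for w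
      using that linear_map_closed[OF letter_s] S.zero_closed by (cases w) (auto simp: \<phi>_def)
    show "linear_map k A S (\<lambda>a. \<phi> (p @ a # q))" if "p \<in> words" "q \<in> words" for p q
    proof (cases "p = [] \<and> q = []")
      case False
      then have "\<phi> (p @ a # q) = \<zero>\<^bsub>S\<^esub>" for a by (auto simp: \<phi>_def)
      then show ?thesis using linear_map_const_zero[OF Sh_is_module] by simp
    qed (use letter_s in \<open>simp add: \<phi>_def\<close>)
  qed
  define s' where "s' = pres_lift k S \<phi>"
  have s': "linear_map k S S s'"
    unfolding s'_def by (rule linear_map_from_Sh[OF word_lift_linear[OF Sh_is_module \<phi>]])
  have s'_word: "s' (wd w) = \<phi> w" if "w \<in> words" for w
    unfolding s'_def by (rule word_lift_word[OF Sh_is_module \<phi> that])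
  have s'_letter: "s' (letter a) = letter (s a)" if "a \<in> carrier A" for a
    using s'_word[of "[a]"] that by (simp add: \<phi>_def)
  have s'_prepend: "s' (pre a x) = \<zero>\<^bsub>S\<^esub>" if a: "a \<in> carrier A" and x: "x \<in> carrier S" for a x
  proof (rule Sh_eqI[OF x _ linear_map_const_zero[OF Sh_is_module]])
    have "linear_map k S S (pre a)"
      using a Sh_subset by (intro linear_map_into_Sh linear_map_from_Sh bilinear_map_right[OF prepend_bilinear]) (auto intro: prepend_in_Sh)
    then show "linear_map k S S (\<lambda>x. s' (pre a x))" by (rule linear_map_compose[OF s'])
    fix b w assume "b \<in> carrier A" "w \<in> words"
    then show "s' (pre a (wd (b # w))) = \<zero>\<^bsub>S\<^esub>"
      using a s'_word[of "a # b # w"] by (simp add: prepend_word \<phi>_def)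
  qed
  let ?\<mu> = "pres_lift k S (\<lambda>(x, y). x \<otimes>\<^bsub>S\<^esub> y)" and ?\<mu>A = "pres_lift k A (\<lambda>(x, y). x \<otimes>\<^bsub>A\<^esub> y)"
  note \<mu> = mult_lift_linear[OF Sh_is_algebra] mult_lift_pure[OF Sh_is_algebra]
  note \<mu>A = mult_lift_linear[OF A.algebra_axioms] mult_lift_pure[OF A.algebra_axioms]
  note id_s' = tensor_map_linear[OF pairs(2,2) S_id s']
  note id_s = tensor_map_linear[OF pairs(1,1) A_id s]
  note F = linear_map_compose[OF \<mu>(1) id_s'(1)]
  have conv_linear: "linear_map k S S (convolution k S D (\<lambda>x. x) s')"
    unfolding convolution_def by (rule linear_map_compose[OF F D_linear])
  have counit_linear: "linear_map k S S (\<lambda>x. E x \<odot>\<^bsub>S\<^esub> \<one>\<^bsub>S\<^esub>)"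
    by (rule linear_map_smult_left[OF Sh_is_module E_linear S.one_closed])
  have "convolution k S D (\<lambda>x. x) s' x = E x \<odot>\<^bsub>S\<^esub> \<one>\<^bsub>S\<^esub>" if "x \<in> carrier S" for x
    using that
  proof (induction rule: Sh_induct_prepend)
    case (letter a)
    note \<Delta>a = \<Delta>_closed[OF letter]
    have "convolution k S D (\<lambda>x. x) s' (letter a) = ?\<mu> (tensor_map k S S (\<lambda>x. x) s' (tensor_map k S S letter letter (\<Delta> a)))"
      using letter by (simp add: convolution_def D_letter)
    \<comment> \<open>The two convolutions correspond because \<open>letter\<close> is an algebra
      map that carries \<open>s\<close> to \<open>s'\<close>.\<close>
    also have "\<dots> = letter (?\<mu>A (tensor_map k A A (\<lambda>x. x) s (\<Delta> a)))"
    proof (rule AA.tensor_eqI[OF \<Delta>a linear_map_compose[OF F letters(1)] linear_map_compose[OF letter_linear linear_map_compose[OF \<mu>A(1) id_s(1)]]])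
      fix b c assume bc: "b \<in> carrier A" "c \<in> carrier A"
      have "s c \<in> carrier A" "letter b \<in> carrier S" "letter c \<in> carrier S" "letter (s c) \<in> carrier S"
        using bc linear_map_closed[OF s] linear_map_closed[OF letter_linear] by auto
      then show "?\<mu> (tensor_map k S S (\<lambda>x. x) s' (tensor_map k S S letter letter (pure k A A b c))) =
          letter (?\<mu>A (tensor_map k A A (\<lambda>x. x) s (pure k A A b c)))"
        using bc ring_hom_mult[OF letter_hom, of b "s c"] by (simp add: letters(2) id_s'(2) id_s(2) \<mu>(2) \<mu>A(2) s'_letter)
    qed
    also have "?\<mu>A (tensor_map k A A (\<lambda>x. x) s (\<Delta> a)) = \<epsilon> a \<odot>\<^bsub>A\<^esub> \<one>\<^bsub>A\<^esub>"
      using anti[OF letter] by (simp add: convolution_def)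
    also have "letter (\<epsilon> a \<odot>\<^bsub>A\<^esub> \<one>\<^bsub>A\<^esub>) = E (letter a) \<odot>\<^bsub>S\<^esub> \<one>\<^bsub>S\<^esub>"
      using letter E.f_closed linear_map_smult[OF letter_linear] by (simp add: E_letter)
    finally show ?case .
  next
    case (prepend a x)
    \<comment> \<open>Stated for arbitrary \<open>t\<close> and \<open>u\<close> in place of the
      comultiplications of \<open>a\<close> and \<open>x\<close>, so that linearity reduces the
      claim to pure tensors. There the right factor becomes \<open>letter c\<close> times
      \<open>P z\<close>, which is \<open>pre c z\<close> and is killed by
      \<open>s'\<close>.\<close>
    have zero: "?\<mu> (tensor_map k S S (\<lambda>x. x) s' (tensor_map k S S letter letter t \<otimes>\<^bsub>SS\<^esub> id_P u)) = \<zero>\<^bsub>S\<^esub>"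
      if t: "t \<in> carrier AA" and u: "u \<in> carrier SS" for t u
    proof (rule AA.tensor_eqI[OF t linear_map_compose[OF F linear_map_mult_left[OF SS.tensor_is_algebra letters(1) D.Q_closed[OF u]]]
          linear_map_const_zero[OF Sh_is_module]])
      fix b c assume bc: "b \<in> carrier A" "c \<in> carrier A"
      then have bc': "letter b \<in> carrier S" "letter c \<in> carrier S" using linear_map_closed[OF letter_linear] by auto
      then have p: "tensor_map k S S letter letter (pure k A A b c) \<in> carrier SS"
        using bc by (simp add: letters(2) SS.pure_closed del: tensor_simps)
      show "?\<mu> (tensor_map k S S (\<lambda>x. x) s' (tensor_map k S S letter letter (pure k A A b c) \<otimes>\<^bsub>SS\<^esub> id_P u)) = \<zero>\<^bsub>S\<^esub>"
      proof (rule SS.tensor_eqI[OF u linear_map_compose[OF F linear_map_mult_right[OF SS.tensor_is_algebra id_P_linear p]]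
            linear_map_const_zero[OF Sh_is_module]])
        fix y z assume yz: "y \<in> carrier S" "z \<in> carrier S"
        then have "P z \<in> carrier S" "letter b \<otimes>\<^bsub>S\<^esub> y \<in> carrier S" "pre c z \<in> carrier S"
          using linear_map_closed[OF Sh_P_linear] bc bc' S.m_closed Sh_subset by (auto intro: prepend_in_Sh)
        then show "?\<mu> (tensor_map k S S (\<lambda>x. x) s' (tensor_map k S S letter letter (pure k A A b c) \<otimes>\<^bsub>SS\<^esub> id_P (pure k S S y z))) = \<zero>\<^bsub>S\<^esub>"
          using bc bc' yz S.zero_closed S.r_null
          by (simp add: letters(2) tensor_map_linear(2)[OF pairs(2,2) S_id Sh_P_linear] SS.tensor_mult_pure letter_mult_Sh_P
              id_s'(2) \<mu>(2) s'_prepend)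
      qed
    qed
    have "D (pre a x) = tensor_map k S S letter letter (\<Delta> a) \<otimes>\<^bsub>SS\<^esub> id_P (D x)"
      using prepend unfolding D_eq by (simp add: D.lift_prepend_Sh Sh_\<Delta>_letter_def)
    then show ?case
      using prepend zero[OF \<Delta>_closed D_closed] S.smult_l_null[OF S.one_closed] by (simp add: convolution_def E_prepend)
  next
    case (add x y)
    then show ?case by (simp only: linear_map_add[OF conv_linear] linear_map_add[OF counit_linear])
  qed
  with s' show ?thesis by (auto simp: right_antipode_def)
qed

lemma Sh_left_counital_operated_bialgebra: "left_counital_operated_bialgebra k S D E P"
  by (intro left_counital_operated_bialgebra.intro left_counital_bialgebra.intro left_counital_bialgebra_axioms.intro
      left_counital_operated_bialgebra_axioms.intro Sh_is_algebra D_linear D_coassoc E_linear D_left_counit D_hom E_hom Sh_P_linear)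

end

theorem theorem4p6:
  fixes k :: "'k ring" and A :: "('k, 'a) module" and l :: 'k
    and \<Delta>\<^sub>A :: "'a \<Rightarrow> ('a \<times> 'a \<Rightarrow> 'k) set" and \<epsilon>\<^sub>A :: "'a \<Rightarrow> 'k"
    and F :: "nat \<Rightarrow> 'a set"
  assumes "connected_filtered_left_counital_bialgebra k A \<Delta>\<^sub>A \<epsilon>\<^sub>A F"
    and "l \<in> carrier k"
  shows "left_counital_hopf_algebra k (Sh k A l) (Sh_\<Delta> k A l \<Delta>\<^sub>A) (Sh_\<epsilon> k \<epsilon>\<^sub>A) (Sh_P k A)"
proof -
  interpret connected_filtered_left_counital_bialgebra k A \<Delta>\<^sub>A \<epsilon>\<^sub>A F by fact
  have "td_bialgebra k A l \<Delta>\<^sub>A \<epsilon>\<^sub>A"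
    by (intro td_bialgebra.intro td_algebra.intro td_algebra_axioms.intro algebra_axioms left_counital_bialgebra_axioms assms(2))
  then interpret S: td_bialgebra k A l \<Delta>\<^sub>A \<epsilon>\<^sub>A .
  show ?thesis
    using S.Sh_left_counital_operated_bialgebra S.Sh_right_antipode[OF right_antipode_antipode]
    by (intro left_counital_hopf_algebra.intro left_counital_hopf_algebra_axioms.intro)
qed

end
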